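(* Let $G=(V,E)$ be a finite simple connected graph. Suppose $V_N\subset V$ is an admissible support and $V=V_N\sqcup V_{ZN}\sqcup V_{ZZ}$ is the associated decomposition. Let $G_N$, $G_{ZN}$, $G_{ZZ}$ be the subgraphs of $G$ induced by $V_N$, $V_{ZN}$, $V_{ZZ}$ respectively. Let $h_N\in\mathcal S(G_N)$ have a simple eigenvalue $\lambda=\lambda_{k_N}(h_N)$ with (real) eigenvector $\psi_N$ which is non-zero on all of $V_N$. Let $h_{ZN}\in\mathcal S(G_{ZN})$ and $h_{ZZ}\in\mathcal S(G_{ZZ})$ be arbitrary matrices such that $\lambda$ is not an eigenvalue of $h_{ZN}$ nor of $h_{ZZ}$; let $k_{ZN}$ (respectively $k_{ZZ}$) be the number of eigenvalues of $h_{ZN}$ (respectively $h_{ZZ}$), counted with multiplicity, that are less than $\lambda$. Then, for any $\epsilon>0$, there exist a generic $h\in\mathcal S(G)$ and $h_\alpha\in\mathcal M_h$ such that (1) $\|h|G_N-h_N\|<\epsilon$, $\|h|G_{ZN}-h_{ZN}\|<\epsilon$, $\|h|G_{ZZ}-h_{ZZ}\|<\epsilon$; (2) $h_\alpha$ is a critical point of $\lambda_{k_N+k_{ZN}+k_{ZZ}}:\mathcal M_h\to\mathbb R$, which is a simple eigenvalue of $h_\alpha$ with the corresponding eigenvector supported on $V_N$.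
   Context: Graphs and matrices. $r\sim s$ means $(rs)\in E$. A matrix $h$ indexed by the vertices of a graph $G$ is supported on $G$ if for $r\ne s$, $h_{rs}\neq0\Rightarrow (rs)\in E$; strictly supported if for $r\neq s$, $h_{rs}\ne0\iff(rs)\in E$. $\mathcal H(G)$, $\mathcal S(G)$, $\mathcal A(G)$ are the spaces of complex Hermitian, real symmetric, real antisymmetric matrices supported on $G$. Eigenvalues of a Hermitian matrix are ordered $\lambda_1\le\lambda_2\le\dots$. For an induced subgraph $G_U$ on a vertex set $U$, $h|G_U$ is the principal submatrix with indices in $U$. Magnetic torus. For $h\in\mathcal S(G)$ strictly supported on $G$ and $\alpha\in\mathcal A(G)$ let $(h_\alpha)_{rs}=e^{i\alpha_{rs}}h_{rs}$. Matrices $h',h''\in\mathcal H(G)$ are gauge equivalent if $h''=e^{i\theta}h'e^{-i\theta}$ for some $\theta\in\mathbb R^V$, with $e^{i\theta}=\operatorname{diag}(e^{i\theta_1},\dots,e^{i\theta_n})$. $\mathcal M_h$ is the set of gauge equivalence classes of the matrices $h_\alpha$, $\alpha\in\mathcal A(G)$; writing $h_\alpha\in\mathcal M_h$ means the class of $h_\alpha$. It is a torus of dimension $|E|-|V|+1$: with $(d\theta)_{rs}=\theta_r-\theta_s$ for $(rs)\in E$, it is the quotient of $\mathcal A(G)$ by $d\mathbb R^V$ and by matrices with entries in $2\pi\mathbb Z$. The eigenvalue $\lambda_k$ descends to a function $\lambda_k:\mathcal M_h\to\mathbb R$, smooth near points where it is a simple eigenvalue. Genericity. A signing of a real symmetric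 matrix is a real symmetric matrix obtained by changing signs of some off-diagonal entries (symmetrically). $h\in\mathcal S(G)$ is generic if (i) $h$ is strictly supported on $G$; (ii) for any induced subgraph $G_J$ of $G$ (including $G_J=G$) and any signing $h'$ of $h|G_J$, all eigenvalues of $h'$ are simple, and every eigenvector of $h'$ is nowhere vanishing on exactly one connected component of $G_J$. Admissible support. A (nonempty) subset $V_N\subset V$ is an admissible support if the subgraph $G_N$ induced by $V_N$ is connected and each vertex $r\notin V_N$ has either no neighbors in $V_N$ or at least three neighbors in $V_N$. The associated decomposition is given by $V_{ZN}=\{r\notin V_N:\exists s\in V_N,\ (rs)\in E\}$ and $V_{ZZ}=V\setminus(V_N\cup V_{ZN})$. A vector is supported on $V_N$ if $V_N$ is its support, i.e. the set of vertices where it is non-zero. *)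

theory Defs
  imports "HOL-Analysis.Analysis" "Graph_Theory.Digraph_Component"
begin

text \<open>
  A finite simple graph is a digraph satisfying the locale predicate \<open>graph\<close> (finite, symmetric,
  without loops or parallel arcs).  A matrix indexed by the vertices of a graph with vertex set
  \<open>U\<close> is represented by its extension by zero to the finite type of all vertices, and likewise for
  vectors; hence matrices on an induced subgraph \<open>G \<restriction> U\<close> have the same type as
  matrices on \<open>G\<close>.
\<close>

definition supported_on :: "('v::finite, 'e) pre_digraph \<Rightarrow> 'a::zero ^'v^'v \<Rightarrow> bool" where
  "supported_on G M \<longleftrightarrow>
     (\<forall>r s. M $ r $ s \<noteq> 0 \<longrightarrow> r \<in> verts G \<and> s \<in> verts G \<and> (r \<noteq> s \<longrightarrow> r \<rightarrow>\<^bsub>G\<^esub> s))"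

definition strictly_supported_on :: "('v::finite, 'e) pre_digraph \<Rightarrow> 'a::zero ^'v^'v \<Rightarrow> bool" where
  "strictly_supported_on G M \<longleftrightarrow> supported_on G M \<and>
     (\<forall>r\<in>verts G. \<forall>s\<in>verts G. r \<noteq> s \<longrightarrow> (M $ r $ s \<noteq> 0 \<longleftrightarrow> r \<rightarrow>\<^bsub>G\<^esub> s))"

definition hermitian_on :: "('v::finite, 'e) pre_digraph \<Rightarrow> (complex^'v^'v) set" where
  "hermitian_on G = {M. supported_on G M \<and> (\<forall>r s. M $ s $ r = cnj (M $ r $ s))}"

definition symmetric_on :: "('v::finite, 'e) pre_digraph \<Rightarrow> (real^'v^'v) set" where
  "symmetric_on G = {M. supported_on G M \<and> transpose M = M}"

definition antisymmetric_on :: "('v::finite, 'e) pre_digraph \<Rightarrow> (real^'v^'v) set" where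
  "antisymmetric_on G = {M. supported_on G M \<and> transpose M = - M}"

definition principal_submatrix :: "'a::zero ^'v^'v \<Rightarrow> 'v::finite set \<Rightarrow> 'a^'v^'v" where
  "principal_submatrix M U = (\<chi> r s. if r \<in> U \<and> s \<in> U then M $ r $ s else 0)"

definition vec_support :: "'a::zero ^'v \<Rightarrow> 'v::finite set" where
  "vec_support x = {r. x $ r \<noteq> 0}"

text \<open>
  Spectral notions for a real symmetric or complex Hermitian matrix \<open>M\<close> with index set \<open>U\<close>.  The
  set \<open>U\<close> must be given, since the zero rows outside of \<open>U\<close> contribute no eigenvalues.  The
  multiplicity is the dimension of the eigenspace over the field of the entries, and
  \<open>eigenvalues U M\<close> lists the eigenvalues in increasing order, repeated according to multiplicity.
  The index \<open>k\<close> of \<open>eigenvalue_nth k U M\<close> starts from \<open>1\<close>.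
\<close>

definition eigenspace :: "'v set \<Rightarrow> 'a::real_field ^'v^'v \<Rightarrow> real \<Rightarrow> ('a^'v::finite) set" where
  "eigenspace U M \<mu> = {x. vec_support x \<subseteq> U \<and> M *v x = of_real \<mu> *s x}"

definition spectrum :: "'v::finite set \<Rightarrow> 'a::real_field ^'v^'v \<Rightarrow> real set" where
  "spectrum U M = {\<mu>. \<exists>x\<in>eigenspace U M \<mu>. x \<noteq> 0}"

definition multiplicity_of :: "'v::finite set \<Rightarrow> 'a::real_field ^'v^'v \<Rightarrow> real \<Rightarrow> nat" where
  "multiplicity_of U M \<mu> = vec.dim (eigenspace U M \<mu>)"

definition simple_eigenvalue :: "'v::finite set \<Rightarrow> 'a::real_field ^'v^'v \<Rightarrow> real \<Rightarrow> bool" where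
  "simple_eigenvalue U M \<mu> \<longleftrightarrow> multiplicity_of U M \<mu> = 1"

definition eigenvalues :: "'v::finite set \<Rightarrow> 'a::real_field ^'v^'v \<Rightarrow> real list" where
  "eigenvalues U M =
     concat (map (\<lambda>\<mu>. replicate (multiplicity_of U M \<mu>) \<mu>) (sorted_list_of_set (spectrum U M)))"

definition eigenvalue_nth :: "nat \<Rightarrow> 'v::finite set \<Rightarrow> 'a::real_field ^'v^'v \<Rightarrow> real" where
  "eigenvalue_nth k U M = eigenvalues U M ! (k - 1)"

definition count_below :: "'v::finite set \<Rightarrow> 'a::real_field ^'v^'v \<Rightarrow> real \<Rightarrow> nat" where
  "count_below U M c = length (filter (\<lambda>\<mu>. \<mu> < c) (eigenvalues U M))"

definition magnetic :: "real^'v^'v \<Rightarrow> real^'v^'v \<Rightarrow> complex^'v^'v::finite" where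
  "magnetic h \<alpha> = (\<chi> r s. exp (\<i> * complex_of_real (\<alpha> $ r $ s)) * complex_of_real (h $ r $ s))"

definition phase_matrix :: "real^'v \<Rightarrow> complex^'v^'v::finite" where
  "phase_matrix \<theta> = (\<chi> r s. if r = s then exp (\<i> * complex_of_real (\<theta> $ r)) else 0)"

definition gauge_rel :: "('v::finite, 'e) pre_digraph \<Rightarrow> (complex^'v^'v) rel" where
  "gauge_rel G = {(M, M'). M \<in> hermitian_on G \<and> M' \<in> hermitian_on G \<and>
     (\<exists>\<theta>. M' = phase_matrix \<theta> ** M ** phase_matrix (- \<theta>))}"

definition gauge_class :: "('v::finite, 'e) pre_digraph \<Rightarrow> complex^'v^'v \<Rightarrow> (complex^'v^'v) set" where
  "gauge_class G M = gauge_rel G `` {M}"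

definition magnetic_torus ::
    "('v::finite, 'e) pre_digraph \<Rightarrow> real^'v^'v \<Rightarrow> (complex^'v^'v) set set" where
  "magnetic_torus G h = (magnetic h ` antisymmetric_on G) // gauge_rel G"

text \<open>The function induced by an eigenvalue on gauge classes, on which it is constant.\<close>

definition torus_eigenvalue ::
    "nat \<Rightarrow> ('v::finite, 'e) pre_digraph \<Rightarrow> (complex^'v^'v) set \<Rightarrow> real" where
  "torus_eigenvalue k G c = the_elem (eigenvalue_nth k (verts G) ` c)"

text \<open>
  For strictly supported \<open>h\<close> the smooth structure of the magnetic torus is that of the quotient of
  the vector space \<open>antisymmetric_on G\<close>: the projection \<open>\<alpha> \<mapsto> gauge_class G (magnetic h \<alpha>)\<close> is a
  surjective submersion.  So \<open>F\<close> is differentiable at \<open>c\<close> with zero differential iff its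
  pullback to that space is so at the points over \<open>c\<close>.
\<close>

definition torus_critical_point ::
    "('v::finite, 'e) pre_digraph \<Rightarrow> real^'v^'v \<Rightarrow> ((complex^'v^'v) set \<Rightarrow> real)
      \<Rightarrow> (complex^'v^'v) set \<Rightarrow> bool" where
  "torus_critical_point G h F c \<longleftrightarrow> c \<in> magnetic_torus G h \<and>
     (\<forall>\<alpha>\<in>antisymmetric_on G. gauge_class G (magnetic h \<alpha>) = c \<longrightarrow>
        ((\<lambda>\<beta>. F (gauge_class G (magnetic h \<beta>))) has_derivative (\<lambda>_. 0))
          (at \<alpha> within antisymmetric_on G))"

definition signing :: "real^'v^'v \<Rightarrow> real^'v^'v::finite \<Rightarrow> bool" where
  "signing M M' \<longleftrightarrow> transpose M' = M' \<and> (\<forall>r. M' $ r $ r = M $ r $ r) \<and>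
     (\<forall>r s. M' $ r $ s = M $ r $ s \<or> M' $ r $ s = - M $ r $ s)"

text \<open>
  In a symmetric digraph, \<open>pre_digraph.sccs_verts\<close> is the set of the vertex sets of the connected
  components.
\<close>

definition generic :: "('v::finite, 'e) pre_digraph \<Rightarrow> real^'v^'v \<Rightarrow> bool" where
  "generic G h \<longleftrightarrow> h \<in> symmetric_on G \<and> strictly_supported_on G h \<and>
     (\<forall>J h'. J \<subseteq> verts G \<and> signing (principal_submatrix h J) h' \<longrightarrow>
        (\<forall>\<mu>\<in>spectrum J h'. simple_eigenvalue J h' \<mu>) \<and>
        (\<forall>\<mu>. \<forall>x\<in>eigenspace J h' \<mu>. x \<noteq> 0 \<longrightarrow>
           (\<exists>!C. C \<in> pre_digraph.sccs_verts (G \<restriction> J) \<and> (\<forall>r\<in>C. x $ r \<noteq> 0))))"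

definition admissible_support :: "('v, 'e) pre_digraph \<Rightarrow> 'v set \<Rightarrow> bool" where
  "admissible_support G U \<longleftrightarrow> U \<noteq> {} \<and> U \<subseteq> verts G \<and> Digraph_Component.connected (G \<restriction> U) \<and>
     (\<forall>r\<in>verts G - U. {s\<in>U. r \<rightarrow>\<^bsub>G\<^esub> s} = {} \<or> card {s\<in>U. r \<rightarrow>\<^bsub>G\<^esub> s} \<ge> 3)"

definition support_ZN :: "('v, 'e) pre_digraph \<Rightarrow> 'v set \<Rightarrow> 'v set" where
  "support_ZN G U = {r \<in> verts G - U. \<exists>s\<in>U. r \<rightarrow>\<^bsub>G\<^esub> s}"

definition support_ZZ :: "('v, 'e) pre_digraph \<Rightarrow> 'v set \<Rightarrow> 'v set" where
  "support_ZZ G U = verts G - (U \<union> support_ZN G U)"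

end

theory Submission
  imports Defs
begin

text \<open>
  Let \<open>h0\<close> be the block diagonal matrix with blocks \<open>h_N\<close>, \<open>h_ZN\<close>, \<open>h_ZZ\<close>; its eigenvalue \<open>\<mu>0\<close> is simple with
  index \<open>k_N + k_ZN + k_ZZ\<close>.  For \<open>h\<close> close to \<open>h0\<close> the block of \<open>h\<close> on \<open>V_N\<close> has a simple eigenpair \<open>(\<mu>, \<psi>)\<close>
  close to the given one.  If the flux \<open>\<alpha>\<close> lives on the edges between \<open>V_N\<close> and \<open>V_ZN\<close>, then \<open>\<psi>\<close>, extended
  by zero, is an eigenvector of \<open>h\<^sub>\<alpha>\<close> as soon as
  \<open>\<Sum>\<^sub>s exp (i \<alpha>\<^sub>r\<^sub>s) h\<^sub>r\<^sub>s \<psi>\<^sub>s = 0\<close> for every \<open>r\<close> in \<open>V_ZN\<close>.  Such phases exist when the numbers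
  \<open>h\<^sub>r\<^sub>s \<psi>\<^sub>s\<close> can be grouped into the sides of a triangle.  As \<open>r\<close> has at least three neighbours in \<open>V_N\<close>, this can be
  arranged on a nonempty open set of matrices \<open>h\<close> arbitrarily close to \<open>h0\<close>, and that set contains a
  generic matrix.  The point is critical by first order perturbation theory: the derivative of the eigenvalue in
  \<open>\<alpha>\<^sub>r\<^sub>s\<close> is proportional to the imaginary part of \<open>cnj \<psi>\<^sub>r (h\<^sub>\<alpha>)\<^sub>r\<^sub>s \<psi>\<^sub>s\<close>, which vanishes on all edges.

  Density of generic matrices: if an eigenvector on a connected set \<open>C\<close> vanishes at \<open>r\<close>, it is an eigenvector on
  \<open>C - {r}\<close>.  Generically the components of \<open>C - {r}\<close> have disjoint spectra (shift the diagonal), so it lives on one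
  component \<open>K\<close>, is nowhere zero there by induction, and is orthogonal to the row of \<open>r\<close>; this fails after perturbing a
  single entry between \<open>r\<close> and \<open>K\<close>.
\<close>

section \<open>Selfadjoint maps on subspaces\<close>

text \<open>Three obstacles shape the proof. First, the matrix is made generic after the target
  weights have been chosen, and the eigenvector on \<open>V_N\<close> moves along with it. The
  phases must therefore exist for a whole neighbourhood of weights, and the constants come in a
  fixed order: a bound for the total perturbation, then the strength of the coupling between
  \<open>V_N\<close> and \<open>V_ZN\<close>, and last a tolerance that is small relative to that
  coupling. Second, ordered eigenvalues are controlled through counts: a subspace on which the
  quadratic form lies below \<open>c\<close> has at most as many dimensions as there are eigenvalues
  below \<open>c\<close>. Applied to a map and to its negative, this bounds eigenvalues from both
  sides and yields a quadratic bound for their change, which is enough for a vanishing derivative.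
  Third, real blocks have to be compared with a complex matrix. Complex matrices are treated as
  real-linear maps, where every multiplicity doubles; this is the source of the factors 2 in the
  counts.\<close>

definition selfadjoint_on :: "'a::euclidean_space set \<Rightarrow> ('a \<Rightarrow> 'a) \<Rightarrow> bool" where
  "selfadjoint_on S f \<longleftrightarrow> subspace S \<and> linear f \<and> f ` S \<subseteq> S \<and> (\<forall>x\<in>S. \<forall>y\<in>S. f x \<bullet> y = x \<bullet> f y)"

text \<open>Eigenvalues are not stored: the one of \<open>b\<close> is recovered as the Rayleigh
  quotient \<open>f b \<bullet> b\<close>, so that eigenvalues with multiplicity become
  cardinalities of subsets of \<open>B\<close>, in the real and the complex case alike.\<close>

definition eigenbasis :: "'a::euclidean_space set \<Rightarrow> ('a \<Rightarrow> 'a) \<Rightarrow> 'a set \<Rightarrow> bool" where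
  "eigenbasis S f B \<longleftrightarrow> linear f \<and> finite B \<and> pairwise orthogonal B \<and>
     (\<forall>b\<in>B. norm b = 1 \<and> (\<exists>m. f b = m *\<^sub>R b)) \<and> span B = S"

text \<open>The Rayleigh quotient attains a maximum on the unit sphere of \<open>S\<close>. At a
  maximiser \<open>b\<close> the residual \<open>w\<close> must vanish, since a small move from
  \<open>b\<close> towards \<open>w\<close> would otherwise increase the quotient to first
  order.\<close>

lemma selfadjoint_on_unit_eigenvector:
  assumes "selfadjoint_on S f" "x \<in> S" "x \<noteq> 0"
  obtains b where "b \<in> S" "norm b = 1" "f b = (f b \<bullet> b) *\<^sub>R b"
proof -
  have S: "subspace S" and lin: "linear f" and inv: "\<And>x. x \<in> S \<Longrightarrow> f x \<in> S"
    and adj: "\<And>x y. x \<in> S \<Longrightarrow> y \<in> S \<Longrightarrow> f x \<bullet> y = x \<bullet> f y"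
    using assms by (auto simp: selfadjoint_on_def)
  let ?K = "S \<inter> sphere 0 1"
  have "compact ?K"
    using closed_subspace[OF S] by (intro closed_Int_compact) auto
  moreover have "(1 / norm x) *\<^sub>R x \<in> ?K"
    using assms(2,3) S by (simp add: subspace_scale)
  moreover have "continuous_on ?K (\<lambda>x. f x \<bullet> x)"
    by (intro continuous_on_inner linear_continuous_on continuous_on_id linear_conv_bounded_linear[THEN iffD1] lin)
  ultimately obtain b where b: "b \<in> ?K" and bmax: "\<And>y. y \<in> ?K \<Longrightarrow> f y \<bullet> y \<le> f b \<bullet> b"
    using continuous_attains_sup[of ?K "\<lambda>x. f x \<bullet> x"] by blast
  define m where "m = f b \<bullet> b"
  have form: "f v \<bullet> v \<le> m * (v \<bullet> v)" if "v \<in> S" for v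
  proof (cases "v = 0")
    case False
    have "(1 / norm v) *\<^sub>R v \<in> ?K" using that False S by (auto simp: subspace_scale)
    from bmax[OF this] have "f v \<bullet> v / (norm v * norm v) \<le> m"
      by (simp add: linear_cmul[OF lin] m_def field_simps)
    then show ?thesis using False
      by (simp add: divide_le_eq dot_square_norm power2_eq_square)
  qed (simp add: linear_0[OF lin])
  define w where "w = f b - m *\<^sub>R b"
  have wS: "w \<in> S" using b inv S by (simp add: w_def subspace_diff subspace_scale)
  define c where "c = m * (w \<bullet> w) - f w \<bullet> w"
  have c: "c \<ge> 0" using form[OF wS] by (simp add: c_def)
  have "w \<bullet> w = 0"
  proof (rule ccontr)
    assume nz: "w \<bullet> w \<noteq> 0"
    then have pos: "w \<bullet> w > 0" by simp
    \<comment> \<open>The second-order loss is \<open>t * t * c\<close>, the first-order gain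
      \<open>2 * t * (w \<bullet> w)\<close>. This \<open>t\<close> keeps the loss at no more than
      half the gain; adding 1 covers \<open>c = 0\<close>.\<close>
    define t where "t = (w \<bullet> w) / (c + 1)"
    have t: "t > 0" using pos c by (simp add: t_def)
    have bb: "b \<bullet> b = 1" "b \<bullet> f b = m" using b by (simp_all add: dot_square_norm m_def inner_commute)
    have "f (b + t *\<^sub>R w) \<bullet> (b + t *\<^sub>R w) \<le> m * ((b + t *\<^sub>R w) \<bullet> (b + t *\<^sub>R w))"
      using b wS S by (intro form) (auto simp: subspace_add subspace_scale)
    moreover have "f w \<bullet> b = f b \<bullet> w" using adj[OF wS, of b] b by (simp add: inner_commute)
    ultimately have "0 \<le> t * (t * c) - 2 * t * (f b \<bullet> w - m * (b \<bullet> w))"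
      using bb by (simp add: linear_add[OF lin] linear_cmul[OF lin] inner_simps c_def
          algebra_simps inner_commute)
    also have "f b \<bullet> w - m * (b \<bullet> w) = w \<bullet> w"
      by (simp add: w_def inner_simps inner_commute algebra_simps)
    finally have "0 \<le> t * (t * c - 2 * (w \<bullet> w))" by (simp add: algebra_simps)
    then have "2 * (w \<bullet> w) \<le> t * c" using t by (simp add: zero_le_mult_iff)
    also have "t * c \<le> w \<bullet> w" using c pos by (simp add: t_def field_simps)
    finally show False using pos by simp
  qed
  then have "f b = (f b \<bullet> b) *\<^sub>R b" by (simp add: w_def m_def)
  with b that show ?thesis by auto
qed

text \<open>Spectral theorem by induction on \<open>dim S\<close>: the orthogonal complement of an
  eigenvector inside \<open>S\<close> is again invariant, because \<open>f\<close> is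
  selfadjoint.\<close>

lemma selfadjoint_on_eigenbasis:
  assumes "selfadjoint_on S f"
  obtains B where "eigenbasis S f B"
proof -
  have "\<exists>B. eigenbasis S f B" using assms
  proof (induction "dim S" arbitrary: S rule: less_induct)
    case less
    have S: "subspace S" and lin: "linear f" and inv: "\<And>x. x \<in> S \<Longrightarrow> f x \<in> S"
      and adj: "\<And>x y. x \<in> S \<Longrightarrow> y \<in> S \<Longrightarrow> f x \<bullet> y = x \<bullet> f y"
      using less.prems by (auto simp: selfadjoint_on_def)
    show ?case
    proof (cases "S = {0}")
      case True
      then show ?thesis by (intro exI[of _ "{}"]) (simp add: eigenbasis_def lin)
    next
      case False
      then obtain x where "x \<in> S" "x \<noteq> 0" using subspace_0[OF S] by blast
      then obtain b where b: "b \<in> S" "norm b = 1" "f b = (f b \<bullet> b) *\<^sub>R b"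
        using selfadjoint_on_unit_eigenvector less.prems by blast
      have bb: "b \<bullet> b = 1" using b by (simp add: dot_square_norm)
      define T where "T = {x \<in> S. x \<bullet> b = 0}"
      have T: "subspace T" using S by (auto simp: T_def subspace_def inner_simps)
      have "b \<notin> T" using bb by (simp add: T_def)
      moreover have "T \<subseteq> S" by (auto simp: T_def)
      ultimately have "T \<subset> S" using b(1) by blast
      then have "dim T < dim S"
        using T S by (metis dim_psubset span_eq_iff)
      moreover have "selfadjoint_on T f" unfolding selfadjoint_on_def
      proof (intro conjI T lin)
        show "f ` T \<subseteq> T"
        proof clarsimp
          fix x assume x: "x \<in> T"
          have "f x \<bullet> b = x \<bullet> f b" using adj x b by (simp add: T_def)
          also have "\<dots> = (f b \<bullet> b) * (x \<bullet> b)" by (subst b(3)) simp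
          also have "\<dots> = 0" using x by (simp add: T_def)
          finally show "f x \<in> T" using x inv by (simp add: T_def)
        qed
      qed (use adj in \<open>auto simp: T_def\<close>)
      ultimately obtain B where B: "eigenbasis T f B" using less.hyps by blast
      have "span (insert b B) = S"
      proof
        have "B \<subseteq> S" using B span_superset[of B] by (auto simp: eigenbasis_def T_def)
        then show "span (insert b B) \<subseteq> S" using S b by (simp add: span_minimal)
        show "S \<subseteq> span (insert b B)"
        proof
          fix x assume x: "x \<in> S"
          have "x - (x \<bullet> b) *\<^sub>R b \<in> T"
            using x S b bb by (simp add: T_def subspace_diff subspace_scale inner_simps)
          then have "x - (x \<bullet> b) *\<^sub>R b \<in> span B" using B by (simp add: eigenbasis_def)
          then show "x \<in> span (insert b B)" by (auto simp: span_breakdown_eq)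
        qed
      qed
      moreover have "B \<subseteq> T" using B span_superset[of B] by (auto simp: eigenbasis_def)
      then have "\<forall>y\<in>B. orthogonal b y" by (auto simp: T_def orthogonal_def inner_commute)
      moreover have "\<exists>m. f b = m *\<^sub>R b" using b(3) by blast
      ultimately have "eigenbasis S f (insert b B)"
        using B b(2) lin by (auto simp: eigenbasis_def pairwise_insert orthogonal_commute)
      then show ?thesis by blast
    qed
  qed
  with that show ?thesis by blast
qed

lemma eigenbasis_inner:
  assumes "eigenbasis S f B" "b \<in> B" "b' \<in> B"
  shows "b \<bullet> b' = (if b = b' then 1 else 0)"
  using assms by (auto simp: eigenbasis_def pairwise_def orthogonal_def dot_square_norm)

lemma eigenbasis_eq:
  assumes "eigenbasis S f B" "b \<in> B"
  shows "f b = (f b \<bullet> b) *\<^sub>R b"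
  using assms by (auto simp: eigenbasis_def dot_square_norm)

lemma eigenbasis_subset: "eigenbasis S f B \<Longrightarrow> B \<subseteq> S"
  using span_superset by (auto simp: eigenbasis_def)

lemma eigenbasis_independent:
  assumes "eigenbasis S f B" shows "independent B"
  using assms by (intro pairwise_orthogonal_independent) (auto simp: eigenbasis_def)

lemma eigenbasis_card: "eigenbasis S f B \<Longrightarrow> card B = dim S"
  using eigenbasis_independent[of S f B] by (metis dim_eq_card_independent dim_span eigenbasis_def)

lemma eigenbasis_expand:
  assumes "eigenbasis S f B" "v \<in> S"
  shows "v = (\<Sum>b\<in>B. (v \<bullet> b) *\<^sub>R b)"
proof -
  have fin: "finite B" using assms by (simp add: eigenbasis_def)
  have "v \<in> span B" using assms by (simp add: eigenbasis_def)
  then obtain u where u: "v = (\<Sum>b\<in>B. u b *\<^sub>R b)" using span_finite[OF fin] by auto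
  have "v \<bullet> b = u b" if "b \<in> B" for b
  proof -
    have "v \<bullet> b = (\<Sum>b'\<in>B. if b' = b then u b else 0)"
      unfolding u inner_sum_left
      by (intro sum.cong refl) (use that eigenbasis_inner[OF assms(1)] in auto)
    then show ?thesis using that fin by (simp add: sum.delta)
  qed
  then show ?thesis by (subst u) simp
qed

lemma eigenbasis_inner_expand:
  assumes "eigenbasis S f B"
  shows "(\<Sum>b\<in>B. x b *\<^sub>R b) \<bullet> (\<Sum>b\<in>B. y b *\<^sub>R b) = (\<Sum>b\<in>B. x b * y b)"
proof -
  have fin: "finite B" using assms by (simp add: eigenbasis_def)
  have "(\<Sum>b\<in>B. x b *\<^sub>R b) \<bullet> (\<Sum>b\<in>B. y b *\<^sub>R b) = (\<Sum>b\<in>B. \<Sum>b'\<in>B. if b' = b then x b * y b else 0)"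
    unfolding inner_sum_left inner_sum_right using eigenbasis_inner[OF assms]
    by (intro sum.cong refl) (auto simp: )
  also have "\<dots> = (\<Sum>b\<in>B. x b * y b)" using fin by (simp add: sum.delta)
  finally show ?thesis .
qed

lemma eigenbasis_apply:
  assumes "eigenbasis S f B" "v \<in> S"
  shows "f v = (\<Sum>b\<in>B. ((f b \<bullet> b) * (v \<bullet> b)) *\<^sub>R b)"
proof -
  have lin: "linear f" and ev: "\<And>b. b \<in> B \<Longrightarrow> f b = (f b \<bullet> b) *\<^sub>R b"
    using assms(1) eigenbasis_eq by (auto simp: eigenbasis_def)
  have "f v = (\<Sum>b\<in>B. (v \<bullet> b) *\<^sub>R f b)"
    by (subst eigenbasis_expand[OF assms]) (simp add: linear_sum[OF lin] linear_cmul[OF lin])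
  also have "\<dots> = (\<Sum>b\<in>B. ((f b \<bullet> b) * (v \<bullet> b)) *\<^sub>R b)"
    by (intro sum.cong refl, subst ev) (auto simp: mult.commute)
  finally show ?thesis .
qed

lemma eigenbasis_norm:
  assumes "eigenbasis S f B" "v \<in> S"
  shows "v \<bullet> v = (\<Sum>b\<in>B. (v \<bullet> b)\<^sup>2)"
proof -
  have "v \<bullet> v = (\<Sum>b\<in>B. (v \<bullet> b) *\<^sub>R b) \<bullet> (\<Sum>b\<in>B. (v \<bullet> b) *\<^sub>R b)"
    by (intro arg_cong2[where f = inner] eigenbasis_expand[OF assms])
  then show ?thesis by (simp only: eigenbasis_inner_expand[OF assms(1)] power2_eq_square)
qed

lemma eigenbasis_form:
  assumes "eigenbasis S f B" "v \<in> S"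
  shows "f v \<bullet> v = (\<Sum>b\<in>B. (f b \<bullet> b) * (v \<bullet> b)\<^sup>2)"
proof -
  have "f v \<bullet> v = (\<Sum>b\<in>B. ((f b \<bullet> b) * (v \<bullet> b)) *\<^sub>R b) \<bullet> (\<Sum>b\<in>B. (v \<bullet> b) *\<^sub>R b)"
    by (intro arg_cong2[where f = inner] eigenbasis_expand[OF assms] eigenbasis_apply[OF assms])
  then show ?thesis by (simp only: eigenbasis_inner_expand[OF assms(1)] power2_eq_square mult.assoc)
qed

lemma eigenbasis_shift_norm:
  assumes "eigenbasis S f B" "v \<in> S"
  shows "(norm (f v - c *\<^sub>R v))\<^sup>2 = (\<Sum>b\<in>B. ((f b \<bullet> b) - c)\<^sup>2 * (v \<bullet> b)\<^sup>2)"
proof -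
  have "f v - c *\<^sub>R v = (\<Sum>b\<in>B. ((f b \<bullet> b) * (v \<bullet> b)) *\<^sub>R b) - c *\<^sub>R (\<Sum>b\<in>B. (v \<bullet> b) *\<^sub>R b)"
    by (intro arg_cong2[where f = minus] arg_cong2[where f = scaleR] refl eigenbasis_expand[OF assms] eigenbasis_apply[OF assms])
  also have "\<dots> = (\<Sum>b\<in>B. (((f b \<bullet> b) - c) * (v \<bullet> b)) *\<^sub>R b)"
    by (simp add: scaleR_sum_right sum_subtractf[symmetric] algebra_simps)
  finally show ?thesis unfolding power2_norm_eq_inner
    using eigenbasis_inner_expand[OF assms(1), of "\<lambda>b. ((f b \<bullet> b) - c) * (v \<bullet> b)" "\<lambda>b. ((f b \<bullet> b) - c) * (v \<bullet> b)"]
    by (simp add: power2_eq_square algebra_simps)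
qed

lemma eigenbasis_eigenspace:
  assumes "eigenbasis S f B"
  shows "{x \<in> S. f x = \<mu> *\<^sub>R x} = span {b \<in> B. f b \<bullet> b = \<mu>}" (is "?E = span ?C")
proof
  have fin: "finite B" and lin: "linear f" using assms by (auto simp: eigenbasis_def)
  show "?E \<subseteq> span ?C"
  proof
    fix x assume x: "x \<in> ?E"
    then have "(\<Sum>b\<in>B. ((f b \<bullet> b) - \<mu>)\<^sup>2 * (x \<bullet> b)\<^sup>2) = 0"
      using eigenbasis_shift_norm[OF assms, of x \<mu>] by simp
    then have z: "\<And>b. b \<in> B \<Longrightarrow> b \<notin> ?C \<Longrightarrow> x \<bullet> b = 0"
      using fin by (auto simp: sum_nonneg_eq_0_iff)
    have "x = (\<Sum>b\<in>B. (x \<bullet> b) *\<^sub>R b)" by (rule eigenbasis_expand[OF assms]) (use x in simp)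
    also have "\<dots> = (\<Sum>b\<in>?C. (x \<bullet> b) *\<^sub>R b)"
      using z fin by (intro sum.mono_neutral_right) auto
    also have "\<dots> \<in> span ?C" by (intro span_sum span_scale span_base)
    finally show "x \<in> span ?C" .
  qed
  have "subspace S" using assms subspace_span[of B] by (simp add: eigenbasis_def)
  moreover have "subspace {x. f x = \<mu> *\<^sub>R x}"
    by (simp add: subspace_def linear_add[OF lin] linear_cmul[OF lin] linear_0[OF lin] scaleR_right_distrib)
  moreover have "?E = S \<inter> {x. f x = \<mu> *\<^sub>R x}" by blast
  ultimately have "subspace ?E" by (simp only: subspace_inter)
  moreover have "?C \<subseteq> ?E"
  proof
    fix b assume b: "b \<in> ?C"
    then have "f b = \<mu> *\<^sub>R b" by (metis (mono_tags, lifting) mem_Collect_eq eigenbasis_eq[OF assms])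
    with b show "b \<in> ?E" using eigenbasis_subset[OF assms] by blast
  qed
  ultimately show "span ?C \<subseteq> ?E" by (simp add: span_minimal)
qed

lemma eigenbasis_dim_eigenspace:
  assumes "eigenbasis S f B"
  shows "dim {x \<in> S. f x = \<mu> *\<^sub>R x} = card {b \<in> B. f b \<bullet> b = \<mu>}"
proof -
  have "independent {b \<in> B. f b \<bullet> b = \<mu>}"
    by (rule independent_mono[OF eigenbasis_independent[OF assms]]) auto
  then show ?thesis unfolding eigenbasis_eigenspace[OF assms] by (simp add: dim_eq_card_independent)
qed

section \<open>Eigenvalue counts and their stability\<close>

lemma eigenbasis_span_sub:
  assumes "eigenbasis S f B" "C \<subseteq> B" "v \<in> span C"
  shows "v \<in> S" "\<And>b. b \<in> B - C \<Longrightarrow> v \<bullet> b = 0"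
proof -
  show "v \<in> S" using assms span_mono by (auto simp: eigenbasis_def)
  fix b assume b: "b \<in> B - C"
  show "v \<bullet> b = 0" using assms(3)
  proof (induction rule: span_induct_alt)
    case (step c x y)
    have "x \<bullet> b = 0" using eigenbasis_inner[OF assms(1), of x b] step assms(2) b by auto
    then show ?case using step by (simp add: inner_simps)
  qed simp
qed

text \<open>One half of the min-max principle. On the span of the eigenvectors with eigenvalue at
  least \<open>c\<close> the form is at least \<open>c\<close>, so \<open>P\<close> meets it only in
  0 and the two dimensions add up to at most \<open>dim S\<close>. The comparisons of eigenvalue
  counts of two maps rest on this.\<close>

lemma eigenbasis_inertia:
  assumes B: "eigenbasis S f B" and P: "subspace P" "P \<subseteq> S"
    and neg: "\<And>v. v \<in> P \<Longrightarrow> v \<noteq> 0 \<Longrightarrow> f v \<bullet> v < c * (v \<bullet> v)"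
  shows "dim P \<le> card {b \<in> B. f b \<bullet> b < c}"
proof -
  let ?C = "{b \<in> B. \<not> f b \<bullet> b < c}" and ?D = "{b \<in> B. f b \<bullet> b < c}"
  have fin: "finite B" using B by (simp add: eigenbasis_def)
  have ind: "independent ?C" "independent ?D"
    by (auto intro!: independent_mono[OF eigenbasis_independent[OF B]])
  have "P \<inter> span ?C = {0}"
  proof -
    have "v = 0" if v: "v \<in> P" "v \<in> span ?C" for v
    proof (rule ccontr)
      assume "v \<noteq> 0"
      have vS: "v \<in> S" and z: "\<And>b. b \<in> ?D \<Longrightarrow> v \<bullet> b = 0"
        using eigenbasis_span_sub[OF B _ v(2)] by auto
      have "c * (v \<bullet> v) = (\<Sum>b\<in>B. c * (v \<bullet> b)\<^sup>2)"
        using eigenbasis_norm[OF B vS] by (simp add: sum_distrib_left)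
      also have "\<dots> \<le> (\<Sum>b\<in>B. (f b \<bullet> b) * (v \<bullet> b)\<^sup>2)"
      proof (rule sum_mono)
        fix b assume "b \<in> B"
        then show "c * (v \<bullet> b)\<^sup>2 \<le> (f b \<bullet> b) * (v \<bullet> b)\<^sup>2"
          using z[of b] by (cases "b \<in> ?D") (auto intro: mult_right_mono)
      qed
      also have "\<dots> = f v \<bullet> v" using eigenbasis_form[OF B vS] by simp
      finally show False using neg[OF v(1) \<open>v \<noteq> 0\<close>] by simp
    qed
    then show ?thesis using P subspace_0 span_0 by auto
  qed
  then have "dim (P \<inter> span ?C) = 0" by (simp only: dim_eq_0)
  then have "dim P + dim (span ?C) = dim {x + y |x y. x \<in> P \<and> y \<in> span ?C}"
    using dim_sums_Int[OF P(1) subspace_span[of ?C]] by linarith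
  also have "\<dots> \<le> dim S"
  proof (rule dim_subset)
    show "{x + y |x y. x \<in> P \<and> y \<in> span ?C} \<subseteq> S"
    proof clarify
      fix x y assume "x \<in> P" "y \<in> span ?C"
      moreover have "subspace S" using B subspace_span by (auto simp: eigenbasis_def)
      moreover have "span ?C \<subseteq> S" using B span_mono[of ?C B] by (auto simp: eigenbasis_def)
      ultimately show "x + y \<in> S" using P by (auto intro: subspace_add)
    qed
  qed
  also have "\<dots> = card B" using eigenbasis_card[OF B] by simp
  also have "card B = card ?D + card ?C"
  proof -
    have "B = ?D \<union> ?C" "?D \<inter> ?C = {}" by auto
    with fin show ?thesis by (metis (lifting) card_Un_disjoint finite_Un)
  qed
  finally show ?thesis using ind by (simp add: dim_eq_card_independent)
qed

lemma eigenbasis_uminus: "eigenbasis S f B \<Longrightarrow> eigenbasis S (\<lambda>x. - f x) B"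
  unfolding eigenbasis_def by (auto simp: linear_compose_neg) (metis scaleR_minus_left)

lemma eigenbasis_span_form_le:
  assumes B: "eigenbasis S f B" and C: "C \<subseteq> B" "v \<in> span C"
    and le: "\<And>b. b \<in> C \<Longrightarrow> f b \<bullet> b \<le> m"
  shows "f v \<bullet> v \<le> m * (v \<bullet> v)"
proof -
  note vS = eigenbasis_span_sub[OF B C]
  have "(\<Sum>b\<in>B. (f b \<bullet> b) * (v \<bullet> b)\<^sup>2) \<le> (\<Sum>b\<in>B. m * (v \<bullet> b)\<^sup>2)"
  proof (rule sum_mono)
    fix b assume "b \<in> B"
    then show "(f b \<bullet> b) * (v \<bullet> b)\<^sup>2 \<le> m * (v \<bullet> b)\<^sup>2"
      using vS(2)[of b] le[of b] by (cases "b \<in> C") (auto intro: mult_right_mono)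
  qed
  then show ?thesis
    unfolding eigenbasis_form[OF B vS(1)] eigenbasis_norm[OF B vS(1)] by (simp add: sum_distrib_left)
qed

text \<open>Serves in two directions: an approximate eigenvector forces an eigenvalue nearby, and
  the component of an approximate eigenvector outside the eigenspace must be short.\<close>

lemma eigenbasis_shift_ge:
  assumes B: "eigenbasis S f B" and v: "v \<in> S" and d: "d \<ge> 0"
    and ge: "\<And>b. b \<in> B \<Longrightarrow> v \<bullet> b \<noteq> 0 \<Longrightarrow> d \<le> \<bar>f b \<bullet> b - c\<bar>"
  shows "d * norm v \<le> norm (f v - c *\<^sub>R v)"
proof -
  have "(d * norm v)\<^sup>2 = (\<Sum>b\<in>B. d\<^sup>2 * (v \<bullet> b)\<^sup>2)"
    unfolding power_mult_distrib power2_norm_eq_inner eigenbasis_norm[OF B v] by (simp add: sum_distrib_left)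
  also have "\<dots> \<le> (\<Sum>b\<in>B. ((f b \<bullet> b) - c)\<^sup>2 * (v \<bullet> b)\<^sup>2)"
  proof (rule sum_mono)
    fix b assume b: "b \<in> B"
    show "d\<^sup>2 * (v \<bullet> b)\<^sup>2 \<le> ((f b \<bullet> b) - c)\<^sup>2 * (v \<bullet> b)\<^sup>2"
    proof (cases "v \<bullet> b = 0")
      case False
      then have "d\<^sup>2 \<le> ((f b \<bullet> b) - c)\<^sup>2" using ge[OF b] d by (simp add: abs_le_square_iff[symmetric])
      then show ?thesis by (rule mult_right_mono) simp
    qed simp
  qed
  also have "\<dots> = (norm (f v - c *\<^sub>R v))\<^sup>2" by (rule eigenbasis_shift_norm[OF B v, symmetric])
  finally show ?thesis by (rule power2_le_imp_le) simp
qed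

lemma card_trichotomy:
  fixes g :: "'a \<Rightarrow> real"
  assumes "finite B"
  shows "card B = card {b \<in> B. g b < c} + card {b \<in> B. g b = c} + card {b \<in> B. c < g b}"
proof -
  have "B = ({b \<in> B. g b < c} \<union> {b \<in> B. g b = c}) \<union> {b \<in> B. c < g b}" by auto
  moreover have "({b \<in> B. g b < c} \<union> {b \<in> B. g b = c}) \<inter> {b \<in> B. c < g b} = {}"
    "{b \<in> B. g b < c} \<inter> {b \<in> B. g b = c} = {}" by auto
  ultimately show ?thesis using assms by (metis (lifting) card_Un_disjoint finite_Un)
qed

lemma eigenbasis_finite: "eigenbasis S f B \<Longrightarrow> finite B"
  by (simp add: eigenbasis_def)

lemma eigenbasis_dim_span:
  assumes "eigenbasis S f B" "C \<subseteq> B"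
  shows "dim (span C) = card C"
  using independent_mono[OF eigenbasis_independent[OF assms(1)] assms(2)] by (simp add: dim_eq_card_independent)

lemma eigenbasis_span_subset:
  assumes "eigenbasis S f B" "C \<subseteq> B"
  shows "span C \<subseteq> S"
  using span_mono[OF assms(2)] assms(1) by (simp add: eigenbasis_def)

lemma inner_le_norm_sq:
  fixes v :: "'a::real_inner"
  assumes "norm w \<le> \<eta> * norm v" shows "\<bar>w \<bullet> v\<bar> \<le> \<eta> * (v \<bullet> v)"
proof -
  have "\<bar>w \<bullet> v\<bar> \<le> norm w * norm v" by (rule Cauchy_Schwarz_ineq2)
  also have "\<dots> \<le> (\<eta> * norm v) * norm v" by (rule mult_right_mono[OF assms]) simp
  finally show ?thesis by (simp add: dot_square_norm power2_eq_square mult.assoc)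
qed

text \<open>The span of the old eigenvectors below \<open>c\<close> is the test space: there the old
  form is at most \<open>c - d\<close>, and the two errors of size \<open>\<eta>\<close>, in the
  form and in the threshold, do not use up the gap. Equality of counts comes later, by counting on
  both sides of the eigenvalue.\<close>

lemma eigenbasis_perturb_less:
  assumes B: "eigenbasis S f B" and B': "eigenbasis S f' B'"
    and gap: "\<And>b. b \<in> B \<Longrightarrow> f b \<bullet> b \<noteq> c \<Longrightarrow> d \<le> \<bar>f b \<bullet> b - c\<bar>"
    and near: "\<And>v. v \<in> S \<Longrightarrow> norm (f' v - f v) \<le> \<eta> * norm v"
    and c': "\<bar>c' - c\<bar> \<le> \<eta>" and "2 * \<eta> < d"
  shows "card {b \<in> B. f b \<bullet> b < c} \<le> card {b \<in> B'. f' b \<bullet> b < c'}"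
proof -
  let ?C = "{b \<in> B. f b \<bullet> b < c}"
  have C: "?C \<subseteq> B" by auto
  have "dim (span ?C) \<le> card {b \<in> B'. f' b \<bullet> b < c'}"
  proof (rule eigenbasis_inertia[OF B' subspace_span eigenbasis_span_subset[OF B C]])
    fix v assume v: "v \<in> span ?C" "v \<noteq> 0"
    have vS: "v \<in> S" using eigenbasis_span_subset[OF B C] v by blast
    have "f v \<bullet> v \<le> (c - d) * (v \<bullet> v)"
      by (rule eigenbasis_span_form_le[OF B C v(1)]) (use gap in force)
    moreover have "f' v \<bullet> v - f v \<bullet> v \<le> \<eta> * (v \<bullet> v)"
      using inner_le_norm_sq[OF near[OF vS]] by (simp add: inner_diff_left)
    ultimately have "f' v \<bullet> v \<le> (c - d + \<eta>) * (v \<bullet> v)" by (simp add: algebra_simps)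
    also have "\<dots> < c' * (v \<bullet> v)"
      using v c' \<open>2 * \<eta> < d\<close> by (intro mult_strict_right_mono) auto
    finally show "f' v \<bullet> v < c' * (v \<bullet> v)" .
  qed
  then show ?thesis using eigenbasis_dim_span[OF B C] by simp
qed

lemma eigenbasis_perturb_greater:
  assumes B: "eigenbasis S f B" and B': "eigenbasis S f' B'"
    and gap: "\<And>b. b \<in> B \<Longrightarrow> f b \<bullet> b \<noteq> c \<Longrightarrow> d \<le> \<bar>f b \<bullet> b - c\<bar>"
    and near: "\<And>v. v \<in> S \<Longrightarrow> norm (f' v - f v) \<le> \<eta> * norm v"
    and c': "\<bar>c' - c\<bar> \<le> \<eta>" and "2 * \<eta> < d"
  shows "card {b \<in> B. c < f b \<bullet> b} \<le> card {b \<in> B'. c' < f' b \<bullet> b}"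
  using eigenbasis_perturb_less[OF eigenbasis_uminus[OF B] eigenbasis_uminus[OF B'], of "-c" d \<eta> "-c'"]
    gap near c' \<open>2 * \<eta> < d\<close>
  by (simp add: norm_minus_commute) (smt (verit, best))

text \<open>Why a first-order change of the map moves the eigenvalue only to second order: on the
  old eigenspace of \<open>\<mu>\<close> the change of the form is of order
  \<open>\<delta>\<^sup>2\<close> by hypothesis, and on lower eigenvectors, where it is of order
  \<open>\<delta>\<close>, the gap \<open>g\<close> absorbs it. The matching lower bound is this one
  for the negated maps.\<close>

lemma eigenbasis_perturb_second_order:
  assumes B: "eigenbasis S f B" and B': "eigenbasis S f' B'"
    and g: "g > 0" and gap: "\<And>b. b \<in> B \<Longrightarrow> f b \<bullet> b < \<mu> \<Longrightarrow> f b \<bullet> b \<le> \<mu> - g"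
    and near: "\<And>v. v \<in> S \<Longrightarrow> norm (f' v - f v) \<le> \<delta> * norm v"
    and \<delta>: "\<delta> > 0" "2 * \<delta> \<le> g" and K: "K \<ge> 0"
    and quad: "\<And>y. y \<in> S \<Longrightarrow> f y = \<mu> *\<^sub>R y \<Longrightarrow> (f' y - f y) \<bullet> y \<le> K * \<delta>\<^sup>2 * (y \<bullet> y)"
  shows "card {b \<in> B. f b \<bullet> b \<le> \<mu>} \<le> card {b \<in> B'. f' b \<bullet> b < \<mu> + (K + 2 / g + 1) * \<delta>\<^sup>2}"
proof -
  let ?C = "{b \<in> B. f b \<bullet> b \<le> \<mu>}" and ?L = "{b \<in> B. f b \<bullet> b < \<mu>}" and ?E = "{b \<in> B. f b \<bullet> b = \<mu>}"
  have C: "?C \<subseteq> B" and fin: "finite B" using eigenbasis_finite[OF B] by auto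
  have lin: "linear f" "linear f'" using B B' by (auto simp: eigenbasis_def)
  have "dim (span ?C) \<le> card {b \<in> B'. f' b \<bullet> b < \<mu> + (K + 2 / g + 1) * \<delta>\<^sup>2}"
  proof (rule eigenbasis_inertia[OF B' subspace_span eigenbasis_span_subset[OF B C]])
    fix v assume v: "v \<in> span ?C" "v \<noteq> 0"
    have vS: "v \<in> S" and v0: "\<And>b. b \<in> B - ?C \<Longrightarrow> v \<bullet> b = 0"
      using eigenbasis_span_sub[OF B C v(1)] by auto
    define w where "w = (\<Sum>b\<in>?L. (v \<bullet> b) *\<^sub>R b)"
    define y where "y = (\<Sum>b\<in>?E. (v \<bullet> b) *\<^sub>R b)"
    have wL: "w \<in> span ?L" and yE: "y \<in> span ?E"
      unfolding w_def y_def by (intro span_sum span_scale span_base; simp)+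
    have "v = (\<Sum>b\<in>B. (v \<bullet> b) *\<^sub>R b)" by (rule eigenbasis_expand[OF B vS])
    also have "\<dots> = (\<Sum>b\<in>?L \<union> ?E. (v \<bullet> b) *\<^sub>R b)"
    proof (intro sum.mono_neutral_right fin ballI)
      fix b assume "b \<in> B - (?L \<union> ?E)"
      then have "b \<in> B - ?C" by force
      then show "(v \<bullet> b) *\<^sub>R b = 0" using v0 by simp
    qed auto
    also have "\<dots> = w + y" unfolding w_def y_def using fin by (intro sum.union_disjoint) auto
    finally have vwy: "v = w + y" .
    have wS: "w \<in> S" and yS: "y \<in> S"
      using wL yE eigenbasis_span_subset[OF B, of ?L] eigenbasis_span_subset[OF B, of ?E] by auto
    have fy: "f y = \<mu> *\<^sub>R y" using yE eigenbasis_eigenspace[OF B, of \<mu>] by blast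
    have vb: "v \<bullet> b = w \<bullet> b + y \<bullet> b" for b by (simp add: vwy inner_add_left)
    have w0: "w \<bullet> b = 0" if "b \<in> B - ?L" for b
      by (rule eigenbasis_span_sub(2)[OF B _ wL that]) auto
    have y0: "y \<bullet> b = 0" if "b \<in> B - ?E" for b
      by (rule eigenbasis_span_sub(2)[OF B _ yE that]) auto
    have vv: "v \<bullet> v = w \<bullet> w + y \<bullet> y"
      unfolding eigenbasis_norm[OF B vS] eigenbasis_norm[OF B wS] eigenbasis_norm[OF B yS] sum.distrib[symmetric]
    proof (rule sum.cong[OF refl])
      fix b assume "b \<in> B"
      then show "(v \<bullet> b)\<^sup>2 = (w \<bullet> b)\<^sup>2 + (y \<bullet> b)\<^sup>2"
        using w0[of b] y0[of b] by (cases "b \<in> ?E") (auto simp: vb)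
    qed
    have fv: "f v \<bullet> v \<le> \<mu> * (v \<bullet> v) - g * (w \<bullet> w)"
      unfolding eigenbasis_norm[OF B vS] eigenbasis_norm[OF B wS] eigenbasis_form[OF B vS]
        sum_distrib_left sum_subtractf[symmetric]
    proof (rule sum_mono)
      fix b assume b: "b \<in> B"
      consider "b \<in> ?L" | "b \<in> ?E" | "b \<in> B - ?C" using b by force
      then show "(f b \<bullet> b) * (v \<bullet> b)\<^sup>2 \<le> \<mu> * (v \<bullet> b)\<^sup>2 - g * (w \<bullet> b)\<^sup>2"
      proof cases
        case 1
        then have "v \<bullet> b = w \<bullet> b" using y0[of b] by (auto simp: vb)
        moreover have "(f b \<bullet> b) * (w \<bullet> b)\<^sup>2 \<le> (\<mu> - g) * (w \<bullet> b)\<^sup>2"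
          using gap 1 by (intro mult_right_mono) auto
        ultimately show ?thesis by (simp add: algebra_simps)
      next
        case 2 then show ?thesis using w0[of b] by auto
      next
        case 3 then show ?thesis using v0 w0[of b] by auto
      qed
    qed
    define W Y where "W = norm w" and "Y = norm y"
    have ww: "w \<bullet> w = W\<^sup>2" and yy: "y \<bullet> y = Y\<^sup>2" by (simp_all add: W_def Y_def dot_square_norm)
    have D: "(f' v - f v) \<bullet> v = (f' w - f w) \<bullet> w + (f' w - f w) \<bullet> y + (f' y - f y) \<bullet> w + (f' y - f y) \<bullet> y"
      by (simp add: vwy linear_add[OF lin(1)] linear_add[OF lin(2)] inner_simps)
    have cs: "(f' x - f x) \<bullet> z \<le> \<delta> * norm x * norm z" if "x \<in> S" for x z
    proof -
      have "(f' x - f x) \<bullet> z \<le> norm (f' x - f x) * norm z" by (rule norm_cauchy_schwarz)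
      also have "\<dots> \<le> \<delta> * norm x * norm z" by (rule mult_right_mono[OF near[OF that]]) simp
      finally show ?thesis .
    qed
    have "(f' v - f v) \<bullet> v \<le> \<delta> * W * W + 2 * \<delta> * W * Y + K * \<delta>\<^sup>2 * Y\<^sup>2"
      using cs[OF wS, of w] cs[OF wS, of y] cs[OF yS, of w] quad[OF yS fy]
      unfolding D W_def[symmetric] Y_def[symmetric] yy by (simp add: mult.commute mult.left_commute)
    \<comment> \<open>Completing the square splits the gain \<open>g * W\<^sup>2\<close>: one half
      absorbs this mixed term at the price of \<open>2 / g\<close> in the constant, the other half
      absorbs \<open>\<delta> * W * W\<close>.\<close>
    moreover have "2 * \<delta> * W * Y \<le> g / 2 * W\<^sup>2 + 2 / g * \<delta>\<^sup>2 * Y\<^sup>2"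
    proof -
      have "0 \<le> g / 2 * (W - 2 * \<delta> * Y / g)\<^sup>2" using g by simp
      also have "\<dots> = g / 2 * W\<^sup>2 - 2 * \<delta> * W * Y + 2 / g * \<delta>\<^sup>2 * Y\<^sup>2"
        using g by (simp add: power2_eq_square field_simps)
      finally show ?thesis by simp
    qed
    moreover have "\<delta> * W * W \<le> g / 2 * W\<^sup>2"
      using \<delta> mult_right_mono[of \<delta> "g / 2" "W\<^sup>2"] by (simp add: power2_eq_square)
    ultimately have "f' v \<bullet> v \<le> \<mu> * (v \<bullet> v) + (K + 2 / g) * \<delta>\<^sup>2 * Y\<^sup>2"
      using fv unfolding ww by (simp add: inner_diff_left algebra_simps)
    also have "\<dots> \<le> \<mu> * (v \<bullet> v) + (K + 2 / g) * \<delta>\<^sup>2 * (v \<bullet> v)"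
      using K g by (auto simp: vv ww yy intro!: mult_left_mono)
    \<comment> \<open>The summand 1 makes the inequality strict, as the inertia argument
      demands.\<close>
    also have "\<dots> < (\<mu> + (K + 2 / g + 1) * \<delta>\<^sup>2) * (v \<bullet> v)"
      using v \<delta> by (simp add: algebra_simps)
    finally show "f' v \<bullet> v < (\<mu> + (K + 2 / g + 1) * \<delta>\<^sup>2) * (v \<bullet> v)" .
  qed
  then show ?thesis using eigenbasis_dim_span[OF B C] by simp
qed

text \<open>If no eigenvalue of \<open>f'\<close> were within \<open>\<eta>\<close> of
  \<open>\<mu>\<close>, then \<open>f'\<close> shifted by \<open>\<mu>\<close> would stretch
  \<open>\<psi>\<close> by more than \<open>\<eta>\<close>. A unit eigenvector \<open>y\<close> for
  a close eigenvalue is nearly an eigenvector of \<open>f\<close>, so its part \<open>z\<close>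
  orthogonal to the simple eigenvector \<open>b\<close> has length at most
  \<open>2 * \<eta> / d\<close>.\<close>

lemma eigenbasis_perturb_eigenvector:
  assumes B: "eigenbasis S f B" and B': "eigenbasis S f' B'"
    and \<psi>: "\<psi> \<in> S" "\<psi> \<noteq> 0" "f \<psi> = \<mu> *\<^sub>R \<psi>" and simple: "card {b \<in> B. f b \<bullet> b = \<mu>} = 1"
    and d: "d > 0" and gap: "\<And>b. b \<in> B \<Longrightarrow> f b \<bullet> b \<noteq> \<mu> \<Longrightarrow> d \<le> \<bar>f b \<bullet> b - \<mu>\<bar>"
    and near: "\<And>v. v \<in> S \<Longrightarrow> norm (f' v - f v) \<le> \<eta> * norm v"
    and \<eta>: "4 * \<eta> \<le> d"
  obtains \<mu>' \<psi>' where "\<psi>' \<in> S" "f' \<psi>' = \<mu>' *\<^sub>R \<psi>'" "\<bar>\<mu>' - \<mu>\<bar> \<le> \<eta>" "norm (\<psi>' - \<psi>) \<le> 4 * \<eta> / d * norm \<psi>"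
proof -
  have sub: "subspace S" using B subspace_span by (auto simp: eigenbasis_def)
  have lin: "linear f" "linear f'" using B B' by (auto simp: eigenbasis_def)
  have "\<exists>y\<in>B'. \<bar>f' y \<bullet> y - \<mu>\<bar> \<le> \<eta>"
  proof (rule ccontr)
    assume "\<not> ?thesis"
    then have far: "\<eta> < \<bar>f' y \<bullet> y - \<mu>\<bar>" if "y \<in> B'" for y using that by force
    have ne: "B' \<noteq> {}" using B' \<psi> by (auto simp: eigenbasis_def)
    define m where "m = Min ((\<lambda>y. \<bar>f' y \<bullet> y - \<mu>\<bar>) ` B')"
    have fin: "finite B'" using B' by (rule eigenbasis_finite)
    have m: "m \<le> \<bar>f' y \<bullet> y - \<mu>\<bar>" if "y \<in> B'" for y using that fin by (simp add: m_def)
    have "m \<in> (\<lambda>y. \<bar>f' y \<bullet> y - \<mu>\<bar>) ` B'" unfolding m_def using fin ne by (intro Min_in) auto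
    then have "\<eta> < m" "0 \<le> m" using far by auto
    have "m * norm \<psi> \<le> norm (f' \<psi> - \<mu> *\<^sub>R \<psi>)"
      using m by (intro eigenbasis_shift_ge[OF B' \<psi>(1)]) (use \<open>0 \<le> m\<close> in auto)
    also have "\<dots> \<le> \<eta> * norm \<psi>" using near[OF \<psi>(1)] \<psi>(3) by simp
    finally show False using \<open>\<eta> < m\<close> \<psi>(2) by simp
  qed
  then obtain y where y: "y \<in> B'" and \<mu>': "\<bar>f' y \<bullet> y - \<mu>\<bar> \<le> \<eta>" by blast
  obtain b where b: "{b \<in> B. f b \<bullet> b = \<mu>} = {b}" using simple card_1_singletonE by blast
  then have bB: "b \<in> B" and bb: "b \<bullet> b = 1" using eigenbasis_inner[OF B, of b b] by auto
  have nb: "norm b = 1" using bb by (simp add: norm_eq_1)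
  have "\<psi> \<in> span {b}" using eigenbasis_eigenspace[OF B, of \<mu>] \<psi> b by auto
  then obtain k where k: "\<psi> = k *\<^sub>R b" by (auto simp: span_singleton)
  have fb: "f b = \<mu> *\<^sub>R b" using eigenbasis_eigenspace[OF B, of \<mu>] b span_base[of b "{b}"] by auto
  have yS: "y \<in> S" using y eigenbasis_subset[OF B'] by auto
  have ny: "norm y = 1" using y B' by (auto simp: eigenbasis_def)
  define z where "z = y - (y \<bullet> b) *\<^sub>R b"
  have zS: "z \<in> S" using sub yS bB eigenbasis_subset[OF B] by (auto simp: z_def subspace_diff subspace_scale)
  have zb: "z \<bullet> b = 0" by (simp add: z_def inner_diff_left bb)
  have "d * norm z \<le> norm (f z - \<mu> *\<^sub>R z)"
  proof (rule eigenbasis_shift_ge[OF B zS])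
    fix b' assume "b' \<in> B" "z \<bullet> b' \<noteq> 0"
    then have "b' \<in> B" "b' \<noteq> b" using zb by auto
    then show "d \<le> \<bar>f b' \<bullet> b' - \<mu>\<bar>" using b by (intro gap) auto
  qed (use d in simp)
  also have "f z - \<mu> *\<^sub>R z = f y - \<mu> *\<^sub>R y"
    by (simp add: z_def linear_diff[OF lin(1)] linear_cmul[OF lin(1)] fb algebra_simps)
  also have "\<dots> = - (f' y - f y) + (f' y \<bullet> y - \<mu>) *\<^sub>R y"
    using eigenbasis_eq[OF B' y] by (simp add: scaleR_diff_left)
  also have "norm \<dots> \<le> norm (f' y - f y) + norm ((f' y \<bullet> y - \<mu>) *\<^sub>R y)"
    by (metis norm_minus_cancel norm_triangle_ineq)
  also have "\<dots> \<le> \<eta> + \<eta>" using near[OF yS] \<mu>' ny by (intro add_mono) auto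
  finally have nz: "norm z \<le> 2 * \<eta> / d" using d by (simp add: field_simps)
  also have "\<dots> \<le> 1 / 2" using \<eta> d by (simp add: field_simps)
  finally have nz2: "norm z \<le> 1 / 2" .
  have "1 = norm ((y \<bullet> b) *\<^sub>R b + z)" using ny by (simp add: z_def)
  also have "\<dots> \<le> \<bar>y \<bullet> b\<bar> + norm z"
    using norm_triangle_ineq[of "(y \<bullet> b) *\<^sub>R b" z] nb by simp
  finally have yb: "1 / 2 \<le> \<bar>y \<bullet> b\<bar>" using nz2 by simp
  then have yb0: "y \<bullet> b \<noteq> 0" by auto
  \<comment> \<open>Rescaling \<open>y\<close> to the component of \<open>\<psi>\<close> along
    \<open>b\<close> fixes sign and length at once. Since that component of \<open>y\<close> is at
    least 1/2 in modulus, the bound \<open>2 * \<eta> / d\<close> becomes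
    \<open>4 * \<eta> / d\<close>.\<close>
  define \<psi>' where "\<psi>' = (k / (y \<bullet> b)) *\<^sub>R y"
  have "\<psi>' \<in> S" using sub yS by (simp add: \<psi>'_def subspace_scale)
  moreover have "f' \<psi>' = (f' y \<bullet> y) *\<^sub>R \<psi>'"
    unfolding \<psi>'_def linear_cmul[OF lin(2)] by (subst eigenbasis_eq[OF B' y]) (simp add: mult.commute)
  moreover have "norm (\<psi>' - \<psi>) \<le> 4 * \<eta> / d * norm \<psi>"
  proof -
    have "\<psi>' - \<psi> = (k / (y \<bullet> b)) *\<^sub>R z" using yb0 by (simp add: \<psi>'_def z_def k algebra_simps)
    then have "norm (\<psi>' - \<psi>) = norm \<psi> * (norm z / \<bar>y \<bullet> b\<bar>)"
      using nb by (simp add: k abs_divide)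
    also have "\<dots> \<le> norm \<psi> * ((2 * \<eta> / d) / (1 / 2))"
      using nz yb by (intro mult_left_mono frac_le) (auto intro: order_trans[OF norm_ge_zero nz])
    finally show ?thesis by (simp add: mult.commute)
  qed
  ultimately show ?thesis using that \<mu>' by blast
qed

lemma eigenbasis_cong:
  assumes "eigenbasis S f B" "linear g" "\<And>x. x \<in> S \<Longrightarrow> g x = f x"
  shows "eigenbasis S g B"
  using assms eigenbasis_subset[OF assms(1)] by (auto simp: eigenbasis_def subset_iff)

lemma eigenbasis_Un:
  assumes B: "eigenbasis S f B" "eigenbasis S' f B'" and orth: "\<And>x y. x \<in> S \<Longrightarrow> y \<in> S' \<Longrightarrow> x \<bullet> y = 0"
  shows "eigenbasis {x + y |x y. x \<in> S \<and> y \<in> S'} f (B \<union> B')" "B \<inter> B' = {}"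
proof -
  have o: "b \<bullet> b' = 0" if "b \<in> B" "b' \<in> B'" for b b'
    using orth that eigenbasis_subset[OF B(1)] eigenbasis_subset[OF B(2)] by blast
  then have o': "b' \<bullet> b = 0" if "b \<in> B" "b' \<in> B'" for b b' using that by (metis inner_commute)
  then show "B \<inter> B' = {}" using eigenbasis_inner[OF B(1)] by fastforce
  have "pairwise orthogonal (B \<union> B')"
    using B o o' by (auto simp: eigenbasis_def pairwise_def orthogonal_def)
  moreover have "span (B \<union> B') = {x + y |x y. x \<in> S \<and> y \<in> S'}"
    using B by (simp add: eigenbasis_def span_Un)
  ultimately show "eigenbasis {x + y |x y. x \<in> S \<and> y \<in> S'} f (B \<union> B')"
    using B by (simp add: eigenbasis_def ball_Un)
qed

section \<open>Eigenvalues of symmetric and Hermitian matrices\<close>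

definition coord_space :: "'v set \<Rightarrow> ('a::zero ^'v::finite) set" where
  "coord_space U = {x. vec_support x \<subseteq> U}"

lemma coord_space_iff: "x \<in> coord_space U \<longleftrightarrow> (\<forall>r. r \<notin> U \<longrightarrow> x $ r = 0)"
  by (auto simp: coord_space_def vec_support_def)

lemma eigenspace_coord_space: "eigenspace U M \<mu> = {x \<in> coord_space U. M *v x = of_real \<mu> *s x}"
  by (auto simp: eigenspace_def coord_space_def)

lemma of_real_vector_scale:
  fixes x :: "'a::{real_algebra_1, real_vector}^'v"
  shows "of_real \<mu> *s x = \<mu> *\<^sub>R x"
  unfolding vec_eq_iff by (simp, simp add: scaleR_conv_of_real)

lemma eigenspace_scaleR:
  fixes M :: "'a::real_field^'v^'v::finite"
  shows "eigenspace U M \<mu> = {x \<in> coord_space U. M *v x = \<mu> *\<^sub>R x}"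
  by (simp add: eigenspace_coord_space of_real_vector_scale)

lemma linear_matrix_vector_mult:
  fixes M :: "'a::real_field^'v^'v::finite"
  shows "linear ((*v) M)"
  by (rule linearI)
    (simp_all add: vec_eq_iff matrix_vector_mult_def algebra_simps sum.distrib scaleR_sum_right)

lemma subspace_coord_space: "subspace (coord_space U :: ('a::real_vector^'v::finite) set)"
  by (auto simp: subspace_def coord_space_iff)

lemma dim_coord_space: "dim (coord_space U :: (real^'v::finite) set) = card U"
proof -
  have "coord_space U = {x::real^'v. \<forall>i. i \<notin> U \<longrightarrow> x $ i = 0}" by (auto simp: coord_space_iff)
  then show ?thesis using dim_substandard_cart[of U, where ?'a = real] by (simp add: dim_vec_eq)
qed

lemma matrix_vector_mult_coord_space:
  fixes M :: "'a::real_field^'v^'v::finite"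
  assumes "\<And>r s. r \<notin> U \<Longrightarrow> M $ r $ s = 0"
  shows "M *v x \<in> coord_space U"
  using assms by (simp add: coord_space_iff matrix_vector_mult_def)

lemma selfadjoint_symmetric:
  fixes M :: "real^'v^'v::finite"
  assumes "transpose M = M" "\<And>r s. r \<notin> U \<Longrightarrow> M $ r $ s = 0"
  shows "selfadjoint_on (coord_space U) ((*v) M)"
proof -
  have "(M *v x) \<bullet> y = x \<bullet> (M *v y)" for x y
    using assms(1) by (metis dot_lmul_matrix transpose_matrix_vector)
  then show ?thesis
    using matrix_vector_mult_coord_space[OF assms(2)]
    by (auto simp: selfadjoint_on_def subspace_coord_space linear_matrix_vector_mult)
qed

lemma inner_complex_Re: "inner x y = Re (cnj x * y)"
  by (simp add: inner_complex_def)

lemma selfadjoint_hermitian: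
  fixes M :: "complex^'v^'v::finite"
  assumes h: "\<And>r s. M $ s $ r = cnj (M $ r $ s)" and "\<And>r s. r \<notin> U \<Longrightarrow> M $ r $ s = 0"
  shows "selfadjoint_on (coord_space U) ((*v) M)"
proof -
  have "(M *v x) \<bullet> y = x \<bullet> (M *v y)" for x y
  proof -
    have "(M *v x) \<bullet> y = Re (\<Sum>r\<in>UNIV. \<Sum>s\<in>UNIV. cnj (M $ r $ s * x $ s) * y $ r)"
      by (simp add: inner_vec_def inner_complex_Re matrix_vector_mult_def sum_distrib_right)
    also have "(\<Sum>r\<in>UNIV. \<Sum>s\<in>UNIV. cnj (M $ r $ s * x $ s) * y $ r)
        = (\<Sum>s\<in>UNIV. \<Sum>r\<in>UNIV. cnj (x $ s) * (M $ s $ r * y $ r))"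
      by (subst sum.swap, intro sum.cong refl, subst h) (simp add: mult_ac)
    also have "Re \<dots> = x \<bullet> (M *v y)"
      by (simp add: inner_vec_def inner_complex_Re matrix_vector_mult_def sum_distrib_left)
    finally show ?thesis .
  qed
  then show ?thesis
    using matrix_vector_mult_coord_space[OF assms(2)]
    by (auto simp: selfadjoint_on_def subspace_coord_space linear_matrix_vector_mult)
qed

text \<open>A complex basis vector \<open>b\<close> adds the two real directions \<open>b\<close>
  and \<open>\<i> *s b\<close>. The second is no real multiple of the first modulo the previous
  span, because \<open>\<i> - of_real k\<close> is invertible and that span is a complex
  subspace.\<close>

lemma dim_complex_span:
  fixes B :: "(complex^'v::finite) set"
  assumes "finite B" "vec.independent B"
  shows "dim (vec.span B) = 2 * card B"
  using assms
proof (induction B rule: finite_induct)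
  case empty
  then show ?case by simp
next
  case (insert b B)
  let ?W = "vec.span B"
  have ind: "vec.independent B" and b: "b \<notin> ?W"
    using insert.prems insert.hyps by (auto simp: vec.independent_insert)
  have sR: "c *\<^sub>R x = of_real c *s x" for c and x :: "complex^'v"
    by (simp add: of_real_vector_scale)
  have subR: "subspace (vec.span A)" for A :: "(complex^'v) set"
    by (auto simp: subspace_def sR intro: vec.span_zero vec.span_add vec.span_scale)
  have "vec.span (insert b B) = span (insert (\<i> *s b) (insert b ?W))"
  proof
    show "vec.span (insert b B) \<subseteq> span (insert (\<i> *s b) (insert b ?W))"
    proof
      fix x assume "x \<in> vec.span (insert b B)"
      then obtain k where "x - k *s b \<in> ?W" by (auto simp: vec.span_breakdown_eq)
      moreover have "x - Im k *\<^sub>R (\<i> *s b) - Re k *\<^sub>R b = x - k *s b"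
        by (simp add: vec_eq_iff complex_eq_iff)
      ultimately show "x \<in> span (insert (\<i> *s b) (insert b ?W))"
        unfolding span_breakdown_eq by (metis span_base)
    qed
    have "insert (\<i> *s b) (insert b ?W) \<subseteq> vec.span (insert b B)"
      using vec.span_mono[of B "insert b B"] vec.span_base[of b "insert b B"] vec.span_scale by auto
    then show "span (insert (\<i> *s b) (insert b ?W)) \<subseteq> vec.span (insert b B)"
      using subR by (simp add: span_minimal)
  qed
  moreover have "b \<notin> span ?W" using b subR by (metis span_eq_iff)
  moreover have "\<i> *s b \<notin> span (insert b ?W)"
  proof
    assume "\<i> *s b \<in> span (insert b ?W)"
    then obtain k where "\<i> *s b - k *\<^sub>R b \<in> span ?W" by (auto simp: span_breakdown_eq)
    then have "(\<i> - of_real k) *s b \<in> ?W" using subR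
      by (metis sR span_eq_iff vec.scale_left_diff_distrib)
    then have "inverse (\<i> - of_real k) *s ((\<i> - of_real k) *s b) \<in> ?W" by (rule vec.span_scale)
    moreover have "\<i> - of_real k \<noteq> 0" by (simp add: complex_eq_iff)
    ultimately show False using b by (metis vec.scale_scale left_inverse vec.scale_one)
  qed
  ultimately show ?case using insert.IH[OF ind] insert.hyps by (simp add: dim_insert)
qed

lemma dim_complex_subspace:
  fixes V :: "(complex^'v::finite) set"
  assumes "vec.subspace V"
  shows "dim V = 2 * vec.dim V"
proof -
  obtain B where B: "B \<subseteq> V" "vec.independent B" "V \<subseteq> vec.span B" "card B = vec.dim V"
    by (rule vec.basis_exists)
  then have "vec.span B = V" using assms by (metis vec.span_subspace)
  moreover have "finite B" using B(2) by (rule vec.finiteI_independent)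
  ultimately show ?thesis using dim_complex_span[of B] B by simp
qed

lemma subspace_eigenspace:
  fixes M :: "'a::real_field^'v^'v::finite"
  shows "vec.subspace (eigenspace U M \<mu>)"
proof (rule vec.subspaceI)
  fix c and x :: "'a^'v" assume x: "x \<in> eigenspace U M \<mu>"
  then have "M *v (c *s x) = of_real \<mu> *s (c *s x)"
    by (simp only: eigenspace_coord_space mem_Collect_eq vector_scalar_commute vec.scale_left_commute)
  with x show "c *s x \<in> eigenspace U M \<mu>" by (simp add: eigenspace_coord_space coord_space_iff)
qed (simp_all add: eigenspace_coord_space coord_space_iff matrix_vector_right_distrib vec.scale_right_distrib)

text \<open>The number \<open>d\<close> is the real dimension of the scalar field, so that real and complex matrices are
  treated alike as selfadjoint real-linear maps.\<close>

definition spectral_matrix :: "nat \<Rightarrow> 'v set \<Rightarrow> 'a::{real_field, euclidean_space}^'v^'v::finite \<Rightarrow> bool" where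
  "spectral_matrix d U M \<longleftrightarrow> d > 0 \<and> selfadjoint_on (coord_space U) ((*v) M) \<and>
     (\<forall>\<mu>. d * multiplicity_of U M \<mu> = dim (eigenspace U M \<mu>))"

lemma spectral_symmetric:
  fixes M :: "real^'v^'v::finite"
  assumes "transpose M = M" "\<And>r s. r \<notin> U \<Longrightarrow> M $ r $ s = 0"
  shows "spectral_matrix 1 U M"
  using selfadjoint_symmetric[OF assms] by (simp add: spectral_matrix_def multiplicity_of_def dim_vec_eq)

lemma spectral_hermitian:
  fixes M :: "complex^'v^'v::finite"
  assumes "\<And>r s. M $ s $ r = cnj (M $ r $ s)" "\<And>r s. r \<notin> U \<Longrightarrow> M $ r $ s = 0"
  shows "spectral_matrix 2 U M"
proof -
  have "selfadjoint_on (coord_space U) ((*v) M)" by (rule selfadjoint_hermitian) (fact assms)+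
  then show ?thesis
    by (simp add: spectral_matrix_def multiplicity_of_def dim_complex_subspace[OF subspace_eigenspace])
qed

section \<open>Ordered eigenvalue lists as counts\<close>

lemma length_filter_concat_replicate:
  assumes "distinct xs"
  shows "length (filter P (concat (map (\<lambda>\<mu>. replicate (m \<mu>) \<mu>) xs))) = (\<Sum>\<mu>\<in>{\<mu>\<in>set xs. P \<mu>}. m \<mu>)"
proof -
  have "length (filter P (concat (map (\<lambda>\<mu>. replicate (m \<mu>) \<mu>) xs))) = sum_list (map (\<lambda>\<mu>. if P \<mu> then m \<mu> else 0) xs)"
    by (induction xs) auto
  also have "\<dots> = (\<Sum>\<mu>\<in>set xs. if P \<mu> then m \<mu> else 0)"
    using assms by (simp add: sum_list_distinct_conv_sum_set)
  finally show ?thesis by (simp add: sum.inter_filter)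
qed

lemma sorted_concat_replicate:
  "sorted xs \<Longrightarrow> sorted (concat (map (\<lambda>\<mu>. replicate (m \<mu>) \<mu>) xs))"
  by (induction xs) (auto simp: sorted_append)

text \<open>The entries below \<open>c\<close> form an initial segment of a sorted list, so a
  statement on one entry becomes one on a cardinality.\<close>

lemma sorted_nth_less_iff:
  fixes c :: "'a::linorder"
  shows "sorted L \<Longrightarrow> i < length L \<Longrightarrow> L ! i < c \<longleftrightarrow> i < length (filter (\<lambda>x. x < c) L)"
proof (induction L arbitrary: i)
  case (Cons a L)
  show ?case
  proof (cases "a < c")
    case True
    then show ?thesis using Cons by (cases i) auto
  next
    case False
    then have "filter (\<lambda>x. x < c) (a # L) = []"
      using Cons.prems by (auto simp: filter_empty_conv)
    moreover have "a \<le> (a # L) ! i" using Cons.prems by (cases i) auto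
    ultimately show ?thesis using False by simp
  qed
qed simp

lemma sorted_nth_le_iff:
  fixes c :: "'a::linorder"
  shows "sorted L \<Longrightarrow> i < length L \<Longrightarrow> L ! i \<le> c \<longleftrightarrow> i < length (filter (\<lambda>x. x \<le> c) L)"
proof (induction L arbitrary: i)
  case (Cons a L)
  show ?case
  proof (cases "a \<le> c")
    case True
    then show ?thesis using Cons by (cases i) auto
  next
    case False
    then have "filter (\<lambda>x. x \<le> c) (a # L) = []"
      using Cons.prems by (auto simp: filter_empty_conv)
    moreover have "a \<le> (a # L) ! i" using Cons.prems by (cases i) auto
    ultimately show ?thesis using False by simp
  qed
qed simp

lemma sorted_eigenvalues: "sorted (eigenvalues U M)"
  by (simp add: eigenvalues_def sorted_concat_replicate)

context
  fixes d :: nat and U :: "'v::finite set" and M :: "'a::{real_field, euclidean_space}^'v^'v"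
  assumes spec: "spectral_matrix d U M"
begin

lemma spectral_eigenbasis:
  obtains B where "eigenbasis (coord_space U) ((*v) M) B"
  using spec selfadjoint_on_eigenbasis by (auto simp: spectral_matrix_def)

context
  fixes B assumes B: "eigenbasis (coord_space U) ((*v) M) B"
begin

lemma multiplicity_eigenbasis:
  "d * multiplicity_of U M \<mu> = card {b \<in> B. (M *v b) \<bullet> b = \<mu>}"
  using spec eigenbasis_dim_eigenspace[OF B, of \<mu>] by (simp add: spectral_matrix_def eigenspace_scaleR)

lemma spectrum_eigenbasis: "spectrum U M = (\<lambda>b. (M *v b) \<bullet> b) ` B"
proof -
  have fin: "finite B" using B by (rule eigenbasis_finite)
  have "\<mu> \<in> spectrum U M \<longleftrightarrow> \<mu> \<in> (\<lambda>b. (M *v b) \<bullet> b) ` B" for \<mu>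
  proof -
    have "\<mu> \<in> spectrum U M \<longleftrightarrow> \<not> eigenspace U M \<mu> \<subseteq> {0}" by (auto simp: spectrum_def)
    also have "\<dots> \<longleftrightarrow> card {b \<in> B. (M *v b) \<bullet> b = \<mu>} \<noteq> 0"
      using eigenbasis_dim_eigenspace[OF B, of \<mu>] by (simp add: eigenspace_scaleR flip: dim_eq_0)
    also have "\<dots> \<longleftrightarrow> \<mu> \<in> (\<lambda>b. (M *v b) \<bullet> b) ` B" using fin by auto
    finally show ?thesis .
  qed
  then show ?thesis by blast
qed

text \<open>The bridge from the list definitions to an eigenbasis: each list entry stands for
  \<open>d\<close> real basis vectors.\<close>

lemma length_filter_eigenvalues:
  "d * length (filter P (eigenvalues U M)) = card {b \<in> B. P ((M *v b) \<bullet> b)}"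
proof -
  let ?e = "\<lambda>b. (M *v b) \<bullet> b" and ?S = "{b \<in> B. P ((M *v b) \<bullet> b)}"
  have fin: "finite B" using B by (rule eigenbasis_finite)
  have "d * length (filter P (eigenvalues U M)) = (\<Sum>\<mu>\<in>{\<mu>\<in>?e ` B. P \<mu>}. card {b \<in> B. ?e b = \<mu>})"
    unfolding eigenvalues_def using fin
    by (simp add: length_filter_concat_replicate spectrum_eigenbasis sum_distrib_left multiplicity_eigenbasis)
  also have "\<dots> = (\<Sum>\<mu>\<in>?e ` ?S. card {b \<in> ?S. ?e b = \<mu>})"
    by (intro sum.cong arg_cong[where f = card]) auto
  also have "\<dots> = card ?S"
    using sum.image_gen[of ?S "\<lambda>_. 1::nat" ?e] fin by simp
  finally show ?thesis .
qed

lemma length_eigenvalues: "d * length (eigenvalues U M) = card B"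
  using length_filter_eigenvalues[of "\<lambda>_. True"] by simp

text \<open>The bound on \<open>d * k\<close> keeps the index inside the list, where
  \<open>!\<close> has a meaning. As \<open>k\<close> counts from 1 and the list from 0, a strict
  condition at \<open>k - 1\<close> becomes a non-strict one at \<open>k\<close>.\<close>

lemma eigenvalue_nth_less_iff:
  assumes "1 \<le> k" "d * k \<le> card B"
  shows "eigenvalue_nth k U M < c \<longleftrightarrow> d * k \<le> card {b \<in> B. (M *v b) \<bullet> b < c}"
proof -
  have d: "d > 0" using spec by (simp add: spectral_matrix_def)
  have "k \<le> length (eigenvalues U M)" using assms d length_eigenvalues by (metis mult_le_cancel1 not_less)
  then have "eigenvalue_nth k U M < c \<longleftrightarrow> k - 1 < length (filter (\<lambda>x. x < c) (eigenvalues U M))"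
    unfolding eigenvalue_nth_def using assms by (intro sorted_nth_less_iff sorted_eigenvalues) auto
  also have "\<dots> \<longleftrightarrow> d * k \<le> d * length (filter (\<lambda>x. x < c) (eigenvalues U M))"
    using assms d by auto
  finally show ?thesis by (simp add: length_filter_eigenvalues)
qed

lemma eigenvalue_nth_le_iff:
  assumes "1 \<le> k" "d * k \<le> card B"
  shows "eigenvalue_nth k U M \<le> c \<longleftrightarrow> d * k \<le> card {b \<in> B. (M *v b) \<bullet> b \<le> c}"
proof -
  have d: "d > 0" using spec by (simp add: spectral_matrix_def)
  have "k \<le> length (eigenvalues U M)" using assms d length_eigenvalues by (metis mult_le_cancel1 not_less)
  then have "eigenvalue_nth k U M \<le> c \<longleftrightarrow> k - 1 < length (filter (\<lambda>x. x \<le> c) (eigenvalues U M))"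
    unfolding eigenvalue_nth_def using assms by (intro sorted_nth_le_iff sorted_eigenvalues) auto
  also have "\<dots> \<longleftrightarrow> d * k \<le> d * length (filter (\<lambda>x. x \<le> c) (eigenvalues U M))"
    using assms d by auto
  finally show ?thesis by (simp add: length_filter_eigenvalues)
qed

end

lemma finite_spectrum: "finite (spectrum U M)"
proof -
  obtain B where B: "eigenbasis (coord_space U) ((*v) M) B" by (rule spectral_eigenbasis)
  show ?thesis using eigenbasis_finite[OF B] by (simp add: spectrum_eigenbasis[OF B])
qed

end

text \<open>\<open>norm M\<close> is the Frobenius norm here, so Cauchy-Schwarz in each row is
  enough.\<close>

lemma norm_matrix_vector_le:
  fixes M :: "'a::real_normed_field^'m^'n::finite"
  shows "norm (M *v x) \<le> norm M * norm x"
proof -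
  have "norm ((M *v x) $ r) \<le> norm (M $ r) * norm x" for r
  proof -
    have "norm ((M *v x) $ r) \<le> (\<Sum>s\<in>UNIV. \<bar>norm (M $ r $ s)\<bar> * \<bar>norm (x $ s)\<bar>)"
      by (simp add: matrix_vector_mult_def norm_mult[symmetric] sum_norm_le)
    also have "\<dots> \<le> norm (M $ r) * norm x" unfolding norm_vec_def by (rule L2_set_mult_ineq)
    finally show ?thesis .
  qed
  then have "norm (M *v x) \<le> L2_set (\<lambda>r. norm (M $ r) * norm x) UNIV"
    unfolding norm_vec_def[of "M *v x"] by (intro L2_set_mono) auto
  also have "\<dots> = norm M * norm x"
    unfolding norm_vec_def[of M] by (rule L2_set_left_distrib[symmetric]) simp
  finally show ?thesis .
qed

lemma card_filter_le:
  fixes g :: "'a \<Rightarrow> real"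
  assumes "finite B"
  shows "card {b \<in> B. g b \<le> c} = card {b \<in> B. g b < c} + card {b \<in> B. g b = c}"
proof -
  have "{b \<in> B. g b \<le> c} = {b \<in> B. g b < c} \<union> {b \<in> B. g b = c}" by auto
  moreover have "{b \<in> B. g b < c} \<inter> {b \<in> B. g b = c} = {}" by auto
  ultimately show ?thesis using assms by (simp add: card_Un_disjoint)
qed

lemma eigenvalue_nth_eqI:
  assumes spec: "spectral_matrix d U M" and B: "eigenbasis (coord_space U) ((*v) M) B" and k: "1 \<le> k"
    and less: "card {b \<in> B. (M *v b) \<bullet> b < \<mu>} = d * (k - 1)" and eq: "card {b \<in> B. (M *v b) \<bullet> b = \<mu>} = d"
  shows "eigenvalue_nth k U M = \<mu>"
proof -
  have fin: "finite B" by (rule eigenbasis_finite[OF B])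
  have d: "d > 0" using spec by (simp add: spectral_matrix_def)
  have le: "card {b \<in> B. (M *v b) \<bullet> b \<le> \<mu>} = d * k"
    using card_filter_le[OF fin, of "\<lambda>b. (M *v b) \<bullet> b" \<mu>] less eq k by (cases k) auto
  have kB: "d * k \<le> card B" unfolding le[symmetric] using fin by (intro card_mono) auto
  have "eigenvalue_nth k U M \<le> \<mu>" using eigenvalue_nth_le_iff[OF spec B k kB] le by simp
  moreover have "\<not> eigenvalue_nth k U M < \<mu>"
    using eigenvalue_nth_less_iff[OF spec B k kB] less d k by simp
  ultimately show ?thesis by simp
qed

text \<open>\<open>k\<close> exceeds the number of eigenvalues below \<open>\<mu>\<close> but not
  the number of those up to \<open>\<mu>\<close>; for a simple eigenvalue these two numbers differ
  by 1.\<close>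

lemma card_less_simple_eigenvalue_nth:
  assumes spec: "spectral_matrix 1 U M" and B: "eigenbasis (coord_space U) ((*v) M) B" and k: "1 \<le> k" "k \<le> card B"
    and \<mu>: "\<mu> = eigenvalue_nth k U M" and eq: "card {b \<in> B. (M *v b) \<bullet> b = \<mu>} = 1"
  shows "card {b \<in> B. (M *v b) \<bullet> b < \<mu>} = k - 1"
proof -
  have "k \<le> card {b \<in> B. (M *v b) \<bullet> b \<le> \<mu>}" "\<not> k \<le> card {b \<in> B. (M *v b) \<bullet> b < \<mu>}"
    using eigenvalue_nth_le_iff[OF spec B k(1), of \<mu>] eigenvalue_nth_less_iff[OF spec B k(1), of \<mu>] k(2) \<mu> by auto
  then show ?thesis
    using card_filter_le[OF eigenbasis_finite[OF B], of "\<lambda>b. (M *v b) \<bullet> b" \<mu>] eq by simp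
qed

section \<open>Density of generic matrices\<close>

lemma symmetric_on_nth: "h \<in> symmetric_on G \<Longrightarrow> h $ r $ s = h $ s $ r"
proof -
  assume "h \<in> symmetric_on G"
  then have "transpose h $ s $ r = h $ s $ r" by (simp add: symmetric_on_def)
  then show ?thesis by (simp add: transpose_def)
qed

lemma symmetric_on_iff:
  "h \<in> symmetric_on G \<longleftrightarrow> (\<forall>r s. h $ r $ s = h $ s $ r) \<and>
     (\<forall>r s. h $ r $ s \<noteq> 0 \<longrightarrow> r \<in> verts G \<and> s \<in> verts G \<and> (r \<noteq> s \<longrightarrow> r \<rightarrow>\<^bsub>G\<^esub> s))"
proof -
  have "transpose h = h \<longleftrightarrow> (\<forall>r s. h $ r $ s = h $ s $ r)"
    unfolding vec_eq_iff transpose_def by auto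
  then show ?thesis unfolding symmetric_on_def supported_on_def by auto
qed

lemma principal_submatrix_nth [simp]:
  "principal_submatrix M U $ r $ s = (if r \<in> U \<and> s \<in> U then M $ r $ s else 0)"
  by (simp add: principal_submatrix_def)

text \<open>Using the rows in \<open>C\<close> of the full matrix lets one vector be viewed on
  \<open>C\<close>, on \<open>C - {r}\<close> or on a component without changing the matrix.\<close>

lemma eigenspace_principal_iff:
  fixes h :: "real^'v^'v::finite"
  shows "x \<in> eigenspace C (principal_submatrix h C) \<mu> \<longleftrightarrow>
    x \<in> coord_space C \<and> (\<forall>r\<in>C. (h *v x) $ r = \<mu> * x $ r)"
proof -
  have "(principal_submatrix h C *v x) $ r = (if r \<in> C then (h *v x) $ r else 0)" if "x \<in> coord_space C" for r
    using that by (auto simp: matrix_vector_mult_def coord_space_iff intro!: sum.cong)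
  then show ?thesis
    by (auto simp: eigenspace_coord_space vec_eq_iff coord_space_iff)
qed

lemma finite_spectrum_principal:
  fixes h :: "real^'v^'v::finite"
  assumes "\<And>r s. h $ r $ s = h $ s $ r"
  shows "finite (spectrum C (principal_submatrix h C))"
proof (rule finite_spectrum[OF spectral_symmetric])
  show "transpose (principal_submatrix h C) = principal_submatrix h C"
    unfolding vec_eq_iff transpose_def using assms by auto
qed auto

text \<open>Density alone is not inherited by conjunctions, density of the relative interior is. It
  also passes to weaker properties, so it can be proved for open conditions on blocks and then
  transferred to genericity.\<close>

definition dense_interior_on :: "'a::metric_space set \<Rightarrow> ('a \<Rightarrow> bool) \<Rightarrow> bool" where
  "dense_interior_on S P \<longleftrightarrow> (\<forall>h\<in>S. \<forall>\<epsilon>>0. \<exists>h'\<in>S. dist h h' < \<epsilon> \<and>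
     (\<exists>\<delta>>0. \<forall>h''\<in>S. dist h' h'' < \<delta> \<longrightarrow> P h''))"

lemma dense_interior_onE:
  assumes "dense_interior_on S P" "h \<in> S" "\<epsilon> > 0"
  obtains h' \<delta> where "h' \<in> S" "dist h h' < \<epsilon>" "\<delta> > 0" "\<And>k. k \<in> S \<Longrightarrow> dist h' k < \<delta> \<Longrightarrow> P k"
proof -
  have "\<exists>h'\<in>S. dist h h' < \<epsilon> \<and> (\<exists>\<delta>>0. \<forall>h''\<in>S. dist h' h'' < \<delta> \<longrightarrow> P h'')"
    using assms(1)[unfolded dense_interior_on_def] assms(2,3) by simp
  then show ?thesis using that by blast
qed

lemma dense_interior_on_mono:
  assumes "dense_interior_on S P" "\<And>h. h \<in> S \<Longrightarrow> P h \<Longrightarrow> Q h"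
  shows "dense_interior_on S Q"
  using assms unfolding dense_interior_on_def by meson

lemma dense_interior_on_conj:
  assumes P: "dense_interior_on S P" and Q: "dense_interior_on S Q"
  shows "dense_interior_on S (\<lambda>h. P h \<and> Q h)"
  unfolding dense_interior_on_def
proof (intro ballI allI impI)
  fix h and \<epsilon> :: real assume h: "h \<in> S" "\<epsilon> > 0"
  obtain h1 \<delta>1 where h1: "h1 \<in> S" "dist h h1 < \<epsilon> / 2" "\<delta>1 > 0" "\<And>k. k \<in> S \<Longrightarrow> dist h1 k < \<delta>1 \<Longrightarrow> P k"
    by (rule dense_interior_onE[OF P h(1) half_gt_zero[OF h(2)]]) blast
  have m0: "min (\<epsilon> / 2) (\<delta>1 / 2) > 0" using h h1 by simp
  obtain h2 \<delta>2 where h2: "h2 \<in> S" "dist h1 h2 < min (\<epsilon> / 2) (\<delta>1 / 2)" "\<delta>2 > 0" "\<And>k. k \<in> S \<Longrightarrow> dist h2 k < \<delta>2 \<Longrightarrow> Q k"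
    by (rule dense_interior_onE[OF Q h1(1) m0]) blast
  show "\<exists>h'\<in>S. dist h h' < \<epsilon> \<and> (\<exists>\<delta>>0. \<forall>h''\<in>S. dist h' h'' < \<delta> \<longrightarrow> P h'' \<and> Q h'')"
  proof (intro bexI[of _ h2] conjI exI[of _ "min \<delta>2 (\<delta>1 / 2)"] ballI impI)
    show "dist h h2 < \<epsilon>" using dist_triangle[of h h2 h1] h1 h2 by linarith
    show "0 < min \<delta>2 (\<delta>1 / 2)" using h1 h2 by simp
    fix k assume k: "k \<in> S" "dist h2 k < min \<delta>2 (\<delta>1 / 2)"
    show "P k" using dist_triangle[of h1 k h2] h2 k by (intro h1(4)) auto
    show "Q k" using k by (intro h2(4)) auto
  qed (use h2 in simp)
qed

lemma dense_interior_on_True: "dense_interior_on S (\<lambda>_. True)"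
  unfolding dense_interior_on_def by (intro ballI allI impI, rule bexI[rotated]) (auto intro: exI[of _ 1])

lemma dense_interior_on_finite:
  assumes "finite I" "\<And>i. i \<in> I \<Longrightarrow> dense_interior_on S (P i)"
  shows "dense_interior_on S (\<lambda>h. \<forall>i\<in>I. P i h)"
  using assms
  by (induction I rule: finite_induct) (auto simp: dense_interior_on_True intro!: dense_interior_on_conj)

text \<open>Density has to be checked only at matrices where \<open>Q\<close> holds: a first move
  reaches the interior of \<open>Q\<close>, a second one reaches \<open>P\<close>. This is how an
  induction hypothesis enters a perturbation argument.\<close>

lemma dense_interior_on_open:
  assumes Q: "dense_interior_on S Q" and P: "open {h. P h}"
    and dense: "\<And>h \<epsilon>. h \<in> S \<Longrightarrow> Q h \<Longrightarrow> \<epsilon> > 0 \<Longrightarrow> \<exists>h'\<in>S. dist h h' < \<epsilon> \<and> P h'"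
  shows "dense_interior_on S P"
  unfolding dense_interior_on_def
proof (intro ballI allI impI)
  fix h and \<epsilon> :: real assume h: "h \<in> S" "\<epsilon> > 0"
  obtain h1 \<delta>1 where h1: "h1 \<in> S" "dist h h1 < \<epsilon> / 2" "\<delta>1 > 0" "\<And>k. k \<in> S \<Longrightarrow> dist h1 k < \<delta>1 \<Longrightarrow> Q k"
    by (rule dense_interior_onE[OF Q h(1) half_gt_zero[OF h(2)]]) blast
  obtain h2 where h2: "h2 \<in> S" "dist h1 h2 < \<epsilon> / 2" "P h2"
    using dense[OF h1(1) h1(4)[OF h1(1)], of "\<epsilon> / 2"] h1 h by auto
  obtain \<delta> where \<delta>: "\<delta> > 0" "ball h2 \<delta> \<subseteq> {h. P h}"
    by (rule openE[OF P, of h2]) (use h2 in auto)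
  show "\<exists>h'\<in>S. dist h h' < \<epsilon> \<and> (\<exists>\<delta>>0. \<forall>h''\<in>S. dist h' h'' < \<delta> \<longrightarrow> P h'')"
  proof (intro bexI[of _ h2] conjI exI[of _ \<delta>] ballI impI)
    show "dist h h2 < \<epsilon>" using dist_triangle[of h h2 h1] h1 h2 by linarith
  qed (use \<delta> h2 in auto)
qed

lemma small_real_avoiding_finite:
  fixes F :: "real set"
  assumes "finite F" "\<delta> > 0"
  obtains t where "0 < t" "t < \<delta>" "t \<notin> F"
proof -
  have "infinite ({0<..<\<delta>} - F)" using assms by (simp add: infinite_Ioo)
  then obtain t where "t \<in> {0<..<\<delta>} - F" by (metis finite.emptyI ex_in_conv)
  with that show ?thesis by auto
qed

text \<open>In its applications the property fails for only finitely many \<open>t\<close> on the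
  line in direction \<open>D\<close>; \<open>F\<close> collects these exceptional values.\<close>

lemma small_perturbation:
  fixes h D :: "'a::real_normed_vector"
  assumes S: "subspace S" "h \<in> S" "D \<in> S" and "finite F" "\<epsilon> > 0"
    and P: "\<And>t. t \<notin> F \<Longrightarrow> P (h + t *\<^sub>R D)"
  shows "\<exists>h'\<in>S. dist h h' < \<epsilon> \<and> P h'"
proof -
  have n: "norm D + 1 > 0" by (simp add: add_nonneg_pos)
  then obtain t where t: "0 < t" "t < \<epsilon> / (norm D + 1)" "t \<notin> F"
    using small_real_avoiding_finite[OF \<open>finite F\<close>, of "\<epsilon> / (norm D + 1)"] \<open>\<epsilon> > 0\<close> by auto
  have "dist h (h + t *\<^sub>R D) = t * norm D" using t by (simp add: dist_norm)
  also have "\<dots> \<le> t * (norm D + 1)" using t by (intro mult_left_mono) auto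
  also have "\<dots> < \<epsilon>" using t n by (simp add: field_simps)
  finally show ?thesis using S P t by (intro bexI[of _ "h + t *\<^sub>R D"]) (auto simp: subspace_add subspace_scale)
qed

lemma subspace_symmetric_on: "subspace (symmetric_on G)"
  unfolding subspace_def
proof (intro conjI ballI allI)
  fix x y :: "real^'a^'a" assume xy: "x \<in> symmetric_on G" "y \<in> symmetric_on G"
  have "x $ r $ s \<noteq> 0 \<or> y $ r $ s \<noteq> 0" if "(x + y) $ r $ s \<noteq> 0" for r s using that by auto
  moreover have "(x + y) $ r $ s = (x + y) $ s $ r" for r s
    using symmetric_on_nth[OF xy(1), of r s] symmetric_on_nth[OF xy(2), of r s] by simp
  ultimately show "x + y \<in> symmetric_on G" using xy unfolding symmetric_on_iff by blast
next
  fix c and x :: "real^'a^'a" assume x: "x \<in> symmetric_on G"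
  have "(c *\<^sub>R x) $ r $ s = (c *\<^sub>R x) $ s $ r" for r s using symmetric_on_nth[OF x, of r s] by simp
  moreover have "x $ r $ s \<noteq> 0" if "(c *\<^sub>R x) $ r $ s \<noteq> 0" for r s using that by auto
  ultimately show "c *\<^sub>R x \<in> symmetric_on G" using x unfolding symmetric_on_iff by blast
qed (simp add: symmetric_on_iff)

section \<open>Nonvanishing eigenvectors and disjoint spectra of blocks\<close>

definition nonvanishing_at :: "'v set \<Rightarrow> 'v \<Rightarrow> real^'v^'v::finite \<Rightarrow> bool" where
  "nonvanishing_at C r h \<longleftrightarrow> (\<forall>\<mu> x. x \<in> eigenspace C (principal_submatrix h C) \<mu> \<and> x $ r = 0 \<longrightarrow> x = 0)"

text \<open>For \<open>r\<close> outside \<open>K\<close>, the number \<open>(h *v x) $ r\<close> is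
  the row equation at \<open>r\<close> for \<open>x\<close> extended by zero: it vanishes exactly
  when \<open>x\<close> remains an eigenvector after adding \<open>r\<close> to
  \<open>K\<close>.\<close>

definition nonvanishing_coupling :: "'v set \<Rightarrow> 'v \<Rightarrow> real^'v^'v::finite \<Rightarrow> bool" where
  "nonvanishing_coupling K r h \<longleftrightarrow> (\<forall>\<mu> x. x \<in> eigenspace K (principal_submatrix h K) \<mu> \<and> (h *v x) $ r = 0 \<longrightarrow> x = 0)"

definition disjoint_spectra :: "'v set \<Rightarrow> 'v set \<Rightarrow> real^'v^'v::finite \<Rightarrow> bool" where
  "disjoint_spectra C C' h \<longleftrightarrow> (\<forall>\<mu> x y. x \<in> eigenspace C (principal_submatrix h C) \<mu> \<and>
     y \<in> eigenspace C' (principal_submatrix h C') \<mu> \<longrightarrow> x = 0 \<or> y = 0)"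

lemma rayleigh_principal:
  fixes h :: "real^'v^'v::finite"
  assumes "x \<in> eigenspace C (principal_submatrix h C) \<mu>" "norm x = 1"
  shows "x \<bullet> (h *v x) = \<mu>"
proof -
  have "x \<bullet> (h *v x) = (\<Sum>r\<in>UNIV. \<mu> * (x $ r * x $ r))"
    unfolding inner_vec_def
  proof (rule sum.cong)
    fix r show "x $ r \<bullet> (h *v x) $ r = \<mu> * (x $ r * x $ r)"
      using assms(1) by (cases "r \<in> C") (auto simp: eigenspace_principal_iff coord_space_iff)
  qed simp
  also have "\<dots> = \<mu> * (x \<bullet> x)" by (simp add: inner_vec_def sum_distrib_left)
  finally show ?thesis using assms(2) by (simp add: dot_square_norm)
qed

lemma eigenspace_scale:
  fixes x :: "real^'v::finite"
  assumes "x \<in> eigenspace C M \<mu>" shows "c *\<^sub>R x \<in> eigenspace C M \<mu>"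
  using vec.subspace_scale[OF subspace_eigenspace assms, of c] by (simp add: scalar_mult_eq_scaleR)

text \<open>Eigenvalues are eliminated through the Rayleigh quotient of a unit eigenvector, so that the
  quantified variable ranges over a compact sphere.\<close>

lemma open_no_eigenvector:
  fixes C :: "'v::finite set"
  assumes Z: "closed {p. Z (fst p) (snd p)}" and hom: "\<And>c x h. Z x h \<Longrightarrow> Z (c *\<^sub>R x) h"
  shows "open {h. \<forall>\<mu> x. x \<in> eigenspace C (principal_submatrix h C) \<mu> \<and> Z x h \<longrightarrow> x = (0::real^'v)}"
proof -
  define T where "T = {p :: (real^'v) \<times> (real^'v^'v). (\<forall>r. r \<notin> C \<longrightarrow> fst p $ r = 0) \<and>
      (\<forall>r\<in>C. (snd p *v fst p) $ r = (fst p \<bullet> (snd p *v fst p)) * fst p $ r) \<and> Z (fst p) (snd p)}"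
  have "closed T"
    unfolding T_def matrix_vector_mult_def Ball_def
    by (intro closed_Collect_conj closed_Collect_all closed_Collect_imp closed_Collect_eq open_Collect_const Z continuous_intros)
  then have "closed {h. \<exists>x. x \<in> sphere 0 1 \<and> (x, h) \<in> T}"
    by (rule closed_compact_projection[OF compact_sphere])
  moreover have "{h. \<forall>\<mu> x. x \<in> eigenspace C (principal_submatrix h C) \<mu> \<and> Z x h \<longrightarrow> x = 0}
      = - {h. \<exists>x. x \<in> sphere 0 1 \<and> (x, h) \<in> T}" (is "?L = - ?R")
  proof (intro set_eqI iffI)
    fix h assume h: "h \<in> ?L"
    show "h \<in> - ?R"
    proof clarsimp
      fix x :: "real^'v" assume x: "norm x = 1" "(x, h) \<in> T"
      then have "x \<in> eigenspace C (principal_submatrix h C) (x \<bullet> (h *v x))" "Z x h"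
        by (auto simp: T_def eigenspace_principal_iff coord_space_iff)
      with h have "x = 0" by blast
      with x show False by simp
    qed
  next
    fix h assume h: "h \<in> - ?R"
    show "h \<in> ?L"
    proof (clarsimp, rule ccontr)
      fix \<mu> x assume x: "x \<in> eigenspace C (principal_submatrix h C) \<mu>" "Z x h" "x \<noteq> 0"
      define y where "y = (1 / norm x) *\<^sub>R x"
      have y: "y \<in> eigenspace C (principal_submatrix h C) \<mu>" "Z y h" "norm y = 1"
        using x hom eigenspace_scale by (auto simp: y_def)
      then have "(y, h) \<in> T"
        by (simp add: T_def rayleigh_principal[OF y(1,3)]) (simp add: eigenspace_principal_iff coord_space_iff)
      with y h show False by auto
    qed
  qed
  ultimately show ?thesis by (simp add: open_closed)
qed

lemma open_nonvanishing_coupling: "open {h. nonvanishing_coupling K r h}"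
  unfolding nonvanishing_coupling_def
  by (rule open_no_eigenvector)
    (auto simp: matrix_vector_mult_def mult.left_commute simp flip: sum_distrib_left intro!: closed_Collect_eq continuous_intros)

text \<open>The same projection along compact spheres, now for pairs. Both eigenvalue equations use
  the Rayleigh quotient of the first vector, which expresses that the two eigenvalues
  coincide.\<close>

lemma open_disjoint_spectra: "open {h. disjoint_spectra C (C'::'v::finite set) h}"
proof -
  define T where "T = {p :: ((real^'v) \<times> (real^'v)) \<times> (real^'v^'v).
      (\<forall>r. r \<notin> C \<longrightarrow> fst (fst p) $ r = 0) \<and> (\<forall>r. r \<notin> C' \<longrightarrow> snd (fst p) $ r = 0) \<and>
      (\<forall>r\<in>C. (snd p *v fst (fst p)) $ r = (fst (fst p) \<bullet> (snd p *v fst (fst p))) * fst (fst p) $ r) \<and>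
      (\<forall>r\<in>C'. (snd p *v snd (fst p)) $ r = (fst (fst p) \<bullet> (snd p *v fst (fst p))) * snd (fst p) $ r)}"
  have "closed T"
    unfolding T_def matrix_vector_mult_def Ball_def
    by (intro closed_Collect_conj closed_Collect_all closed_Collect_imp closed_Collect_eq open_Collect_const continuous_intros)
  then have "closed {h. \<exists>z. z \<in> sphere 0 1 \<times> sphere 0 1 \<and> (z, h) \<in> T}"
    by (rule closed_compact_projection[OF compact_Times[OF compact_sphere compact_sphere]])
  moreover have "{h. disjoint_spectra C C' h}
      = - {h. \<exists>z. z \<in> sphere 0 1 \<times> sphere 0 1 \<and> (z, h) \<in> T}" (is "?L = - ?R")
  proof (intro set_eqI iffI)
    fix h assume h: "h \<in> ?L"
    show "h \<in> - ?R"
    proof clarsimp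
      fix x y :: "real^'v" assume x: "norm x = 1" "norm y = 1" "((x, y), h) \<in> T"
      then have "x \<in> eigenspace C (principal_submatrix h C) (x \<bullet> (h *v x))"
          "y \<in> eigenspace C' (principal_submatrix h C') (x \<bullet> (h *v x))"
        by (auto simp: T_def eigenspace_principal_iff coord_space_iff)
      with h have "x = 0 \<or> y = 0" unfolding disjoint_spectra_def by blast
      with x show False by auto
    qed
  next
    fix h assume h: "h \<in> - ?R"
    show "h \<in> ?L" unfolding disjoint_spectra_def
    proof (clarsimp, rule ccontr)
      fix \<mu> x y assume x: "x \<in> eigenspace C (principal_submatrix h C) \<mu>" "x \<noteq> 0"
        and y: "y \<in> eigenspace C' (principal_submatrix h C') \<mu>" "y \<noteq> 0"
      define x' y' where "x' = (1 / norm x) *\<^sub>R x" and "y' = (1 / norm y) *\<^sub>R y"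
      have x': "x' \<in> eigenspace C (principal_submatrix h C) \<mu>" "norm x' = 1"
        and y': "y' \<in> eigenspace C' (principal_submatrix h C') \<mu>" "norm y' = 1"
        using x y eigenspace_scale by (auto simp: x'_def y'_def)
      then have "((x', y'), h) \<in> T"
        by (simp add: T_def rayleigh_principal[OF x']) (simp add: eigenspace_principal_iff coord_space_iff)
      with x' y' h show False by auto
    qed
  qed
  ultimately show ?thesis by (simp add: open_closed)
qed

text \<open>The combination of \<open>x\<close> and \<open>y\<close> that vanishes at
  \<open>r\<close> is again in the eigenspace, hence 0: nonvanishing at a single vertex already
  forces simple eigenvalues.\<close>

lemma nonvanishing_at_unique:
  assumes "nonvanishing_at C r h" and x: "x \<in> eigenspace C (principal_submatrix h C) \<mu>" "x \<noteq> 0"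
    and y: "y \<in> eigenspace C (principal_submatrix h C) \<mu>"
  shows "x $ r \<noteq> 0" "y = (y $ r / x $ r) *\<^sub>R x"
proof -
  show r: "x $ r \<noteq> 0" using assms by (auto simp: nonvanishing_at_def)
  let ?c = "y $ r / x $ r"
  have "y - ?c *\<^sub>R x \<in> eigenspace C (principal_submatrix h C) \<mu>"
    using vec.subspace_diff[OF subspace_eigenspace y eigenspace_scale[OF x(1), of ?c]] by simp
  moreover have "(y - ?c *\<^sub>R x) $ r = 0" using r by simp
  ultimately have "y - ?c *\<^sub>R x = 0" using assms(1) unfolding nonvanishing_at_def by blast
  then show "y = ?c *\<^sub>R x" by simp
qed

lemma dense_interior_disjoint_spectra:
  fixes G :: "('v::finite, 'e) pre_digraph"
  assumes C: "C \<subseteq> verts G" "C \<inter> C' = {}"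
  shows "dense_interior_on (symmetric_on G) (disjoint_spectra C C')"
proof (rule dense_interior_on_open[OF dense_interior_on_True open_disjoint_spectra])
  fix h and \<epsilon> :: real assume h: "h \<in> symmetric_on G" and "\<epsilon> > 0"
  define D :: "real^'v^'v" where "D = (\<chi> r s. if r = s \<and> r \<in> C then 1 else 0)"
  have D: "D \<in> symmetric_on G" using C by (auto simp: symmetric_on_iff D_def)
  have shift: "((h + t *\<^sub>R D) *v x) $ r = (h *v x) $ r + (if r \<in> C then t * x $ r else 0)" for t x r
  proof -
    have "(D *v x) $ r = (\<Sum>s\<in>UNIV. if s = r then (if r \<in> C then x $ r else 0) else 0)"
      unfolding matrix_vector_mult_def D_def by (simp only: vec_lambda_beta, rule sum.cong[OF refl]) auto
    then have "(D *v x) $ r = (if r \<in> C then x $ r else 0)" by simp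
    then show ?thesis by (simp add: matrix_vector_mult_add_rdistrib scaleR_matrix_vector_assoc[symmetric])
  qed
  \<comment> \<open>Adding \<open>t\<close> on the diagonal of \<open>C\<close> translates the
    spectrum of that block and fixes that of \<open>C'\<close>; the two can meet only if
    \<open>t\<close> is a difference of old eigenvalues.\<close>
  let ?F = "(\<lambda>(a, b). a - b) ` (spectrum C' (principal_submatrix h C') \<times> spectrum C (principal_submatrix h C))"
  have sym: "h $ r $ s = h $ s $ r" for r s by (rule symmetric_on_nth[OF h])
  have fin: "finite ?F" by (intro finite_imageI finite_cartesian_product finite_spectrum_principal sym)
  show "\<exists>h'\<in>symmetric_on G. dist h h' < \<epsilon> \<and> disjoint_spectra C C' h'"
  proof (rule small_perturbation[OF subspace_symmetric_on h D fin \<open>\<epsilon> > 0\<close>])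
    fix t assume t: "t \<notin> ?F"
    show "disjoint_spectra C C' (h + t *\<^sub>R D)" unfolding disjoint_spectra_def
    proof (clarify, rule ccontr)
      fix \<mu> x y
      assume x: "x \<in> eigenspace C (principal_submatrix (h + t *\<^sub>R D) C) \<mu>"
        and y: "y \<in> eigenspace C' (principal_submatrix (h + t *\<^sub>R D) C') \<mu>" and nz: "x \<noteq> 0" "y \<noteq> 0"
      have "y \<in> eigenspace C' (principal_submatrix h C') \<mu>"
        unfolding eigenspace_principal_iff
      proof (intro conjI ballI)
        show "y \<in> coord_space C'" using y by (simp add: eigenspace_principal_iff)
        fix r assume r: "r \<in> C'"
        then have "((h + t *\<^sub>R D) *v y) $ r = \<mu> * y $ r" using y unfolding eigenspace_principal_iff by blast
        moreover have "r \<notin> C" using r C(2) by blast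
        ultimately show "(h *v y) $ r = \<mu> * y $ r" unfolding shift by simp
      qed
      moreover have "x \<in> eigenspace C (principal_submatrix h C) (\<mu> - t)"
        using x unfolding eigenspace_principal_iff shift by (simp add: algebra_simps)
      ultimately have "(\<mu>, \<mu> - t) \<in> spectrum C' (principal_submatrix h C') \<times> spectrum C (principal_submatrix h C)"
        using nz by (auto simp: spectrum_def)
      from imageI[OF this, of "\<lambda>(a, b). a - b"] t show False by simp
    qed
  qed
qed

text \<open>Changing the entry at \<open>r\<close>, \<open>s\<close> leaves the block on
  \<open>K\<close> and its eigenvectors untouched because \<open>r\<close> is outside
  \<open>K\<close>, while the row equation at \<open>r\<close> changes by \<open>t * x $ s\<close>,
  and \<open>x $ s\<close> is not 0.\<close>

lemma dense_interior_nonvanishing_coupling: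
  fixes G :: "('v::finite, 'e) pre_digraph"
  assumes K: "dense_interior_on (symmetric_on G) (\<lambda>h. \<forall>s\<in>K. nonvanishing_at K s h)"
    and r: "r \<notin> K" and s: "s \<in> K" and V: "r \<in> verts G" "s \<in> verts G" and E: "r \<rightarrow>\<^bsub>G\<^esub> s" "s \<rightarrow>\<^bsub>G\<^esub> r"
  shows "dense_interior_on (symmetric_on G) (nonvanishing_coupling K r)"
proof (rule dense_interior_on_open[OF K open_nonvanishing_coupling])
  fix h and \<epsilon> :: real assume h: "h \<in> symmetric_on G" and "\<epsilon> > 0" and nv: "\<forall>s\<in>K. nonvanishing_at K s h"
  define D :: "real^'v^'v" where "D = (\<chi> a b. if (a = r \<and> b = s) \<or> (a = s \<and> b = r) then 1 else 0)"
  have D: "D \<in> symmetric_on G" using V E by (auto simp: symmetric_on_iff D_def)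
  have shift: "((h + t *\<^sub>R D) *v x) $ a = (h *v x) $ a + (if a = r then t * x $ s else if a = s then t * x $ r else 0)" for t x a
  proof -
    have "(D *v x) $ a = (\<Sum>b\<in>UNIV. if b = (if a = r then s else r) then (if a = r then x $ s else if a = s then x $ r else 0) else 0)"
      unfolding matrix_vector_mult_def D_def
      by (simp only: vec_lambda_beta, rule sum.cong[OF refl]) (use r s in auto)
    then have "(D *v x) $ a = (if a = r then x $ s else if a = s then x $ r else 0)" by simp
    then show ?thesis by (simp add: matrix_vector_mult_add_rdistrib scaleR_matrix_vector_assoc[symmetric])
  qed
  let ?E = "\<lambda>\<mu>. eigenspace K (principal_submatrix h K) \<mu>"
  define v where "v \<mu> = (SOME x. x \<in> ?E \<mu> \<and> x \<noteq> 0)" for \<mu>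
  have v: "v \<mu> \<in> ?E \<mu>" "v \<mu> \<noteq> 0" if "\<mu> \<in> spectrum K (principal_submatrix h K)" for \<mu>
  proof -
    have "\<exists>x. x \<in> ?E \<mu> \<and> x \<noteq> 0" using that by (auto simp: spectrum_def)
    then have "v \<mu> \<in> ?E \<mu> \<and> v \<mu> \<noteq> 0" unfolding v_def by (rule someI_ex)
    then show "v \<mu> \<in> ?E \<mu>" "v \<mu> \<noteq> 0" by auto
  qed
  \<comment> \<open>Each eigenspace of the block is a line, so it is represented by the single
    vector \<open>v \<mu>\<close> and rules out exactly one value of \<open>t\<close>.\<close>
  let ?F = "(\<lambda>\<mu>. - (h *v v \<mu>) $ r / v \<mu> $ s) ` spectrum K (principal_submatrix h K)"
  have sym: "h $ a $ b = h $ b $ a" for a b by (rule symmetric_on_nth[OF h])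
  have fin: "finite ?F" by (intro finite_imageI finite_spectrum_principal sym)
  show "\<exists>h'\<in>symmetric_on G. dist h h' < \<epsilon> \<and> nonvanishing_coupling K r h'"
  proof (rule small_perturbation[OF subspace_symmetric_on h D fin \<open>\<epsilon> > 0\<close>])
    fix t assume t: "t \<notin> ?F"
    show "nonvanishing_coupling K r (h + t *\<^sub>R D)" unfolding nonvanishing_coupling_def
    proof (clarify, rule ccontr)
      fix \<mu> x
      assume x: "x \<in> eigenspace K (principal_submatrix (h + t *\<^sub>R D) K) \<mu>"
        and z: "((h + t *\<^sub>R D) *v x) $ r = 0" and nz: "x \<noteq> 0"
      have "x $ r = 0" using x r by (auto simp: eigenspace_principal_iff coord_space_iff)
      then have "((h + t *\<^sub>R D) *v x) $ a = (h *v x) $ a" if "a \<in> K" for a unfolding shift using r that \<open>x $ r = 0\<close> by auto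
      then have xE: "x \<in> ?E \<mu>" using x by (simp add: eigenspace_principal_iff)
      then have \<mu>: "\<mu> \<in> spectrum K (principal_submatrix h K)" using nz by (auto simp: spectrum_def)
      have nvs: "nonvanishing_at K s h" using nv s by blast
      define c where "c = x $ s / v \<mu> $ s"
      have vs: "v \<mu> $ s \<noteq> 0" and xc: "x = c *\<^sub>R v \<mu>"
        using nonvanishing_at_unique[OF nvs v[OF \<mu>] xE] by (auto simp: c_def)
      have c: "c \<noteq> 0" using nz xc by auto
      have "(h *v x) $ r + t * x $ s = 0" using z unfolding shift by simp
      then have "c * ((h *v v \<mu>) $ r + t * v \<mu> $ s) = 0"
        by (subst (asm) (1 2) xc) (simp add: matrix_vector_mult_scaleR algebra_simps)
      then have "(h *v v \<mu>) $ r + t * v \<mu> $ s = 0" using c by simp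
      then have "t = - (h *v v \<mu>) $ r / v \<mu> $ s" using vs by (simp add: field_simps)
      with t \<mu> show False by blast
    qed
  qed
qed


section \<open>Components of induced subgraphs\<close>

definition arcs_in :: "('v, 'e) pre_digraph \<Rightarrow> 'v set \<Rightarrow> 'v rel" where
  "arcs_in G J = arcs_ends G \<inter> J \<times> J"

text \<open>By reflexivity the component of a vertex outside \<open>J\<close> is that vertex alone;
  membership of \<open>u\<close> in \<open>J\<close> is therefore assumed separately where it
  matters.\<close>

definition component_of :: "('v, 'e) pre_digraph \<Rightarrow> 'v set \<Rightarrow> 'v \<Rightarrow> 'v set" where
  "component_of G J u = (arcs_in G J)\<^sup>* `` {u}"

definition connected_in :: "('v, 'e) pre_digraph \<Rightarrow> 'v set \<Rightarrow> bool" where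
  "connected_in G C \<longleftrightarrow> (\<forall>u\<in>C. \<forall>v\<in>C. (u, v) \<in> (arcs_in G C)\<^sup>*)"

lemma arcs_ends_induce: "arcs_ends (G \<restriction> J) = arcs_in G J"
  by (auto simp: arcs_ends_def arcs_in_def arc_to_ends_def)

lemma rtrancl_on_iff:
  assumes "r \<subseteq> F \<times> F"
  shows "(a, b) \<in> rtrancl_on F r \<longleftrightarrow> a \<in> F \<and> (a, b) \<in> r\<^sup>*"
proof
  assume "(a, b) \<in> rtrancl_on F r"
  then show "a \<in> F \<and> (a, b) \<in> r\<^sup>*" by (induction rule: rtrancl_on_induct) auto
next
  assume "a \<in> F \<and> (a, b) \<in> r\<^sup>*"
  then have "(a, b) \<in> r\<^sup>*" "a \<in> F" by auto
  then show "(a, b) \<in> rtrancl_on F r"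
    by (induction rule: rtrancl_induct) (use assms in \<open>auto intro: rtrancl_on_into_rtrancl_on\<close>)
qed

lemma reachable_induce_iff: "u \<rightarrow>\<^sup>*\<^bsub>G \<restriction> J\<^esub> v \<longleftrightarrow> u \<in> J \<and> v \<in> component_of G J u"
  unfolding reachable_def arcs_ends_induce component_of_def
  by (simp add: rtrancl_on_iff arcs_in_def)

lemma component_of_self [simp]: "u \<in> component_of G J u"
  by (simp add: component_of_def)

lemma component_of_subset: "u \<in> J \<Longrightarrow> component_of G J u \<subseteq> J"
proof
  fix v assume "u \<in> J" "v \<in> component_of G J u"
  then have "(u, v) \<in> (arcs_in G J)\<^sup>*" by (simp add: component_of_def)
  then show "v \<in> J" using \<open>u \<in> J\<close> by (induction rule: rtrancl_induct) (auto simp: arcs_in_def)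
qed

lemma component_of_step:
  "v \<in> component_of G J u \<Longrightarrow> v \<in> J \<Longrightarrow> w \<in> J \<Longrightarrow> v \<rightarrow>\<^bsub>G\<^esub> w \<Longrightarrow> w \<in> component_of G J u"
  unfolding component_of_def Image_singleton_iff
  by (erule rtrancl_into_rtrancl) (simp add: arcs_in_def)

lemma connected_component_of: 
  assumes sym: "sym (arcs_ends G)" and u: "u \<in> J"
  shows "connected_in G (component_of G J u)"
proof -
  let ?K = "component_of G J u"
  have symJ: "sym ((arcs_in G K)\<^sup>*)" for K
    using sym by (intro sym_rtrancl) (auto simp: arcs_in_def sym_def)
  have from_u: "(u, v) \<in> (arcs_in G ?K)\<^sup>*" if "v \<in> ?K" for v
  proof -
    from that have "(u, v) \<in> (arcs_in G J)\<^sup>*" by (simp add: component_of_def)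
    then show ?thesis
    proof (induction rule: rtrancl_induct)
      case (step y z)
      have y: "y \<in> ?K" using step by (simp add: component_of_def)
      moreover have "z \<in> ?K" using step y component_of_step[of y G J u z] by (simp add: arcs_in_def)
      ultimately have "(y, z) \<in> arcs_in G ?K" using step by (simp add: arcs_in_def)
      with step show ?case by (meson rtrancl_into_rtrancl)
    qed simp
  qed
  then show ?thesis unfolding connected_in_def
    using symJ[THEN symD] by (meson rtrancl_trans)
qed

lemma component_of_eq:
  assumes sym: "sym (arcs_ends G)" and "v \<in> component_of G J u"
  shows "component_of G J v = component_of G J u"
proof -
  have "sym ((arcs_in G J)\<^sup>*)"
    using sym by (intro sym_rtrancl) (auto simp: arcs_in_def sym_def)
  then show ?thesis using assms(2) unfolding component_of_def
    by (auto dest: symD intro: rtrancl_trans)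
qed

lemma component_of_disjoint:
  assumes "sym (arcs_ends G)" "component_of G J v \<noteq> component_of G J u"
  shows "component_of G J v \<inter> component_of G J u = {}"
  using component_of_eq[OF assms(1)] assms(2) by blast

text \<open>Otherwise the component would be closed under the arcs inside \<open>C\<close>, and
  \<open>r\<close> could not be reached. The neighbour found here supplies the entry that is
  perturbed in the coupling argument.\<close>

lemma component_of_adjacent_removed:
  assumes sym: "sym (arcs_ends G)" and C: "connected_in G C" "r \<in> C" and u: "u \<in> C - {r}"
  shows "\<exists>s\<in>component_of G (C - {r}) u. s \<rightarrow>\<^bsub>G\<^esub> r"
proof (rule ccontr)
  assume no: "\<not> ?thesis"
  have "v \<in> component_of G (C - {r}) u" if "(u, v) \<in> (arcs_in G C)\<^sup>*" for v
    using that
  proof (induction rule: rtrancl_induct)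
    case (step y z)
    moreover have "y \<in> C - {r}" using step component_of_subset[OF u, of G] by blast
    moreover have "z \<noteq> r" using step no by (auto simp: arcs_in_def)
    ultimately show ?case using component_of_step[of y G "C - {r}" u z] by (auto simp: arcs_in_def)
  qed simp
  moreover have "(u, r) \<in> (arcs_in G C)\<^sup>*" using C u by (auto simp: connected_in_def)
  ultimately show False using component_of_subset[OF u, of G] by blast
qed

definition restrict_vec :: "'v set \<Rightarrow> 'a::zero^'v \<Rightarrow> 'a^'v::finite" where
  "restrict_vec K x = (\<chi> r. if r \<in> K then x $ r else 0)"

lemma restrict_vec_nth [simp]: "restrict_vec K x $ r = (if r \<in> K then x $ r else 0)"
  by (simp add: restrict_vec_def)

text \<open>No arc leaves the component inside \<open>J\<close>, so the rows of \<open>h\<close> at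
  its vertices only see the entries of \<open>x\<close> there.\<close>

lemma eigenspace_restrict_component:
  fixes G :: "('v::finite, 'e) pre_digraph"
  assumes h: "h \<in> symmetric_on G" and u: "u \<in> J"
    and x: "x \<in> eigenspace J (principal_submatrix h J) \<mu>"
  shows "restrict_vec (component_of G J u) x
    \<in> eigenspace (component_of G J u) (principal_submatrix h (component_of G J u)) \<mu>"
proof -
  let ?K = "component_of G J u"
  have "(h *v restrict_vec ?K x) $ r = (h *v x) $ r" if r: "r \<in> ?K" for r
    unfolding matrix_vector_mult_def vec_lambda_beta
  proof (rule sum.cong[OF refl])
    fix s
    show "h $ r $ s * restrict_vec ?K x $ s = h $ r $ s * x $ s"
    proof (cases "s \<in> ?K \<or> x $ s = 0 \<or> h $ r $ s = 0")
      case False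
      then have "s \<in> J" using x by (auto simp: eigenspace_principal_iff coord_space_iff)
      moreover have "r \<in> J" using r component_of_subset[OF u] by blast
      moreover have "r \<rightarrow>\<^bsub>G\<^esub> s" using h False r unfolding symmetric_on_iff by metis
      ultimately have "s \<in> ?K" using component_of_step[of r G J u s] r by blast
      then show ?thesis using False by simp
    qed auto
  qed
  moreover have "r \<in> J" if "r \<in> ?K" for r using that component_of_subset[OF u] by blast
  ultimately show ?thesis using x by (auto simp: eigenspace_principal_iff coord_space_iff)
qed

text \<open>\<open>x\<close> certifies that \<open>\<mu>\<close> is an eigenvalue of the component
  of \<open>u\<close>. A nonzero restriction of \<open>y\<close> to another component would make
  \<open>\<mu>\<close> a common eigenvalue of two components.\<close>

lemma eigenvector_in_component:
  fixes G :: "('v::finite, 'e) pre_digraph"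
  assumes h: "h \<in> symmetric_on G" and u: "u \<in> J"
    and x: "x \<in> eigenspace J (principal_submatrix h J) \<mu>" "x $ u \<noteq> 0"
    and y: "y \<in> eigenspace J (principal_submatrix h J) \<mu>"
    and ds: "\<And>v. v \<in> J \<Longrightarrow> component_of G J v \<noteq> component_of G J u \<Longrightarrow>
      disjoint_spectra (component_of G J v) (component_of G J u) h"
  shows "y \<in> eigenspace (component_of G J u) (principal_submatrix h (component_of G J u)) \<mu>"
proof -
  let ?K = "component_of G J u"
  have "restrict_vec ?K x $ u \<noteq> 0" using x(2) by simp
  then have x0: "restrict_vec ?K x \<noteq> 0" by force
  have "y $ v = 0" if v: "v \<notin> ?K" for v
  proof (cases "v \<in> J")
    case True
    have "component_of G J v \<noteq> ?K" using v by (metis component_of_self)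
    then have "restrict_vec (component_of G J v) y = 0"
      using ds[OF True] x0 eigenspace_restrict_component[OF h True y] eigenspace_restrict_component[OF h u x(1)]
      unfolding disjoint_spectra_def by blast
    then show ?thesis by (metis component_of_self restrict_vec_nth zero_index)
  next
    case False then show ?thesis using y by (auto simp: eigenspace_principal_iff coord_space_iff)
  qed
  then have "restrict_vec ?K y = y" by (auto simp: vec_eq_iff)
  then show ?thesis using eigenspace_restrict_component[OF h u y] by simp
qed

lemma nonvanishing_at_step:
  fixes G :: "('v::finite, 'e) pre_digraph"
  assumes h: "h \<in> symmetric_on G"
    and coupling: "\<And>u. u \<in> C - {r} \<Longrightarrow> nonvanishing_coupling (component_of G (C - {r}) u) r h"
    and ds: "\<And>u v. u \<in> C - {r} \<Longrightarrow> v \<in> C - {r} \<Longrightarrow> component_of G (C - {r}) v \<noteq> component_of G (C - {r}) u \<Longrightarrow>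
      disjoint_spectra (component_of G (C - {r}) v) (component_of G (C - {r}) u) h"
    and r: "r \<in> C"
  shows "nonvanishing_at C r h"
  unfolding nonvanishing_at_def
proof (clarify, rule ccontr)
  fix \<mu> x assume x: "x \<in> eigenspace C (principal_submatrix h C) \<mu>" "x $ r = 0" "x \<noteq> 0"
  let ?J = "C - {r}"
  have xJ: "x \<in> eigenspace ?J (principal_submatrix h ?J) \<mu>"
    using x by (auto simp: eigenspace_principal_iff coord_space_iff)
  obtain u where u: "x $ u \<noteq> 0" using x(3) by (auto simp: vec_eq_iff)
  then have uJ: "u \<in> ?J" using x by (auto simp: eigenspace_principal_iff coord_space_iff)
  have "x \<in> eigenspace (component_of G ?J u) (principal_submatrix h (component_of G ?J u)) \<mu>"
    by (rule eigenvector_in_component[OF h uJ xJ u xJ ds[OF uJ]])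
  moreover have "(h *v x) $ r = 0" using x r by (auto simp: eigenspace_principal_iff)
  ultimately show False using coupling[OF uJ] x(3) unfolding nonvanishing_coupling_def by blast
qed

text \<open>The coupling step for a component of \<open>C - {r}\<close> needs eigenvectors that do
  not vanish at a neighbour of \<open>r\<close>, which is the same claim for a smaller connected set
  and another vertex. Hence the induction on \<open>card C\<close> with both \<open>C\<close> and
  \<open>r\<close> arbitrary.\<close>

lemma dense_interior_nonvanishing_at:
  fixes G :: "('v::finite, 'e) pre_digraph"
  assumes sym: "sym (arcs_ends G)"
  shows "C \<subseteq> verts G \<Longrightarrow> connected_in G C \<Longrightarrow> r \<in> C \<Longrightarrow> dense_interior_on (symmetric_on G) (nonvanishing_at C r)"
proof (induction "card C" arbitrary: C r rule: less_induct)
  case less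
  let ?J = "C - {r}"
  let ?K = "\<lambda>u. component_of G ?J u"
  have K: "?K u \<subseteq> ?J" if "u \<in> ?J" for u using component_of_subset[OF that] .
  have nv: "dense_interior_on (symmetric_on G) (\<lambda>h. \<forall>s\<in>?K u. nonvanishing_at (?K u) s h)" if u: "u \<in> ?J" for u
  proof (rule dense_interior_on_finite)
    fix s assume s: "s \<in> ?K u"
    have "?K u \<subset> C" using K[OF u] less.prems by blast
    then have "card (?K u) < card C" by (simp add: psubset_card_mono)
    then show "dense_interior_on (symmetric_on G) (nonvanishing_at (?K u) s)"
      using less.prems K[OF u] connected_component_of[OF sym u] s by (intro less.hyps) auto
  qed simp
  have coupling: "dense_interior_on (symmetric_on G) (nonvanishing_coupling (?K u) r)" if u: "u \<in> ?J" for u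
  proof -
    obtain s where s: "s \<in> ?K u" "s \<rightarrow>\<^bsub>G\<^esub> r"
      using component_of_adjacent_removed[OF sym less.prems(2,3) u] by blast
    moreover have "r \<rightarrow>\<^bsub>G\<^esub> s" using s sym by (meson symD)
    ultimately show ?thesis using K[OF u] less.prems
      by (intro dense_interior_nonvanishing_coupling[OF nv[OF u], of r s]) auto
  qed
  have "dense_interior_on (symmetric_on G) (\<lambda>h. (\<forall>u\<in>?J. nonvanishing_coupling (?K u) r h) \<and>
     (\<forall>p\<in>{p \<in> ?J \<times> ?J. ?K (snd p) \<noteq> ?K (fst p)}. disjoint_spectra (?K (snd p)) (?K (fst p)) h))"
  proof (intro dense_interior_on_conj dense_interior_on_finite coupling)
    fix p assume p: "p \<in> {p \<in> ?J \<times> ?J. ?K (snd p) \<noteq> ?K (fst p)}"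
    then obtain u v where uv: "p = (u, v)" "v \<in> ?J" "?K v \<noteq> ?K u" by force
    have "?K v \<subseteq> verts G" using K[OF uv(2)] less.prems(1) by blast
    then show "dense_interior_on (symmetric_on G) (disjoint_spectra (?K (snd p)) (?K (fst p)))"
      unfolding uv(1) fst_conv snd_conv
      using component_of_disjoint[OF sym uv(3)] by (rule dense_interior_disjoint_spectra)
  qed auto
  then show ?case
  proof (rule dense_interior_on_mono)
    fix h assume h: "h \<in> symmetric_on G" and
      P: "(\<forall>u\<in>?J. nonvanishing_coupling (?K u) r h) \<and>
        (\<forall>p\<in>{p \<in> ?J \<times> ?J. ?K (snd p) \<noteq> ?K (fst p)}. disjoint_spectra (?K (snd p)) (?K (fst p)) h)"
    show "nonvanishing_at C r h"
    proof (rule nonvanishing_at_step[OF h _ _ less.prems(3)])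
      show "nonvanishing_coupling (?K u) r h" if "u \<in> ?J" for u using P that by blast
      show "disjoint_spectra (?K v) (?K u) h" if "u \<in> ?J" "v \<in> ?J" "?K v \<noteq> ?K u" for u v
        using P that by force
    qed
  qed
qed

section \<open>Signings and genericity\<close>

definition flip_signs :: "('v \<times> 'v) set \<Rightarrow> real^'v^'v \<Rightarrow> real^'v^'v::finite" where
  "flip_signs T h = (\<chi> r s. if (r, s) \<in> T then - h $ r $ s else h $ r $ s)"

lemma flip_signs_nth [simp]: "flip_signs T h $ r $ s = (if (r, s) \<in> T then - h $ r $ s else h $ r $ s)"
  by (simp add: flip_signs_def)

lemma flip_signs_involution: "flip_signs T (flip_signs T h) = h"
  by (simp add: vec_eq_iff)

lemma flip_signs_symmetric_on:
  assumes "sym T" "h \<in> symmetric_on G" shows "flip_signs T h \<in> symmetric_on G"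
proof -
  have "flip_signs T h $ r $ s = flip_signs T h $ s $ r" for r s
    using symD[OF assms(1)] symmetric_on_nth[OF assms(2), of r s] by auto
  moreover have "h $ r $ s \<noteq> 0" if "flip_signs T h $ r $ s \<noteq> 0" for r s using that by (auto split: if_splits)
  ultimately show ?thesis using assms(2) unfolding symmetric_on_iff by blast
qed

lemma dist_flip_signs: "dist (flip_signs T h) (flip_signs T h') = dist h h'"
proof -
  have "norm (flip_signs T h - flip_signs T h') = norm (h - h')"
    unfolding norm_vec_def by (intro arg_cong2[where f = L2_set] ext refl) (auto simp: abs_minus_commute)
  then show ?thesis by (simp add: dist_norm)
qed

text \<open>For symmetric \<open>T\<close> the flip is an isometric involution of
  \<open>symmetric_on G\<close>, so a dense interior is transported unchanged. All signings are
  thereby covered by finitely many copies of one statement.\<close>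

lemma dense_interior_flip_signs:
  assumes "sym T" "dense_interior_on (symmetric_on G) P"
  shows "dense_interior_on (symmetric_on G) (\<lambda>h. P (flip_signs T h))"
  unfolding dense_interior_on_def
proof (intro ballI allI impI)
  fix h and \<epsilon> :: real assume h: "h \<in> symmetric_on G" "\<epsilon> > 0"
  obtain k \<delta> where k: "k \<in> symmetric_on G" "dist (flip_signs T h) k < \<epsilon>" "\<delta> > 0"
    "\<And>k'. k' \<in> symmetric_on G \<Longrightarrow> dist k k' < \<delta> \<Longrightarrow> P k'"
    by (rule dense_interior_onE[OF assms(2) flip_signs_symmetric_on[OF assms(1) h(1)] h(2)]) blast
  show "\<exists>h'\<in>symmetric_on G. dist h h' < \<epsilon> \<and>
    (\<exists>\<delta>>0. \<forall>h''\<in>symmetric_on G. dist h' h'' < \<delta> \<longrightarrow> P (flip_signs T h''))"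
  proof (intro bexI[of _ "flip_signs T k"] conjI exI[of _ \<delta>] ballI impI)
    show "flip_signs T k \<in> symmetric_on G" using flip_signs_symmetric_on[OF assms(1) k(1)] .
    show "dist h (flip_signs T k) < \<epsilon>" using k(2) by (metis dist_flip_signs flip_signs_involution)
    show "P (flip_signs T h'')" if "h'' \<in> symmetric_on G" "dist (flip_signs T k) h'' < \<delta>" for h''
      using that flip_signs_symmetric_on[OF assms(1) that(1)]
      by (intro k(4)) (metis dist_flip_signs flip_signs_involution)+
  qed (rule k)
qed

text \<open>These conditions on blocks yield simple spectra, supports equal to components and,
  through sets of two vertices, nonzero entries on all arcs.\<close>

definition spectrally_generic :: "('v::finite, 'e) pre_digraph \<Rightarrow> real^'v^'v \<Rightarrow> bool" where
  "spectrally_generic G h \<longleftrightarrow>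
     (\<forall>C r. C \<subseteq> verts G \<longrightarrow> connected_in G C \<longrightarrow> r \<in> C \<longrightarrow> nonvanishing_at C r h) \<and>
     (\<forall>C C'. C \<subseteq> verts G \<longrightarrow> C \<inter> C' = {} \<longrightarrow> disjoint_spectra C C' h)"

lemma dense_interior_spectrally_generic:
  fixes G :: "('v::finite, 'e) pre_digraph"
  assumes sym: "sym (arcs_ends G)"
  shows "dense_interior_on (symmetric_on G) (spectrally_generic G)"
proof -
  have "dense_interior_on (symmetric_on G) (\<lambda>h.
     (\<forall>p\<in>{(C, r). C \<subseteq> verts G \<and> connected_in G C \<and> r \<in> C}. nonvanishing_at (fst p) (snd p) h) \<and>
     (\<forall>p\<in>{(C, C'). C \<subseteq> verts G \<and> C \<inter> C' = {}}. disjoint_spectra (fst p) (snd p) h))"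
    by (intro dense_interior_on_conj dense_interior_on_finite finite)
      (auto intro: dense_interior_nonvanishing_at[OF sym] dense_interior_disjoint_spectra)
  then show ?thesis
    by (rule dense_interior_on_mono) (auto simp: spectrally_generic_def)
qed

text \<open>With \<open>y\<close> ranging over the whole eigenspace, this gives the uniqueness of
  the component in \<open>generic\<close> and, applied to a combination vanishing at
  \<open>u\<close>, simplicity of the eigenvalue.\<close>

lemma spectrally_generic_support:
  fixes G :: "('v::finite, 'e) pre_digraph"
  assumes sym: "sym (arcs_ends G)" and h: "h \<in> symmetric_on G" and gen: "spectrally_generic G h" and J: "J \<subseteq> verts G"
    and x: "x \<in> eigenspace J (principal_submatrix h J) \<mu>" "x $ u \<noteq> 0"
    and y: "y \<in> eigenspace J (principal_submatrix h J) \<mu>" "y \<noteq> 0"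
  shows "u \<in> J" "vec_support y = component_of G J u"
proof -
  let ?K = "component_of G J u"
  show u: "u \<in> J" using x by (auto simp: eigenspace_principal_iff coord_space_iff)
  have K: "?K \<subseteq> verts G" using component_of_subset[OF u] J by blast
  have yK: "y \<in> eigenspace ?K (principal_submatrix h ?K) \<mu>"
  proof (rule eigenvector_in_component[OF h u x y(1)])
    fix v assume "v \<in> J" "component_of G J v \<noteq> ?K"
    then show "disjoint_spectra (component_of G J v) ?K h"
      using gen component_of_disjoint[OF sym] component_of_subset[of v J G] J
      unfolding spectrally_generic_def by (metis (no_types, lifting) subset_trans)
  qed
  moreover have "nonvanishing_at ?K r h" if "r \<in> ?K" for r
    using gen that K connected_component_of[OF sym u] unfolding spectrally_generic_def by blast
  ultimately have "y $ r \<noteq> 0" if "r \<in> ?K" for r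
    using that y(2) unfolding nonvanishing_at_def by blast
  moreover have "y $ r = 0" if "r \<notin> ?K" for r
    using yK that by (auto simp: eigenspace_principal_iff coord_space_iff)
  ultimately show "vec_support y = ?K" by (auto simp: vec_support_def)
qed

lemma sccs_verts_induce:
  assumes sym: "sym (arcs_ends G)"
  shows "C \<in> pre_digraph.sccs_verts (G \<restriction> J) \<longleftrightarrow> (\<exists>u\<in>J. C = component_of G J u)"
proof
  assume C: "C \<in> pre_digraph.sccs_verts (G \<restriction> J)"
  then obtain u where u: "u \<in> C" by (auto simp: pre_digraph.sccs_verts_def)
  have uJ: "u \<in> J" using C u by (auto simp: pre_digraph.sccs_verts_def reachable_induce_iff)
  moreover have "C \<subseteq> component_of G J u" using C u by (auto simp: pre_digraph.sccs_verts_def reachable_induce_iff)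
  moreover have "component_of G J u \<subseteq> C"
  proof
    fix v assume v: "v \<in> component_of G J u"
    then have "v \<in> J" using component_of_subset[OF uJ] by blast
    moreover have "u \<in> component_of G J v" using component_of_eq[OF sym v] by simp
    ultimately show "v \<in> C"
      using C u v uJ by (auto simp: pre_digraph.sccs_verts_def reachable_induce_iff)
  qed
  ultimately show "\<exists>u\<in>J. C = component_of G J u" by blast
next
  assume "\<exists>u\<in>J. C = component_of G J u"
  then obtain u where u: "u \<in> J" and C: "C = component_of G J u" by blast
  have "component_of G J v = C" "v \<in> J" if "v \<in> C" for v
    using that component_of_eq[OF sym] component_of_subset[OF u, of G] by (auto simp: C)
  then show "C \<in> pre_digraph.sccs_verts (G \<restriction> J)"
    using component_of_self[of u G J] unfolding pre_digraph.sccs_verts_def reachable_induce_iff C[symmetric] by auto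
qed

lemma spectrally_generic_simple:
  fixes G :: "('v::finite, 'e) pre_digraph"
  assumes sym: "sym (arcs_ends G)" and h: "h \<in> symmetric_on G" and gen: "spectrally_generic G h" and J: "J \<subseteq> verts G"
    and \<mu>: "\<mu> \<in> spectrum J (principal_submatrix h J)"
  shows "simple_eigenvalue J (principal_submatrix h J) \<mu>"
proof -
  let ?E = "eigenspace J (principal_submatrix h J) \<mu>"
  note supp = spectrally_generic_support[OF sym h gen J]
  obtain x where x: "x \<in> ?E" "x \<noteq> 0" using \<mu> by (auto simp: spectrum_def)
  obtain u where u: "x $ u \<noteq> 0" using x(2) by (auto simp: vec_eq_iff)
  have "y \<in> span {x}" if y: "y \<in> ?E" for y
  proof -
    let ?z = "y - (y $ u / x $ u) *\<^sub>R x"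
    have "?z \<in> ?E"
      using vec.subspace_diff[OF subspace_eigenspace y eigenspace_scale[OF x(1)]] by simp
    moreover have "u \<notin> vec_support ?z" using u by (simp add: vec_support_def)
    ultimately have "?z = 0" using supp(2)[OF x(1) u, of ?z] by (metis component_of_self)
    then have "y = (y $ u / x $ u) *\<^sub>R x" by simp
    then show ?thesis by (metis span_base span_scale singletonI)
  qed
  then have "?E \<subseteq> span {x}" by blast
  moreover have "span {x} \<subseteq> ?E"
    using subspace_eigenspace[of J "principal_submatrix h J" \<mu>] x by (simp add: span_minimal subspace_vec_eq)
  ultimately have "dim ?E = dim {x}" by (metis dim_span subset_antisym)
  also have "\<dots> = 1" using x(2) by (simp add: dim_insert)
  finally show ?thesis by (simp add: simple_eigenvalue_def multiplicity_of_def dim_vec_eq)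
qed

lemma generic_if_spectrally_generic:
  fixes G :: "('v::finite, 'e) pre_digraph"
  assumes sym: "sym (arcs_ends G)" and h: "h \<in> symmetric_on G"
    and gen: "\<And>T. sym T \<Longrightarrow> spectrally_generic G (flip_signs T h)"
  shows "generic G h"
  unfolding generic_def
proof (intro conjI allI ballI impI h)
  have h0: "spectrally_generic G h"
    using gen[of "{}"] by (simp add: sym_def flip_signs_def)
  \<comment> \<open>If the entry on an arc were 0, the block on the connected set
    \<open>{r, s}\<close> would be diagonal and the axis vector at \<open>r\<close> an eigenvector
    vanishing at \<open>s\<close>.\<close>
  have "h $ r $ s \<noteq> 0" if rs: "r \<in> verts G" "s \<in> verts G" "r \<noteq> s" "r \<rightarrow>\<^bsub>G\<^esub> s" for r s
  proof
    assume "h $ r $ s = 0"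
    then have z: "h $ s $ r = 0" using symmetric_on_nth[OF h, of r s] by simp
    have "(s, r) \<in> arcs_ends G" using rs sym by (meson symD)
    then have "connected_in G {r, s}" using rs by (auto simp: connected_in_def arcs_in_def)
    then have nv: "nonvanishing_at {r, s} s h" using h0 rs by (auto simp: spectrally_generic_def)
    have "(h *v axis r 1) $ a = h $ a $ r" for a
      by (simp add: matrix_vector_mult_def axis_def if_distrib cong: if_cong)
    then have "axis r 1 \<in> eigenspace {r, s} (principal_submatrix h {r, s}) (h $ r $ r)"
      using rs z by (auto simp: eigenspace_principal_iff coord_space_iff axis_def)
    then have "axis r 1 = (0 :: real^'v)" using nv rs by (auto simp: nonvanishing_at_def axis_def)
    then show False by (simp add: axis_eq_0_iff)
  qed
  moreover have "supported_on G h" using h by (simp add: symmetric_on_def)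
  ultimately show "strictly_supported_on G h"
    unfolding strictly_supported_on_def supported_on_def by blast
next
  fix J h' assume "J \<subseteq> verts G \<and> signing (principal_submatrix h J) h'"
  then have J: "J \<subseteq> verts G" and sg: "signing (principal_submatrix h J) h'" by auto
  \<comment> \<open>A signing is recovered as a sign flip at the positions where it really differs;
    positions with entry 0 never belong to \<open>T\<close>.\<close>
  define T where "T = {(r, s). h' $ r $ s \<noteq> principal_submatrix h J $ r $ s}"
  have tr: "h' $ r $ s = h' $ s $ r" for r s
  proof -
    have "transpose h' $ s $ r = h' $ s $ r" using sg by (simp add: signing_def)
    then show ?thesis by (simp add: transpose_def)
  qed
  have "sym T" unfolding T_def sym_def
  proof (intro allI impI)
    fix r s assume "(r, s) \<in> {(r, s). h' $ r $ s \<noteq> principal_submatrix h J $ r $ s}"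
    then show "(s, r) \<in> {(r, s). h' $ r $ s \<noteq> principal_submatrix h J $ r $ s}"
      using tr[of r s] symmetric_on_nth[OF h, of r s] by (auto split: if_splits)
  qed
  then have gT: "spectrally_generic G (flip_signs T h)" and hT: "flip_signs T h \<in> symmetric_on G"
    using gen flip_signs_symmetric_on h by auto
  have "h' $ r $ s = principal_submatrix (flip_signs T h) J $ r $ s" for r s
  proof -
    have "h' $ r $ s = principal_submatrix h J $ r $ s \<or> h' $ r $ s = - principal_submatrix h J $ r $ s"
      using sg unfolding signing_def by blast
    then show ?thesis by (auto simp: T_def)
  qed
  then have h': "h' = principal_submatrix (flip_signs T h) J" by (simp add: vec_eq_iff)
  show "simple_eigenvalue J h' \<mu>" if "\<mu> \<in> spectrum J h'" for \<mu>
    using spectrally_generic_simple[OF sym hT gT J] that unfolding h' by blast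
  show "\<exists>!C. C \<in> pre_digraph.sccs_verts (G \<restriction> J) \<and> (\<forall>r\<in>C. x $ r \<noteq> 0)"
    if x: "x \<in> eigenspace J h' \<mu>" "x \<noteq> 0" for \<mu> x
  proof -
    obtain u where u: "x $ u \<noteq> 0" using x(2) by (auto simp: vec_eq_iff)
    note supp = spectrally_generic_support[OF sym hT gT J x(1)[unfolded h'] u x(1)[unfolded h'] x(2)]
    show ?thesis unfolding sccs_verts_induce[OF sym]
    proof (rule ex1I[of _ "component_of G J u"])
      show "(\<exists>v\<in>J. component_of G J u = component_of G J v) \<and> (\<forall>r\<in>component_of G J u. x $ r \<noteq> 0)"
        using supp by (auto simp: vec_support_def)
      fix C assume C: "(\<exists>v\<in>J. C = component_of G J v) \<and> (\<forall>r\<in>C. x $ r \<noteq> 0)"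
      then obtain v where v: "C = component_of G J v" by blast
      then have "x $ v \<noteq> 0" using C by simp
      then have "v \<in> component_of G J u" using supp(2) by (auto simp: vec_support_def)
      then show "C = component_of G J u" using component_of_eq[OF sym] v by blast
    qed
  qed
qed

lemma dense_interior_generic:
  fixes G :: "('v::finite, 'e) pre_digraph"
  assumes sym: "sym (arcs_ends G)"
  shows "dense_interior_on (symmetric_on G) (generic G)"
proof -
  have "dense_interior_on (symmetric_on G) (\<lambda>h. \<forall>T\<in>{T. sym T}. spectrally_generic G (flip_signs T h))"
    by (intro dense_interior_on_finite finite) (simp add: dense_interior_flip_signs dense_interior_spectrally_generic[OF sym])
  then show ?thesis
    by (rule dense_interior_on_mono) (auto intro: generic_if_spectrally_generic[OF sym])
qed

section \<open>Eigenvalues on the magnetic torus\<close>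

lemma magnetic_nth [simp]:
  "magnetic h \<alpha> $ r $ s = exp (\<i> * complex_of_real (\<alpha> $ r $ s)) * complex_of_real (h $ r $ s)"
  by (simp add: magnetic_def)

lemma antisymmetric_on_nth: "\<alpha> \<in> antisymmetric_on G \<Longrightarrow> \<alpha> $ r $ s = - (\<alpha> $ s $ r)"
proof -
  assume "\<alpha> \<in> antisymmetric_on G"
  then have "transpose \<alpha> $ s $ r = (- \<alpha>) $ s $ r" by (simp add: antisymmetric_on_def)
  then show ?thesis by (simp add: transpose_def)
qed

lemma magnetic_hermitian:
  assumes "h \<in> symmetric_on G" "\<alpha> \<in> antisymmetric_on G"
  shows "magnetic h \<alpha> \<in> hermitian_on G"
proof -
  have "magnetic h \<alpha> $ s $ r = cnj (magnetic h \<alpha> $ r $ s)" for r s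
    unfolding magnetic_nth symmetric_on_nth[OF assms(1), of s r] antisymmetric_on_nth[OF assms(2), of s r]
    by (simp add: exp_cnj)
  moreover have "supported_on G (magnetic h \<alpha>)"
    using assms(1) by (simp add: supported_on_def symmetric_on_def)
  ultimately show ?thesis unfolding hermitian_on_def by blast
qed

lemma spectral_hermitian_on:
  assumes "M \<in> hermitian_on G"
  shows "spectral_matrix 2 (verts G) M"
proof (rule spectral_hermitian)
  show "M $ s $ r = cnj (M $ r $ s)" for r s using assms unfolding hermitian_on_def by blast
  show "M $ r $ s = 0" if "r \<notin> verts G" for r s
    using assms that unfolding hermitian_on_def supported_on_def by blast
qed

lemma phase_matrix_conj_nth:
  "(phase_matrix \<theta> ** M ** phase_matrix (- \<theta>)) $ r $ s =
     exp (\<i> * complex_of_real (\<theta> $ r)) * M $ r $ s * exp (- (\<i> * complex_of_real (\<theta> $ s)))"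
proof -
  have "(phase_matrix \<theta> ** M) $ r $ k = exp (\<i> * complex_of_real (\<theta> $ r)) * M $ r $ k" for k
    by (simp add: matrix_matrix_mult_def phase_matrix_def if_distrib if_distribR cong: if_cong)
  then show ?thesis
    by (simp add: matrix_matrix_mult_def[of "phase_matrix \<theta> ** M"] phase_matrix_def[of "- \<theta>"] if_distrib cong: if_cong)
qed

lemma phase_matrix_vec: "(phase_matrix \<theta> *v x) $ r = exp (\<i> * complex_of_real (\<theta> $ r)) * x $ r"
  by (simp add: matrix_vector_mult_def phase_matrix_def if_distrib if_distribR cong: if_cong)

lemma phase_matrix_inverse: "phase_matrix (- \<theta>) *v (phase_matrix \<theta> *v x) = x"
  by (simp add: vec_eq_iff phase_matrix_vec mult.assoc[symmetric] exp_add[symmetric])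

lemma phase_eigenspace:
  assumes M': "M' = phase_matrix \<theta> ** M ** phase_matrix (- \<theta>)" and x: "x \<in> eigenspace U M \<mu>"
  shows "phase_matrix \<theta> *v x \<in> eigenspace U M' \<mu>"
proof -
  have "M' *v (phase_matrix \<theta> *v x) = phase_matrix \<theta> *v (M *v x)"
    unfolding M' by (simp add: matrix_vector_mul_assoc[symmetric] phase_matrix_inverse)
  also have "\<dots> = of_real \<mu> *s (phase_matrix \<theta> *v x)"
    using x by (simp add: eigenspace_coord_space vector_scalar_commute)
  finally show ?thesis using x
    by (simp add: eigenspace_coord_space coord_space_iff phase_matrix_vec)
qed

lemma phase_conj_inverse:
  assumes "M' = phase_matrix \<theta> ** M ** phase_matrix (- \<theta>)"
  shows "M = phase_matrix (- \<theta>) ** M' ** phase_matrix (- (- \<theta>))"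
  unfolding vec_eq_iff phase_matrix_conj_nth assms
  by (simp add: mult_ac flip: exp_add mult.assoc)

lemma phase_eigenspace_image:
  assumes "M' = phase_matrix \<theta> ** M ** phase_matrix (- \<theta>)"
  shows "eigenspace U M' \<mu> = (*v) (phase_matrix \<theta>) ` eigenspace U M \<mu>"
proof
  show "eigenspace U M' \<mu> \<subseteq> (*v) (phase_matrix \<theta>) ` eigenspace U M \<mu>"
  proof
    fix x assume "x \<in> eigenspace U M' \<mu>"
    then have "phase_matrix (- \<theta>) *v x \<in> eigenspace U M \<mu>"
      using phase_eigenspace[OF phase_conj_inverse[OF assms]] by blast
    then show "x \<in> (*v) (phase_matrix \<theta>) ` eigenspace U M \<mu>"
      using phase_matrix_inverse[of "- \<theta>" x] by (metis image_eqI minus_minus)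
  qed
qed (use phase_eigenspace[OF assms] in blast)

text \<open>A phase matrix is invertible and diagonal, so it carries eigenspaces to eigenspaces and
  keeps vectors inside \<open>coord_space U\<close>.\<close>

lemma gauge_eigenvalues:
  assumes "M' = phase_matrix \<theta> ** M ** phase_matrix (- \<theta>)"
  shows "multiplicity_of U M' \<mu> = multiplicity_of U M \<mu>" "eigenvalues U M' = eigenvalues U M"
proof -
  have inj: "inj ((*v) (phase_matrix \<theta>))" by (rule inj_on_inverseI[of _ "(*v) (phase_matrix (- \<theta>))"]) (rule phase_matrix_inverse)
  have mult: "multiplicity_of U M' \<mu> = multiplicity_of U M \<mu>" for \<mu>
  proof -
    have "dim (eigenspace U M' \<mu>) = dim (eigenspace U M \<mu>)"
      unfolding phase_eigenspace_image[OF assms]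
      by (rule dim_image_eq[OF linear_matrix_vector_mult]) (rule inj_on_subset[OF inj], simp)
    then show ?thesis
      by (simp add: multiplicity_of_def dim_complex_subspace[OF subspace_eigenspace])
  qed
  then show "multiplicity_of U M' \<mu> = multiplicity_of U M \<mu>" .
  have "phase_matrix \<theta> *v x = 0 \<longleftrightarrow> x = 0" for x
    by (metis phase_matrix_inverse matrix_vector_mult_0_right)
  then have "spectrum U M' = spectrum U M"
    unfolding spectrum_def phase_eigenspace_image[OF assms] by auto
  with mult show "eigenvalues U M' = eigenvalues U M" by (simp add: eigenvalues_def)
qed

lemma gauge_class_self:
  assumes "M \<in> hermitian_on G" shows "M \<in> gauge_class G M"
proof -
  have "M = phase_matrix 0 ** M ** phase_matrix (- 0)"
    unfolding vec_eq_iff phase_matrix_conj_nth by simp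
  with assms show ?thesis unfolding gauge_class_def gauge_rel_def by blast
qed

lemma gauge_classD:
  assumes "M' \<in> gauge_class G M"
  obtains \<theta> where "M' = phase_matrix \<theta> ** M ** phase_matrix (- \<theta>)"
  using assms by (auto simp: gauge_class_def gauge_rel_def)

lemma torus_eigenvalue_gauge_class:
  assumes "M \<in> hermitian_on G"
  shows "torus_eigenvalue k G (gauge_class G M) = eigenvalue_nth k (verts G) M"
proof -
  have "eigenvalue_nth k (verts G) M' = eigenvalue_nth k (verts G) M" if M': "M' \<in> gauge_class G M" for M'
  proof -
    obtain \<theta> where "M' = phase_matrix \<theta> ** M ** phase_matrix (- \<theta>)" using M' by (rule gauge_classD)
    from gauge_eigenvalues(2)[OF this] show ?thesis by (simp add: eigenvalue_nth_def)
  qed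
  then have "eigenvalue_nth k (verts G) ` gauge_class G M = {eigenvalue_nth k (verts G) M}"
    using gauge_class_self[OF assms] by blast
  then show ?thesis by (simp add: torus_eigenvalue_def)
qed

section \<open>Second-order estimates under a change of flux\<close>

lemma norm_matrix_mono:
  fixes A :: "'a::real_normed_vector^'m^'n" and B :: "'b::real_normed_vector^'m^'n"
  assumes "\<And>r s. norm (A $ r $ s) \<le> norm (B $ r $ s)"
  shows "norm A \<le> norm B"
  unfolding norm_vec_def[of A] norm_vec_def[of B]
proof (rule L2_set_mono)
  fix r show "norm (A $ r) \<le> norm (B $ r)"
    unfolding norm_vec_def by (rule L2_set_mono) (use assms in auto)
qed simp

lemma matrix_entry_le_norm:
  fixes A :: "real^'m^'n" shows "\<bar>A $ r $ s\<bar> \<le> norm A"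
  using component_le_norm_cart[of "A $ r" s] Finite_Cartesian_Product.norm_nth_le[of A r] by linarith

lemma norm_exp_i_minus_1: "norm (exp (\<i> * complex_of_real t) - 1) \<le> \<bar>t\<bar>"
proof -
  have "norm (exp (\<i> * complex_of_real t) - 1) = 2 * \<bar>sin (t / 2)\<bar>"
    using dist_exp_i_1[of t] by (simp add: dist_norm)
  also have "\<dots> \<le> \<bar>t\<bar>" using abs_sin_x_le_abs_x[of "t / 2"] by simp
  finally show ?thesis .
qed

lemma abs_cos_minus_1: "\<bar>cos t - 1\<bar> \<le> t\<^sup>2" for t :: real
proof -
  have "cos t - 1 = - 2 * (sin (t / 2))\<^sup>2" using cos_double_sin[of "t / 2"] by simp
  moreover have "(sin (t / 2))\<^sup>2 \<le> (t / 2)\<^sup>2" using abs_sin_x_le_abs_x[of "t / 2"] by (simp only: abs_le_square_iff)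
  moreover have "(t / 2)\<^sup>2 \<le> t\<^sup>2 / 2" by (simp add: power_divide)
  moreover have "0 \<le> (sin (t / 2))\<^sup>2" by simp
  ultimately show ?thesis by linarith
qed

lemma magnetic_diff_nth:
  "(magnetic h \<beta> - magnetic h \<alpha>) $ r $ s =
     magnetic h \<alpha> $ r $ s * (exp (\<i> * complex_of_real ((\<beta> - \<alpha>) $ r $ s)) - 1)"
proof -
  have "exp (\<i> * complex_of_real (\<beta> $ r $ s)) =
      exp (\<i> * complex_of_real (\<alpha> $ r $ s)) * exp (\<i> * complex_of_real ((\<beta> - \<alpha>) $ r $ s))"
    unfolding exp_add[symmetric] by (simp add: algebra_simps)
  then show ?thesis by (simp add: algebra_simps)
qed

lemma norm_magnetic_diff: "norm (magnetic h \<beta> - magnetic h \<alpha>) \<le> norm h * norm (\<beta> - \<alpha>)"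
proof -
  have "norm (magnetic h \<beta> - magnetic h \<alpha>) \<le> norm (norm h *\<^sub>R (\<beta> - \<alpha>))"
  proof (rule norm_matrix_mono)
    fix r s
    have "norm ((magnetic h \<beta> - magnetic h \<alpha>) $ r $ s) \<le> \<bar>h $ r $ s\<bar> * \<bar>(\<beta> - \<alpha>) $ r $ s\<bar>"
      unfolding magnetic_diff_nth norm_mult magnetic_nth
      by (intro mult_mono norm_exp_i_minus_1) simp_all
    also have "\<dots> \<le> norm h * \<bar>(\<beta> - \<alpha>) $ r $ s\<bar>"
      by (intro mult_right_mono matrix_entry_le_norm) simp
    finally show "norm ((magnetic h \<beta> - magnetic h \<alpha>) $ r $ s) \<le> norm ((norm h *\<^sub>R (\<beta> - \<alpha>)) $ r $ s)"
      by (simp add: abs_mult)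
  qed
  then show ?thesis by simp
qed

text \<open>The source of differentiability: a quadratic bound near one point takes the place of
  smoothness of the eigenvalue.\<close>

lemma has_derivative_zero_quadratic:
  fixes F :: "'a::real_normed_vector \<Rightarrow> real"
  assumes "\<delta> > 0" and L: "\<And>y. y \<in> S \<Longrightarrow> norm (y - x) < \<delta> \<Longrightarrow> \<bar>F y - F x\<bar> \<le> L * (norm (y - x))\<^sup>2"
  shows "(F has_derivative (\<lambda>_. 0)) (at x within S)"
  unfolding has_derivative_within_alt
proof (intro conjI allI impI bounded_linear_zero)
  fix e :: real assume e: "e > 0"
  show "\<exists>d>0. \<forall>y\<in>S. norm (y - x) < d \<longrightarrow> norm (F y - F x - 0) \<le> e * norm (y - x)"
  proof (intro exI[of _ "min \<delta> (e / (\<bar>L\<bar> + 1))"] conjI ballI impI)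
    show "0 < min \<delta> (e / (\<bar>L\<bar> + 1))" using assms e by (simp add: add_nonneg_pos)
    fix y assume y: "y \<in> S" "norm (y - x) < min \<delta> (e / (\<bar>L\<bar> + 1))"
    then have "\<bar>F y - F x\<bar> \<le> L * (norm (y - x))\<^sup>2" using L by simp
    also have "\<dots> \<le> ((\<bar>L\<bar> + 1) * norm (y - x)) * norm (y - x)"
      using mult_right_mono[of L "\<bar>L\<bar> + 1" "(norm (y - x))\<^sup>2"] by (simp add: power2_eq_square mult.assoc)
    also have "\<dots> \<le> e * norm (y - x)"
      using y by (intro mult_right_mono) (auto simp: field_simps)
    finally show "norm (F y - F x - 0) \<le> e * norm (y - x)" by simp
  qed
qed

lemma finite_gap:
  fixes e :: "'a \<Rightarrow> real"
  assumes "finite B"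
  obtains g where "g > 0" "\<And>b. b \<in> B \<Longrightarrow> e b \<noteq> \<mu> \<Longrightarrow> g \<le> \<bar>e b - \<mu>\<bar>"
proof
  \<comment> \<open>The element 1 keeps the minimum defined when every value of \<open>e\<close>
    equals \<open>\<mu>\<close>.\<close>
  let ?D = "insert 1 ((\<lambda>b. \<bar>e b - \<mu>\<bar>) ` {b \<in> B. e b \<noteq> \<mu>})"
  show "Min ?D > 0" using assms by (subst Min_gr_iff) auto
  show "Min ?D \<le> \<bar>e b - \<mu>\<bar>" if "b \<in> B" "e b \<noteq> \<mu>" for b
    using assms that by (intro Min_le) auto
qed

lemma eigenspace_singleton:
  assumes "multiplicity_of U M \<mu> = 1" "x \<in> eigenspace U M \<mu>" "x \<noteq> 0" "y \<in> eigenspace U M \<mu>"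
  obtains a where "y = a *s x"
proof -
  have "eigenspace U M \<mu> \<subseteq> vec.span {x}"
  proof (rule vec.card_ge_dim_independent)
    show "vec.independent {x}" using assms(3) by (simp add: vec.independent_insert)
  qed (use assms in \<open>auto simp: multiplicity_of_def\<close>)
  then show ?thesis using assms(4) that by (auto simp: vec.span_singleton)
qed

text \<open>The first-order part of the form in the flux involves only the imaginary parts of the
  products in the hypothesis; these are 0, and \<open>cos t - 1\<close> is left. The factor
  \<open>a\<close> covers the whole complex line of \<open>x\<close>; its phase drops out.\<close>

lemma magnetic_form_second_order:
  assumes real: "\<And>r s. Im (cnj (x $ r) * magnetic h \<alpha> $ r $ s * x $ s) = 0"
  shows "\<bar>(magnetic h \<beta> *v (a *s x) - magnetic h \<alpha> *v (a *s x)) \<bullet> (a *s x)\<bar>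
    \<le> (cmod a)\<^sup>2 * (\<Sum>r\<in>UNIV. \<Sum>s\<in>UNIV. cmod (cnj (x $ r) * magnetic h \<alpha> $ r $ s * x $ s)) * (norm (\<beta> - \<alpha>))\<^sup>2"
proof -
  define c where "c r s = cnj (x $ r) * magnetic h \<alpha> $ r $ s * x $ s" for r s
  define t where "t r s = (\<beta> - \<alpha>) $ r $ s" for r s
  have "(magnetic h \<beta> *v (a *s x) - magnetic h \<alpha> *v (a *s x)) \<bullet> (a *s x)
      = ((magnetic h \<beta> - magnetic h \<alpha>) *v (a *s x)) \<bullet> (a *s x)"
    by (simp add: matrix_vector_mult_diff_rdistrib)
  also have "\<dots> = (\<Sum>r\<in>UNIV. \<Sum>s\<in>UNIV. Re (cnj ((magnetic h \<beta> - magnetic h \<alpha>) $ r $ s * (a * x $ s)) * (a * x $ r)))"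
    by (simp add: inner_vec_def inner_complex_Re matrix_vector_mult_def sum_distrib_right del: magnetic_nth)
  also have "\<dots> = (\<Sum>r\<in>UNIV. \<Sum>s\<in>UNIV. (cmod a)\<^sup>2 * (Re (c r s) * (cos (t r s) - 1)))"
  proof (intro sum.cong refl)
    fix r s
    have "cnj ((magnetic h \<beta> - magnetic h \<alpha>) $ r $ s * (a * x $ s)) * (a * x $ r)
        = (cnj a * a) * cnj (c r s * (exp (\<i> * complex_of_real (t r s)) - 1))"
      unfolding magnetic_diff_nth c_def t_def by (simp add: mult_ac del: magnetic_nth)
    also have "cnj a * a = complex_of_real ((cmod a)\<^sup>2)" by (simp add: complex_norm_square[symmetric] mult.commute)
    finally have "Re (cnj ((magnetic h \<beta> - magnetic h \<alpha>) $ r $ s * (a * x $ s)) * (a * x $ r))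
        = (cmod a)\<^sup>2 * Re (c r s * (exp (\<i> * complex_of_real (t r s)) - 1))"
      by simp
    also have "Re (c r s * (exp (\<i> * complex_of_real (t r s)) - 1)) = Re (c r s) * (cos (t r s) - 1)"
      using real[of r s] by (simp add: c_def[symmetric] Re_exp del: magnetic_nth)
    finally show "Re (cnj ((magnetic h \<beta> - magnetic h \<alpha>) $ r $ s * (a * x $ s)) * (a * x $ r))
        = (cmod a)\<^sup>2 * (Re (c r s) * (cos (t r s) - 1))" .
  qed
  also have "\<bar>\<dots>\<bar> \<le> (\<Sum>r\<in>UNIV. \<Sum>s\<in>UNIV. \<bar>(cmod a)\<^sup>2 * (Re (c r s) * (cos (t r s) - 1))\<bar>)"
    by (rule order_trans[OF sum_abs]) (intro sum_mono sum_abs)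
  also have "\<dots> \<le> (\<Sum>r\<in>UNIV. \<Sum>s\<in>UNIV. (cmod a)\<^sup>2 * (cmod (c r s) * (norm (\<beta> - \<alpha>))\<^sup>2))"
  proof (intro sum_mono)
    fix r s
    have "\<bar>cos (t r s) - 1\<bar> \<le> (t r s)\<^sup>2" by (rule abs_cos_minus_1)
    also have "\<dots> \<le> (norm (\<beta> - \<alpha>))\<^sup>2"
      using matrix_entry_le_norm[of "\<beta> - \<alpha>" r s] by (simp add: t_def abs_le_square_iff[symmetric])
    finally have "\<bar>Re (c r s)\<bar> * \<bar>cos (t r s) - 1\<bar> \<le> cmod (c r s) * (norm (\<beta> - \<alpha>))\<^sup>2"
      by (intro mult_mono abs_Re_le_cmod) auto
    then show "\<bar>(cmod a)\<^sup>2 * (Re (c r s) * (cos (t r s) - 1))\<bar> \<le> (cmod a)\<^sup>2 * (cmod (c r s) * (norm (\<beta> - \<alpha>))\<^sup>2)"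
      by (simp add: abs_mult mult_left_mono)
  qed
  also have "\<dots> = (cmod a)\<^sup>2 * (\<Sum>r\<in>UNIV. \<Sum>s\<in>UNIV. cmod (c r s)) * (norm (\<beta> - \<alpha>))\<^sup>2"
    by (simp add: sum_distrib_left sum_distrib_right mult.assoc)
  finally show ?thesis by (simp add: c_def)
qed


text \<open>A simple complex eigenvalue has real multiplicity 2, so the first \<open>k\<close>
  eigenvalues correspond to \<open>2 * k\<close> basis vectors. Upper and lower quadratic bounds
  come from one perturbation lemma, applied to the matrices and to their negatives.\<close>

lemma eigenvalue_magnetic_derivative_zero:
  fixes G :: "('v::finite, 'e) pre_digraph"
  defines "V \<equiv> verts G"
  assumes h: "h \<in> symmetric_on G" and \<alpha>: "\<alpha> \<in> antisymmetric_on G"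
    and k: "1 \<le> k" and count: "count_below V (magnetic h \<alpha>) \<mu> = k - 1"
    and mult: "multiplicity_of V (magnetic h \<alpha>) \<mu> = 1"
    and x: "x \<in> eigenspace V (magnetic h \<alpha>) \<mu>" "x \<noteq> 0"
    and real: "\<And>r s. Im (cnj (x $ r) * magnetic h \<alpha> $ r $ s * x $ s) = 0"
  shows "((\<lambda>\<beta>. eigenvalue_nth k V (magnetic h \<beta>)) has_derivative (\<lambda>_. 0)) (at \<alpha> within antisymmetric_on G)"
proof -
  define M where "M = magnetic h \<alpha>"
  have spec: "spectral_matrix 2 V (magnetic h \<beta>)" if "\<beta> \<in> antisymmetric_on G" for \<beta>
    unfolding V_def by (intro spectral_hermitian_on magnetic_hermitian h that)
  obtain B where B: "eigenbasis (coord_space V) ((*v) M) B"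
    using spectral_eigenbasis[OF spec[OF \<alpha>]] unfolding M_def by blast
  note spM = spec[OF \<alpha>, folded M_def]
  have cl: "card {b \<in> B. (M *v b) \<bullet> b < \<mu>} = 2 * (k - 1)"
    using length_filter_eigenvalues[OF spM B, of "\<lambda>x. x < \<mu>"] count by (simp add: count_below_def M_def)
  have ce: "card {b \<in> B. (M *v b) \<bullet> b = \<mu>} = 2"
    using multiplicity_eigenbasis[OF spM B, of \<mu>] mult by (simp add: M_def)
  have fin: "finite B" by (rule eigenbasis_finite[OF B])
  have cle: "card {b \<in> B. (M *v b) \<bullet> b \<le> \<mu>} = 2 * k"
    using card_filter_le[OF fin, of "\<lambda>b. (M *v b) \<bullet> b" \<mu>] cl ce k by simp
  have "{b \<in> B. \<mu> \<le> (M *v b) \<bullet> b} = {b \<in> B. \<mu> < (M *v b) \<bullet> b} \<union> {b \<in> B. (M *v b) \<bullet> b = \<mu>}" by auto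
  then have "card {b \<in> B. \<mu> \<le> (M *v b) \<bullet> b} = card {b \<in> B. \<mu> < (M *v b) \<bullet> b} + 2"
    using ce fin by (subst card_Un_disjoint[OF _ _ ] | simp add: disjoint_iff)+
  then have cge: "card {b \<in> B. \<mu> \<le> (M *v b) \<bullet> b} + 2 * (k - 1) = card B"
    using card_trichotomy[OF fin, of "\<lambda>b. (M *v b) \<bullet> b" \<mu>] cl ce by simp
  have kB: "2 * k \<le> card B" using cle fin by (metis (no_types, lifting) card_mono mem_Collect_eq subsetI)
  obtain g where g: "g > 0" and gap: "\<And>b. b \<in> B \<Longrightarrow> (M *v b) \<bullet> b \<noteq> \<mu> \<Longrightarrow> g \<le> \<bar>(M *v b) \<bullet> b - \<mu>\<bar>"
    using finite_gap[OF fin, of "\<lambda>b. (M *v b) \<bullet> b" \<mu>] by blast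
  define Q where "Q = (\<Sum>r\<in>UNIV. \<Sum>s\<in>UNIV. cmod (cnj (x $ r) * M $ r $ s * x $ s))"
  have Q: "Q \<ge> 0" unfolding Q_def by (intro sum_nonneg) simp
  \<comment> \<open>\<open>C\<close> converts a change of flux into a bound on the change of the
    matrix; adding 1 keeps it positive for \<open>h = 0\<close>.\<close>
  define C where "C = norm h + 1"
  have C: "C > 0" by (simp add: C_def add_nonneg_pos)
  \<comment> \<open>Scaled so that the bound of the form on an eigenvector \<open>y\<close> reads
    \<open>K * \<delta>\<^sup>2 * (y \<bullet> y)\<close> with
    \<open>\<delta> = C * norm (\<beta> - \<alpha>)\<close>.\<close>
  define K where "K = Q / ((norm x)\<^sup>2 * C\<^sup>2)"
  have K: "K \<ge> 0" using Q by (simp add: K_def)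
  define L where "L = K + 2 / g + 1"
  have at_\<alpha>: "eigenvalue_nth k V M = \<mu>"
    by (rule eigenvalue_nth_eqI[OF spM B k cl ce])
  have quad: "\<bar>(magnetic h \<beta> *v y - M *v y) \<bullet> y\<bar> \<le> K * (C * norm (\<beta> - \<alpha>))\<^sup>2 * (y \<bullet> y)"
    if y: "y \<in> coord_space V" "M *v y = \<mu> *\<^sub>R y" for \<beta> y
  proof -
    have "y \<in> eigenspace V (magnetic h \<alpha>) \<mu>" using y by (simp add: eigenspace_scaleR M_def)
    then obtain a where a: "y = a *s x" by (rule eigenspace_singleton[OF mult x])
    have "norm y = cmod a * norm x"
      unfolding a norm_vec_def by (simp add: norm_mult L2_set_right_distrib)
    then have yy: "y \<bullet> y = (cmod a)\<^sup>2 * (norm x)\<^sup>2" by (simp add: dot_square_norm power_mult_distrib)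
    have "\<bar>(magnetic h \<beta> *v y - M *v y) \<bullet> y\<bar> \<le> (cmod a)\<^sup>2 * Q * (norm (\<beta> - \<alpha>))\<^sup>2"
      unfolding a M_def Q_def by (rule magnetic_form_second_order[OF real])
    also have "\<dots> = K * (C * norm (\<beta> - \<alpha>))\<^sup>2 * (y \<bullet> y)"
      unfolding yy K_def using x(2) C by (simp add: field_simps)
    finally show ?thesis .
  qed
  show ?thesis
  \<comment> \<open>Within this radius \<open>2 * \<delta> \<le> g\<close>, the condition under
    which the gap absorbs the perturbation.\<close>
  proof (rule has_derivative_zero_quadratic[where \<delta> = "g / (2 * C)" and L = "L * C\<^sup>2"])
    show "0 < g / (2 * C)" using g C by simp
    fix \<beta> assume \<beta>: "\<beta> \<in> antisymmetric_on G" and small: "norm (\<beta> - \<alpha>) < g / (2 * C)"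
    define \<delta> where "\<delta> = C * norm (\<beta> - \<alpha>)"
    show "\<bar>eigenvalue_nth k V (magnetic h \<beta>) - eigenvalue_nth k V (magnetic h \<alpha>)\<bar> \<le> L * C\<^sup>2 * (norm (\<beta> - \<alpha>))\<^sup>2"
    proof (cases "\<beta> = \<alpha>")
      case False
      then have \<delta>: "\<delta> > 0" "2 * \<delta> \<le> g" using C small by (auto simp: \<delta>_def field_simps)
      let ?N = "magnetic h \<beta>"
      obtain B' where B': "eigenbasis (coord_space V) ((*v) ?N) B'" using spectral_eigenbasis[OF spec[OF \<beta>]] by blast
      have fin': "finite B'" by (rule eigenbasis_finite[OF B'])
      have cB': "card B' = card B" using eigenbasis_card[OF B] eigenbasis_card[OF B'] by simp
      have near: "norm (?N *v v - M *v v) \<le> \<delta> * norm v" for v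
      proof -
        have "norm (?N *v v - M *v v) = norm ((?N - M) *v v)" by (simp add: matrix_vector_mult_diff_rdistrib)
        also have "\<dots> \<le> norm (?N - M) * norm v" by (rule norm_matrix_vector_le)
        also have "\<dots> \<le> (norm h * norm (\<beta> - \<alpha>)) * norm v"
          unfolding M_def by (intro mult_right_mono norm_magnetic_diff) simp
        also have "\<dots> \<le> \<delta> * norm v" by (intro mult_right_mono) (simp_all add: \<delta>_def C_def algebra_simps)
        finally show ?thesis .
      qed
      have "2 * k \<le> card {b \<in> B'. (?N *v b) \<bullet> b < \<mu> + L * \<delta>\<^sup>2}"
        unfolding cle[symmetric] L_def
      proof (rule eigenbasis_perturb_second_order[OF B B' g _ near \<delta> K])
        show "(M *v b) \<bullet> b \<le> \<mu> - g" if "b \<in> B" "(M *v b) \<bullet> b < \<mu>" for b using gap[of b] that by auto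
        show "(?N *v y - M *v y) \<bullet> y \<le> K * \<delta>\<^sup>2 * (y \<bullet> y)" if "y \<in> coord_space V" "M *v y = \<mu> *\<^sub>R y" for y
          using quad[OF that, of \<beta>] by (simp add: \<delta>_def)
      qed
      then have up: "eigenvalue_nth k V ?N < \<mu> + L * \<delta>\<^sup>2"
        using eigenvalue_nth_less_iff[OF spec[OF \<beta>] B' k] kB cB' by simp
      have "card {b \<in> B. - ((M *v b) \<bullet> b) \<le> - \<mu>} \<le> card {b \<in> B'. - (?N *v b) \<bullet> b < - \<mu> + L * \<delta>\<^sup>2}"
        unfolding L_def inner_minus_left[symmetric]
      proof (rule eigenbasis_perturb_second_order[OF eigenbasis_uminus[OF B] eigenbasis_uminus[OF B'] g _ _ \<delta> K])
        show "- (M *v b) \<bullet> b \<le> - \<mu> - g" if "b \<in> B" "- (M *v b) \<bullet> b < - \<mu>" for b using gap[of b] that by auto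
        show "norm (- (?N *v v) - - (M *v v)) \<le> \<delta> * norm v" for v using near[of v] by (simp add: norm_minus_commute)
        show "(- (?N *v y) - - (M *v y)) \<bullet> y \<le> K * \<delta>\<^sup>2 * (y \<bullet> y)" if "y \<in> coord_space V" "- (M *v y) = - \<mu> *\<^sub>R y" for y
          using quad[of y \<beta>] that by (simp add: \<delta>_def inner_diff_left)
      qed
      then have lo: "card {b \<in> B. \<mu> \<le> (M *v b) \<bullet> b} \<le> card {b \<in> B'. \<mu> - L * \<delta>\<^sup>2 < (?N *v b) \<bullet> b}"
        by (simp add: algebra_simps)
      have "{b \<in> B'. (?N *v b) \<bullet> b \<le> \<mu> - L * \<delta>\<^sup>2} = B' - {b \<in> B'. \<mu> - L * \<delta>\<^sup>2 < (?N *v b) \<bullet> b}" by auto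
      then have "card {b \<in> B'. (?N *v b) \<bullet> b \<le> \<mu> - L * \<delta>\<^sup>2} = card B' - card {b \<in> B'. \<mu> - L * \<delta>\<^sup>2 < (?N *v b) \<bullet> b}"
        using fin' by (simp add: card_Diff_subset)
      \<comment> \<open>At most \<open>2 * (k - 1)\<close> basis vectors are left at or below the
        threshold, so the eigenvalue with index \<open>k\<close> lies above it.\<close>
      then have "\<not> 2 * k \<le> card {b \<in> B'. (?N *v b) \<bullet> b \<le> \<mu> - L * \<delta>\<^sup>2}"
        using lo cge cB' k by linarith
      then have "\<mu> - L * \<delta>\<^sup>2 < eigenvalue_nth k V ?N"
        using eigenvalue_nth_le_iff[OF spec[OF \<beta>] B' k] kB cB' by (simp add: not_le[symmetric])
      with up have "\<bar>eigenvalue_nth k V ?N - \<mu>\<bar> \<le> L * \<delta>\<^sup>2" by linarith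
      then show ?thesis using at_\<alpha> by (simp add: M_def \<delta>_def power_mult_distrib mult.assoc)
    qed simp
  qed
qed

text \<open>Criticality is asked at every flux over the class. Such a flux \<open>\<gamma>\<close>
  differs by a gauge phase, which carries the eigenvector to \<open>?y\<close> and cancels in every
  product of the reality condition.\<close>

lemma torus_critical_point_magnetic:
  fixes G :: "('v::finite, 'e) pre_digraph"
  assumes h: "h \<in> symmetric_on G" and \<alpha>: "\<alpha> \<in> antisymmetric_on G"
    and k: "1 \<le> k" and count: "count_below (verts G) (magnetic h \<alpha>) \<mu> = k - 1"
    and mult: "multiplicity_of (verts G) (magnetic h \<alpha>) \<mu> = 1"
    and x: "x \<in> eigenspace (verts G) (magnetic h \<alpha>) \<mu>" "x \<noteq> 0"
    and real: "\<And>r s. Im (cnj (x $ r) * magnetic h \<alpha> $ r $ s * x $ s) = 0"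
  shows "torus_critical_point G h (torus_eigenvalue k G) (gauge_class G (magnetic h \<alpha>))"
  unfolding torus_critical_point_def
proof (intro conjI ballI impI)
  show "gauge_class G (magnetic h \<alpha>) \<in> magnetic_torus G h"
    unfolding magnetic_torus_def gauge_class_def by (intro quotientI imageI \<alpha>)
  fix \<gamma> assume \<gamma>: "\<gamma> \<in> antisymmetric_on G" and eq: "gauge_class G (magnetic h \<gamma>) = gauge_class G (magnetic h \<alpha>)"
  have "magnetic h \<gamma> \<in> gauge_class G (magnetic h \<alpha>)"
    using gauge_class_self[OF magnetic_hermitian[OF h \<gamma>]] eq by simp
  then obtain \<theta> where \<theta>: "magnetic h \<gamma> = phase_matrix \<theta> ** magnetic h \<alpha> ** phase_matrix (- \<theta>)"
    by (rule gauge_classD)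
  let ?y = "phase_matrix \<theta> *v x"
  have "((\<lambda>\<beta>. eigenvalue_nth k (verts G) (magnetic h \<beta>)) has_derivative (\<lambda>_. 0)) (at \<gamma> within antisymmetric_on G)"
  proof (rule eigenvalue_magnetic_derivative_zero[OF h \<gamma> k])
    show "count_below (verts G) (magnetic h \<gamma>) \<mu> = k - 1"
      using count by (simp add: count_below_def gauge_eigenvalues(2)[OF \<theta>])
    show "multiplicity_of (verts G) (magnetic h \<gamma>) \<mu> = 1"
      using mult by (simp add: gauge_eigenvalues(1)[OF \<theta>])
    show "?y \<in> eigenspace (verts G) (magnetic h \<gamma>) \<mu>" by (rule phase_eigenspace[OF \<theta> x(1)])
    show "?y \<noteq> 0" using x(2) phase_matrix_inverse[of \<theta> x] by force
    fix r s
    have "cnj (?y $ r) * magnetic h \<gamma> $ r $ s * ?y $ s = cnj (x $ r) * magnetic h \<alpha> $ r $ s * x $ s"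
    proof -
      have e: "exp (- (\<i> * t)) * exp (\<i> * t) = 1" "exp (\<i> * t) * exp (- (\<i> * t)) = 1" for t :: complex
        by (simp_all flip: exp_add)
      have "cnj (?y $ r) * magnetic h \<gamma> $ r $ s * ?y $ s =
          (exp (- (\<i> * complex_of_real (\<theta> $ r))) * exp (\<i> * complex_of_real (\<theta> $ r))) *
          (exp (- (\<i> * complex_of_real (\<theta> $ s))) * exp (\<i> * complex_of_real (\<theta> $ s))) *
          (cnj (x $ r) * magnetic h \<alpha> $ r $ s * x $ s)"
        unfolding arg_cong[where f = "\<lambda>M. M $ r $ s", OF \<theta>] phase_matrix_conj_nth phase_matrix_vec
        by (simp only: complex_cnj_mult exp_cnj complex_cnj_i complex_cnj_complex_of_real mult_minus_left mult_ac)
      then show ?thesis by (simp only: e mult_1)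
    qed
    then show "Im (cnj (?y $ r) * magnetic h \<gamma> $ r $ s * ?y $ s) = 0" using real by (simp only:)
  qed
  then show "((\<lambda>\<beta>. torus_eigenvalue k G (gauge_class G (magnetic h \<beta>))) has_derivative (\<lambda>_. 0))
      (at \<gamma> within antisymmetric_on G)"
    by (rule has_derivative_transform[OF \<gamma>, rotated])
      (simp add: torus_eigenvalue_gauge_class magnetic_hermitian h)
qed

section \<open>Construction of the critical point\<close>

lemma exists_phase_rotation:
  fixes z :: complex and c :: real
  assumes "cmod z = \<bar>c\<bar>"
  obtains \<theta> where "exp (\<i> * complex_of_real \<theta>) * z = complex_of_real c"
proof (cases "c = 0")
  case True
  then show ?thesis using assms that[of 0] by simp
next
  case False
  then have z: "z \<noteq> 0" using assms by auto
  have "cmod (complex_of_real c / z) = 1" using assms False by (simp add: norm_divide)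
  then obtain \<theta> where "complex_of_real c / z = exp (\<i> * complex_of_real \<theta>)"
    using Arg_eq[of "complex_of_real c / z"] z False by auto
  then have "exp (\<i> * complex_of_real \<theta>) * z = complex_of_real c" using z by (metis nonzero_eq_divide_eq)
  then show ?thesis by (rule that)
qed

text \<open>The modulus of \<open>a + exp (\<i> * t) * b\<close> moves continuously between the sum
  and the difference of the two lengths as \<open>t\<close> runs over \<open>{0..pi}\<close>, so it
  takes the value of the third length. A common rotation then turns the sum into
  \<open>- c\<close>.\<close>

lemma triangle_phases:
  fixes a b c :: real
  assumes "\<bar>\<bar>a\<bar> - \<bar>b\<bar>\<bar> \<le> \<bar>c\<bar>" "\<bar>c\<bar> \<le> \<bar>a\<bar> + \<bar>b\<bar>"
  obtains \<phi> \<xi> where "exp (\<i> * complex_of_real \<phi>) * a + exp (\<i> * complex_of_real \<xi>) * b + c = 0"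
proof -
  define f where "f t = cmod (a + exp (\<i> * complex_of_real t) * b)" for t
  have cont: "continuous_on {0..pi} f" unfolding f_def by (intro continuous_intros)
  have "f 0 = \<bar>a + b\<bar>" "f pi = \<bar>a - b\<bar>"
    by (simp_all add: f_def exp_pi_i' norm_of_real flip: of_real_add of_real_diff of_real_minus)
  then have "(f 0 \<le> \<bar>c\<bar> \<and> \<bar>c\<bar> \<le> f pi) \<or> (f pi \<le> \<bar>c\<bar> \<and> \<bar>c\<bar> \<le> f 0)" using assms by linarith
  then obtain t where t: "f t = \<bar>c\<bar>"
    using IVT'[of f 0 "\<bar>c\<bar>" pi] IVT2'[of f pi "\<bar>c\<bar>" 0] cont by (auto simp: pi_ge_zero)
  then have "cmod (a + exp (\<i> * complex_of_real t) * b) = \<bar>- c\<bar>" by (simp add: f_def)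
  then obtain \<theta> where \<theta>: "exp (\<i> * complex_of_real \<theta>) * (a + exp (\<i> * complex_of_real t) * b) = complex_of_real (- c)"
    by (rule exists_phase_rotation)
  have "exp (\<i> * complex_of_real \<theta>) * a + exp (\<i> * complex_of_real (\<theta> + t)) * b + c = 0"
    using \<theta> by (simp add: distrib_left exp_add mult.assoc)
  then show ?thesis by (rule that)
qed

text \<open>Target weights 1, 1 and a remainder of total 1 satisfy the strict triangle inequality,
  which is why three neighbours are needed.\<close>

lemma cancelling_phases:
  fixes N :: "'v::finite set"
  assumes N: "card N \<ge> 3"
  shows "\<exists>m. \<forall>t>0. \<forall>w. (\<forall>s\<in>N. 10 * real CARD('v) * \<bar>w s - t * m s\<bar> \<le> t) \<longrightarrow>
    (\<exists>\<phi>. (\<Sum>s\<in>N. exp (\<i> * complex_of_real (\<phi> s)) * complex_of_real (w s)) = 0)"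
proof -
  obtain s1 where s1: "s1 \<in> N" using N by fastforce
  have "card (N - {s1}) \<ge> 2" using N s1 by simp
  then have "N - {s1} \<noteq> {}" by (metis card.empty not_numeral_le_zero)
  then obtain s2 where s2: "s2 \<in> N - {s1}" by blast
  define R where "R = N - {s1, s2}"
  have "s1 \<noteq> s2" using s2 by blast
  then have "card R = card N - 2" using s1 s2 by (simp add: R_def card_Diff_subset)
  then have R: "real (card R) > 0" using N by simp
  define m where "m s = (if s = s1 \<or> s = s2 then 1 else 1 / real (card R))" for s
  have split: "(\<Sum>s\<in>N. g s) = g s1 + g s2 + (\<Sum>s\<in>R. g s)" for g :: "'v \<Rightarrow> complex"
  proof -
    have "N = insert s1 (insert s2 R)" using s1 s2 by (auto simp: R_def)
    moreover have "(\<Sum>s\<in>insert s1 (insert s2 R). g s) = g s1 + g s2 + (\<Sum>s\<in>R. g s)"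
    proof -
      have "s1 \<notin> insert s2 R" "s2 \<notin> R" using s2 by (auto simp: R_def)
      then show ?thesis by (simp add: add.assoc)
    qed
    ultimately show ?thesis by simp
  qed
  show ?thesis
  \<comment> \<open>\<open>m\<close> is fixed before the scale \<open>t\<close> and the weights
    \<open>w\<close>, since it will determine the direction in which the matrix is
    perturbed.\<close>
  proof (rule exI[of _ m], intro allI impI)
    fix t :: real and w assume t: "t > 0" and near: "\<forall>s\<in>N. 10 * real CARD('v) * \<bar>w s - t * m s\<bar> \<le> t"
    have n: "real CARD('v) \<ge> 1" by (simp add: Suc_leI)
    have near1: "\<bar>w s - t * m s\<bar> \<le> t / (10 * real CARD('v))" if "s \<in> N" for s
      using near[rule_format, OF that] n by (simp add: field_simps)
    also have "t / (10 * real CARD('v)) \<le> t / 10" using n t by (simp add: field_simps)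
    finally have near10: "\<bar>w s - t * m s\<bar> \<le> t / 10" if "s \<in> N" for s using that by simp
    have a: "\<bar>w s1 - t\<bar> \<le> t / 10" and b: "\<bar>w s2 - t\<bar> \<le> t / 10"
      using near10[of s1] near10[of s2] s1 s2 by (auto simp: m_def)
    define c where "c = (\<Sum>s\<in>R. w s)"
    have "(\<Sum>s\<in>R. t * m s) = (\<Sum>s\<in>R. t / real (card R))"
      by (intro sum.cong refl) (auto simp: m_def R_def)
    also have "\<dots> = t" using R by (cases "R = {}") simp_all
    finally have "(\<Sum>s\<in>R. t * m s) = t" .
    then have "\<bar>c - t\<bar> = \<bar>\<Sum>s\<in>R. w s - t * m s\<bar>" by (simp add: c_def sum_subtractf)
    also have "\<dots> \<le> (\<Sum>s\<in>R. t / (10 * real CARD('v)))"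
      by (rule order_trans[OF sum_abs]) (intro sum_mono near1, auto simp: R_def)
    also have "\<dots> = real (card R) * (t / (10 * real CARD('v)))" by simp
    also have "\<dots> \<le> real CARD('v) * (t / (10 * real CARD('v)))"
      using t by (intro mult_right_mono) (auto intro: card_mono)
    also have "\<dots> = t / 10" using n by simp
    finally have c: "\<bar>c - t\<bar> \<le> t / 10" .
    \<comment> \<open>All three lengths lie within \<open>t / 10\<close> of \<open>t\<close>. The
      remainder may collect up to \<open>CARD('v)\<close> errors, which is why each single tolerance
      is divided by that number.\<close>
    have "\<bar>\<bar>w s1\<bar> - \<bar>w s2\<bar>\<bar> \<le> \<bar>c\<bar>" "\<bar>c\<bar> \<le> \<bar>w s1\<bar> + \<bar>w s2\<bar>" using a b c t by linarith+
    then obtain \<phi> \<xi> where \<phi>: "exp (\<i> * complex_of_real \<phi>) * w s1 + exp (\<i> * complex_of_real \<xi>) * w s2 + c = 0"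
      by (rule triangle_phases)
    define \<theta> where "\<theta> s = (if s = s1 then \<phi> else if s = s2 then \<xi> else 0)" for s
    have "(\<Sum>s\<in>R. exp (\<i> * complex_of_real (\<theta> s)) * complex_of_real (w s)) = complex_of_real c"
      unfolding c_def of_real_sum by (intro sum.cong) (auto simp: \<theta>_def R_def)
    then have "(\<Sum>s\<in>N. exp (\<i> * complex_of_real (\<theta> s)) * complex_of_real (w s)) = 0"
      using \<phi> s2 by (simp add: split \<theta>_def)
    then show "\<exists>\<phi>. (\<Sum>s\<in>N. exp (\<i> * complex_of_real (\<phi> s)) * complex_of_real (w s)) = 0" by blast
  qed
qed

section \<open>Spectra of block sums and of complexified matrices\<close>

lemma card_filter_Un:
  assumes "finite B" "finite B'" "B \<inter> B' = {}"
  shows "card {b \<in> B \<union> B'. P b} = card {b \<in> B. P b} + card {b \<in> B'. P b}"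
proof -
  have "{b \<in> B \<union> B'. P b} = {b \<in> B. P b} \<union> {b \<in> B'. P b}" by auto
  moreover have "{b \<in> B. P b} \<inter> {b \<in> B'. P b} = {}" using assms by auto
  ultimately show ?thesis using assms by (simp add: card_Un_disjoint)
qed

text \<open>Used for the two isometries from real to complex vectors, multiplication by 1 and by
  \<open>\<i>\<close>.\<close>

lemma eigenbasis_image:
  fixes J :: "'a::euclidean_space \<Rightarrow> 'b::euclidean_space"
  assumes B: "eigenbasis S f B" and J: "linear J" "\<And>x y. J x \<bullet> J y = x \<bullet> y"
    and f': "linear f'" "\<And>x. x \<in> S \<Longrightarrow> f' (J x) = J (f x)"
  shows "eigenbasis (J ` S) f' (J ` B)"
    and "card {b \<in> J ` B. P (f' b \<bullet> b)} = card {b \<in> B. P (f b \<bullet> b)}"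
proof -
  have BS: "B \<subseteq> S" by (rule eigenbasis_subset[OF B])
  have "span (J ` B) = J ` S" using B J(1) by (simp add: eigenbasis_def span_linear_image)
  moreover have "\<exists>m. f' b = m *\<^sub>R b" if b: "b \<in> J ` B" for b
  proof -
    obtain x where x: "x \<in> B" "b = J x" using b by blast
    obtain m where "f x = m *\<^sub>R x" using B x by (auto simp: eigenbasis_def)
    then have "f' b = m *\<^sub>R b" using x f'(2)[of x] BS by (auto simp: linear_cmul[OF J(1)])
    then show ?thesis by blast
  qed
  moreover have "norm (J x) = norm x" for x by (simp add: norm_eq_sqrt_inner J(2))
  ultimately show "eigenbasis (J ` S) f' (J ` B)"
    using B f'(1) by (auto simp: eigenbasis_def pairwise_def orthogonal_def J(2))
  have inj: "inj J"
  proof (rule injI)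
    fix x y assume "J x = J y"
    then have "J (x - y) = 0" by (simp add: linear_diff[OF J(1)])
    then have "(x - y) \<bullet> (x - y) = 0" using J(2)[of "x - y" "x - y"] by simp
    then show "x = y" by simp
  qed
  have "{b \<in> J ` B. P (f' b \<bullet> b)} = J ` {b \<in> B. P (f b \<bullet> b)}"
    using BS f'(2) J(2) by force
  then show "card {b \<in> J ` B. P (f' b \<bullet> b)} = card {b \<in> B. P (f b \<bullet> b)}"
    using inj by (simp add: card_image inj_on_subset)
qed

definition complex_vec :: "complex \<Rightarrow> real^'v \<Rightarrow> complex^'v::finite" where
  "complex_vec c x = (\<chi> r. c * complex_of_real (x $ r))"

lemma complex_vec_nth [simp]: "complex_vec c x $ r = c * complex_of_real (x $ r)"
  by (simp add: complex_vec_def)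

lemma inner_complex_vec: "complex_vec c x \<bullet> complex_vec c' y = Re (cnj c * c') * (x \<bullet> y)"
proof -
  have "complex_vec c x \<bullet> complex_vec c' y = (\<Sum>r\<in>UNIV. Re (cnj c * c' * complex_of_real (x $ r * y $ r)))"
    unfolding inner_vec_def inner_complex_Re by (intro sum.cong refl) (simp add: mult_ac)
  also have "\<dots> = (\<Sum>r\<in>UNIV. Re (cnj c * c') * (x $ r * y $ r))"
    by (intro sum.cong refl) (simp add: algebra_simps)
  also have "\<dots> = Re (cnj c * c') * (x \<bullet> y)" by (simp add: inner_vec_def sum_distrib_left)
  finally show ?thesis .
qed

lemma linear_complex_vec: "linear (complex_vec c)"
proof (rule linearI)
  show "complex_vec c (r *\<^sub>R x) = r *\<^sub>R complex_vec c x" for r and x :: "real^'v"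
    by (simp add: vec_eq_iff complex_eq_iff algebra_simps)
qed (simp add: vec_eq_iff algebra_simps)

lemma magnetic_0_complex_vec: "magnetic h 0 *v complex_vec c x = complex_vec c (h *v x)"
  by (simp add: vec_eq_iff matrix_vector_mult_def sum_distrib_left mult_ac)

text \<open>For the real inner product the real and the purely imaginary vectors are orthogonal and
  together span everything, and a real matrix preserves both. Every real eigenvector thus occurs
  twice, once multiplied by \<open>\<i>\<close>.\<close>

lemma eigenbasis_complexify:
  fixes h :: "real^'v^'v::finite"
  assumes B: "eigenbasis (coord_space U) ((*v) h) B"
  obtains B' where "eigenbasis (coord_space U) ((*v) (magnetic h 0)) B'"
    "\<And>P. card {b \<in> B'. P ((magnetic h 0 *v b) \<bullet> b)} = 2 * card {b \<in> B. P ((h *v b) \<bullet> b)}"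
proof -
  let ?f = "(*v) (magnetic h 0)"
  have iso: "complex_vec c x \<bullet> complex_vec c y = x \<bullet> y" if "c = 1 \<or> c = \<i>" for c and x y :: "real^'v"
    using that by (auto simp: inner_complex_vec)
  have E: "eigenbasis (complex_vec 1 ` coord_space U) ?f (complex_vec 1 ` B)"
     "eigenbasis (complex_vec \<i> ` coord_space U) ?f (complex_vec \<i> ` B)"
    by (rule eigenbasis_image(1)[OF B linear_complex_vec]; simp add: iso linear_matrix_vector_mult magnetic_0_complex_vec)+
  have orth: "x \<bullet> y = 0" if "x \<in> complex_vec 1 ` coord_space U" "y \<in> complex_vec \<i> ` coord_space U" for x y :: "complex^'v"
    using that by (auto simp: inner_complex_vec)
  note Un = eigenbasis_Un[OF E orth]
  have S: "{x + y |x y. x \<in> complex_vec 1 ` coord_space U \<and> y \<in> complex_vec \<i> ` coord_space U} = (coord_space U :: (complex^'v) set)"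
  proof (intro set_eqI iffI)
    fix z :: "complex^'v" assume z: "z \<in> coord_space U"
    have "z = complex_vec 1 (\<chi> r. Re (z $ r)) + complex_vec \<i> (\<chi> r. Im (z $ r))"
      by (simp add: vec_eq_iff complex_eq)
    moreover have "(\<chi> r. Re (z $ r)) \<in> coord_space U" "(\<chi> r. Im (z $ r)) \<in> coord_space U"
      using z by (auto simp: coord_space_iff)
    ultimately show "z \<in> {x + y |x y. x \<in> complex_vec 1 ` coord_space U \<and> y \<in> complex_vec \<i> ` coord_space U}" by blast
  qed (auto simp: coord_space_iff)
  show ?thesis
  proof (rule that)
    show "eigenbasis (coord_space U) ?f (complex_vec 1 ` B \<union> complex_vec \<i> ` B)" using Un(1) unfolding S .
    show "card {b \<in> complex_vec 1 ` B \<union> complex_vec \<i> ` B. P ((magnetic h 0 *v b) \<bullet> b)} = 2 * card {b \<in> B. P ((h *v b) \<bullet> b)}" for P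
    proof -
      have "card {b \<in> complex_vec c ` B. P ((magnetic h 0 *v b) \<bullet> b)} = card {b \<in> B. P ((h *v b) \<bullet> b)}"
        if "c = 1 \<or> c = \<i>" for c
        by (rule eigenbasis_image(2)[OF B linear_complex_vec])
          (simp_all add: iso that linear_matrix_vector_mult magnetic_0_complex_vec)
      then show ?thesis
        using card_filter_Un[OF eigenbasis_finite[OF E(1)] eigenbasis_finite[OF E(2)] Un(2)] by simp
    qed
  qed
qed

text \<open>Each summand annihilates the vectors living on the other index set, so the eigenbases
  are joined and the counts add.\<close>

lemma eigenbasis_coord_Un:
  fixes h h' :: "real^'v^'v::finite"
  assumes B: "eigenbasis (coord_space U) ((*v) h) B" and B': "eigenbasis (coord_space U') ((*v) h') B'"
    and U: "U \<inter> U' = {}" and h: "\<And>r s. s \<notin> U \<Longrightarrow> h $ r $ s = 0" and h': "\<And>r s. s \<notin> U' \<Longrightarrow> h' $ r $ s = 0"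
  shows "eigenbasis (coord_space (U \<union> U')) ((*v) (h + h')) (B \<union> B')"
    and "card {b \<in> B \<union> B'. P (((h + h') *v b) \<bullet> b)} = card {b \<in> B. P ((h *v b) \<bullet> b)} + card {b \<in> B'. P ((h' *v b) \<bullet> b)}"
proof -
  have 1: "(h + h') *v x = h *v x" if "x \<in> coord_space U" for x
  proof -
    have "h' $ i $ s * x $ s = 0" for i s
      using that U h' by (cases "s \<in> U") (auto simp: coord_space_iff disjoint_iff)
    then have "h' *v x = 0" by (auto simp: vec_eq_iff matrix_vector_mult_def intro!: sum.neutral)
    then show ?thesis by (simp add: matrix_vector_mult_add_rdistrib)
  qed
  have 2: "(h + h') *v x = h' *v x" if "x \<in> coord_space U'" for x
  proof -
    have "h $ i $ s * x $ s = 0" for i s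
      using that U h by (cases "s \<in> U'") (auto simp: coord_space_iff disjoint_iff)
    then have "h *v x = 0" by (auto simp: vec_eq_iff matrix_vector_mult_def intro!: sum.neutral)
    then show ?thesis by (simp add: matrix_vector_mult_add_rdistrib)
  qed
  have E: "eigenbasis (coord_space U) ((*v) (h + h')) B" "eigenbasis (coord_space U') ((*v) (h + h')) B'"
    by (rule eigenbasis_cong[OF B linear_matrix_vector_mult], erule 1)
      (rule eigenbasis_cong[OF B' linear_matrix_vector_mult], erule 2)
  have orth: "x \<bullet> y = 0" if "x \<in> coord_space U" "y \<in> coord_space U'" for x y :: "real^'v"
    unfolding inner_vec_def using that U by (intro sum.neutral) (auto simp: coord_space_iff disjoint_iff)
  have "{x + y |x y. x \<in> coord_space U \<and> y \<in> coord_space U'} = (coord_space (U \<union> U') :: (real^'v) set)"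
  proof (intro set_eqI iffI)
    fix z :: "real^'v" assume z: "z \<in> coord_space (U \<union> U')"
    have "z = restrict_vec U z + restrict_vec U' z" using z U by (auto simp: vec_eq_iff coord_space_iff)
    moreover have "restrict_vec U z \<in> coord_space U" "restrict_vec U' z \<in> coord_space U'"
      by (auto simp: coord_space_iff)
    ultimately show "z \<in> {x + y |x y. x \<in> coord_space U \<and> y \<in> coord_space U'}" by blast
  qed (auto simp: coord_space_iff)
  then show "eigenbasis (coord_space (U \<union> U')) ((*v) (h + h')) (B \<union> B')"
    using eigenbasis_Un(1)[OF E orth] by simp
  have "{b \<in> B. P (((h + h') *v b) \<bullet> b)} = {b \<in> B. P ((h *v b) \<bullet> b)}"
     "{b \<in> B'. P (((h + h') *v b) \<bullet> b)} = {b \<in> B'. P ((h' *v b) \<bullet> b)}"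
    using 1 2 eigenbasis_subset[OF B] eigenbasis_subset[OF B'] by (auto simp: subset_iff)
  then show "card {b \<in> B \<union> B'. P (((h + h') *v b) \<bullet> b)} = card {b \<in> B. P ((h *v b) \<bullet> b)} + card {b \<in> B'. P ((h' *v b) \<bullet> b)}"
    using card_filter_Un[OF eigenbasis_finite[OF B] eigenbasis_finite[OF B'] eigenbasis_Un(2)[OF E orth]] by simp
qed

lemma norm_principal_submatrix_le:
  fixes M :: "'a::real_normed_vector^'v^'v::finite"
  shows "norm (principal_submatrix M U) \<le> norm M"
  by (rule norm_matrix_mono) simp

text \<open>The numbers of eigenvalues on either side cannot drop under the perturbation, so the given
  eigenpair of the perturbed matrix accounts for exactly one eigenvalue.\<close>

lemma hermitian_eigenvalue_count:
  fixes M0 M :: "complex^'v^'v::finite"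
  assumes M: "spectral_matrix 2 U M" and B: "eigenbasis (coord_space U) ((*v) M0) B"
    and less: "card {b \<in> B. (M0 *v b) \<bullet> b < \<mu>} = 2 * (k - 1)" and eq: "card {b \<in> B. (M0 *v b) \<bullet> b = \<mu>} = 2"
    and gap: "\<And>b. b \<in> B \<Longrightarrow> (M0 *v b) \<bullet> b \<noteq> \<mu> \<Longrightarrow> d \<le> \<bar>(M0 *v b) \<bullet> b - \<mu>\<bar>"
    and near: "norm (M - M0) \<le> \<eta>" and \<mu>': "\<bar>\<mu>' - \<mu>\<bar> \<le> \<eta>" and d: "2 * \<eta> < d"
    and x: "x \<in> eigenspace U M \<mu>'" "x \<noteq> 0" and k: "1 \<le> k"
  shows "count_below U M \<mu>' = k - 1" "multiplicity_of U M \<mu>' = 1" "eigenvalue_nth k U M = \<mu>'"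
proof -
  obtain B' where B': "eigenbasis (coord_space U) ((*v) M) B'" by (rule spectral_eigenbasis[OF M])
  have nearv: "norm (M *v v - M0 *v v) \<le> \<eta> * norm v" for v
  proof -
    have "norm (M *v v - M0 *v v) \<le> norm (M - M0) * norm v"
      using norm_matrix_vector_le[of "M - M0" v] by (simp add: matrix_vector_mult_diff_rdistrib)
    also have "\<dots> \<le> \<eta> * norm v" by (rule mult_right_mono[OF near]) simp
    finally show ?thesis .
  qed
  have l: "2 * (k - 1) \<le> card {b \<in> B'. (M *v b) \<bullet> b < \<mu>'}"
    unfolding less[symmetric] by (rule eigenbasis_perturb_less[OF B B' gap nearv \<mu>' d])
  have g: "card {b \<in> B. \<mu> < (M0 *v b) \<bullet> b} \<le> card {b \<in> B'. \<mu>' < (M *v b) \<bullet> b}"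
    by (rule eigenbasis_perturb_greater[OF B B' gap nearv \<mu>' d])
  have mult: "2 * multiplicity_of U M \<mu>' = card {b \<in> B'. (M *v b) \<bullet> b = \<mu>'}"
    by (rule multiplicity_eigenbasis[OF M B'])
  have "\<mu>' \<in> spectrum U M" using x by (auto simp: spectrum_def)
  then have "{b \<in> B'. (M *v b) \<bullet> b = \<mu>'} \<noteq> {}" using spectrum_eigenbasis[OF M B'] by auto
  then have "card {b \<in> B'. (M *v b) \<bullet> b = \<mu>'} \<noteq> 0" using eigenbasis_finite[OF B'] by simp
  \<comment> \<open>The real dimension of a nonzero complex eigenspace is even, hence at least 2.
    Together with the lower bounds \<open>l\<close> and \<open>g\<close> and the equal totals this
    leaves no freedom in any of the three counts.\<close>
  with mult have m: "2 \<le> card {b \<in> B'. (M *v b) \<bullet> b = \<mu>'}" by presburger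
  have "card B = card B'" using eigenbasis_card[OF B] eigenbasis_card[OF B'] by simp
  then have "card {b \<in> B'. (M *v b) \<bullet> b < \<mu>'} = 2 * (k - 1)" and m2: "card {b \<in> B'. (M *v b) \<bullet> b = \<mu>'} = 2"
    using l g m less eq
      card_trichotomy[OF eigenbasis_finite[OF B], of "\<lambda>b. (M0 *v b) \<bullet> b" \<mu>]
      card_trichotomy[OF eigenbasis_finite[OF B'], of "\<lambda>b. (M *v b) \<bullet> b" \<mu>'] by linarith+
  then show "count_below U M \<mu>' = k - 1" "multiplicity_of U M \<mu>' = 1" "eigenvalue_nth k U M = \<mu>'"
    using length_filter_eigenvalues[OF M B', of "\<lambda>x. x < \<mu>'"] mult eigenvalue_nth_eqI[OF M B' k]
    by (simp_all add: count_below_def)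
qed

theorem theorem3p8:
  fixes G :: "('v::finite, 'e) pre_digraph"
    and V_N V_ZN V_ZZ :: "'v set"
    and h_N h_ZN h_ZZ :: "real^'v^'v"
    and \<psi>_N :: "real^'v"
    and \<mu>0 \<epsilon> :: real
    and k_N k_ZN k_ZZ :: nat
  assumes "graph G" and "Digraph_Component.connected G"
    and "admissible_support G V_N"
    and "V_ZN = support_ZN G V_N" and "V_ZZ = support_ZZ G V_N"
    and "h_N \<in> symmetric_on (G \<restriction> V_N)"
    and "1 \<le> k_N" and "k_N \<le> card V_N" and "\<mu>0 = eigenvalue_nth k_N V_N h_N"
    and "simple_eigenvalue V_N h_N \<mu>0"
    and "\<psi>_N \<in> eigenspace V_N h_N \<mu>0" and "\<forall>r\<in>V_N. \<psi>_N $ r \<noteq> 0"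
    and "h_ZN \<in> symmetric_on (G \<restriction> V_ZN)" and "h_ZZ \<in> symmetric_on (G \<restriction> V_ZZ)"
    and "\<mu>0 \<notin> spectrum V_ZN h_ZN" and "\<mu>0 \<notin> spectrum V_ZZ h_ZZ"
    and "k_ZN = count_below V_ZN h_ZN \<mu>0" and "k_ZZ = count_below V_ZZ h_ZZ \<mu>0"
    and "\<epsilon> > 0"
  shows "\<exists>h \<alpha>. h \<in> symmetric_on G \<and> generic G h \<and> \<alpha> \<in> antisymmetric_on G \<and>
    norm (principal_submatrix h V_N - h_N) < \<epsilon> \<and>
    norm (principal_submatrix h V_ZN - h_ZN) < \<epsilon> \<and>
    norm (principal_submatrix h V_ZZ - h_ZZ) < \<epsilon> \<and>
    (let k = k_N + k_ZN + k_ZZ;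
         M = magnetic h \<alpha>;
         \<mu> = eigenvalue_nth k (verts G) M
     in torus_critical_point G h (torus_eigenvalue k G) (gauge_class G M) \<and>
        simple_eigenvalue (verts G) M \<mu> \<and>
        (\<forall>x\<in>eigenspace (verts G) M \<mu>. x \<noteq> 0 \<longrightarrow> vec_support x = V_N))"
proof -
  interpret graph G by fact
  define k where "k = k_N + k_ZN + k_ZZ"
  define V where "V = verts G"
  have sym: "sym (arcs_ends G)" using sym_arcs by (simp add: symmetric_def)
  have adjV: "r \<in> V \<and> s \<in> V" if "r \<rightarrow>\<^bsub>G\<^esub> s" for r s using that by (auto simp: V_def adj_in_verts)
  have adj_sym: "s \<rightarrow>\<^bsub>G\<^esub> r" if "r \<rightarrow>\<^bsub>G\<^esub> s" for r s using that sym by (meson symD)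
  have VN: "V_N \<noteq> {}" "V_N \<subseteq> V" and adm: "\<And>r. r \<in> V - V_N \<Longrightarrow> {s\<in>V_N. r \<rightarrow>\<^bsub>G\<^esub> s} = {} \<or> card {s\<in>V_N. r \<rightarrow>\<^bsub>G\<^esub> s} \<ge> 3"
    using assms(3) by (auto simp: admissible_support_def V_def)
  have ZN: "r \<in> V_ZN \<longleftrightarrow> r \<in> V \<and> r \<notin> V_N \<and> (\<exists>s\<in>V_N. r \<rightarrow>\<^bsub>G\<^esub> s)" for r
    unfolding assms(4) support_ZN_def V_def by auto
  have ZZ: "r \<in> V_ZZ \<longleftrightarrow> r \<in> V \<and> r \<notin> V_N \<and> r \<notin> V_ZN" for r
    unfolding assms(4,5) support_ZZ_def V_def by auto
  have disj: "V_N \<inter> V_ZN = {}" "(V_N \<union> V_ZN) \<inter> V_ZZ = {}" and V: "V = V_N \<union> V_ZN \<union> V_ZZ"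
    using ZN ZZ VN by blast+
  have sub: "transpose g = g" "\<And>r s. r \<notin> U \<Longrightarrow> g $ r $ s = 0" "\<And>r s. s \<notin> U \<Longrightarrow> g $ r $ s = 0"
    if "g \<in> symmetric_on (G \<restriction> U)" for g :: "real^'v^'v" and U
    using that unfolding symmetric_on_def supported_on_def by auto
  have induce_sub: "g \<in> symmetric_on G" if g: "g \<in> symmetric_on (G \<restriction> U)" and U: "U \<subseteq> V" for g :: "real^'v^'v" and U
  proof -
    have "(r, s) \<in> arcs_ends G" if "(r, s) \<in> arcs_ends (G \<restriction> U)" for r s
      using that by (auto simp: arcs_ends_induce arcs_in_def)
    then show ?thesis using g U unfolding symmetric_on_def supported_on_def V_def by force
  qed

  note sN = sub[OF assms(6)] and sZN = sub[OF assms(13)] and sZZ = sub[OF assms(14)]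
  note spN = spectral_symmetric[OF sN(1,2)] and spZN = spectral_symmetric[OF sZN(1,2)] and spZZ = spectral_symmetric[OF sZZ(1,2)]
  obtain B_N where BN: "eigenbasis (coord_space V_N) ((*v) h_N) B_N" by (rule spectral_eigenbasis[OF spN])
  obtain B_ZN where BZN: "eigenbasis (coord_space V_ZN) ((*v) h_ZN) B_ZN" by (rule spectral_eigenbasis[OF spZN])
  obtain B_ZZ where BZZ: "eigenbasis (coord_space V_ZZ) ((*v) h_ZZ) B_ZZ" by (rule spectral_eigenbasis[OF spZZ])
  have N_eq: "card {b \<in> B_N. (h_N *v b) \<bullet> b = \<mu>0} = 1"
    using multiplicity_eigenbasis[OF spN BN, of \<mu>0] assms(10) by (simp add: simple_eigenvalue_def)
  have "card B_N = card V_N" using eigenbasis_card[OF BN] by (simp add: dim_coord_space)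
  then have N_less: "card {b \<in> B_N. (h_N *v b) \<bullet> b < \<mu>0} = k_N - 1"
    using card_less_simple_eigenvalue_nth[OF spN BN _ _ assms(9) N_eq] assms(7,8) by simp
  have ZN_less: "card {b \<in> B_ZN. (h_ZN *v b) \<bullet> b < \<mu>0} = k_ZN"
    using length_filter_eigenvalues[OF spZN BZN, of "\<lambda>x. x < \<mu>0"] assms(17) by (simp add: count_below_def)
  have ZZ_less: "card {b \<in> B_ZZ. (h_ZZ *v b) \<bullet> b < \<mu>0} = k_ZZ"
    using length_filter_eigenvalues[OF spZZ BZZ, of "\<lambda>x. x < \<mu>0"] assms(18) by (simp add: count_below_def)
  have "{b \<in> B_ZN. (h_ZN *v b) \<bullet> b = \<mu>0} = {}" "{b \<in> B_ZZ. (h_ZZ *v b) \<bullet> b = \<mu>0} = {}"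
    using assms(15,16) spectrum_eigenbasis[OF spZN BZN] spectrum_eigenbasis[OF spZZ BZZ] by auto
  then have Z_eq: "card {b \<in> B_ZN. (h_ZN *v b) \<bullet> b = \<mu>0} = 0" "card {b \<in> B_ZZ. (h_ZZ *v b) \<bullet> b = \<mu>0} = 0"
    by (metis card.empty)+

  define h0 where "h0 = h_N + h_ZN + h_ZZ"
  have h0S: "h0 \<in> symmetric_on G"
    using induce_sub[OF assms(6)] induce_sub[OF assms(13)] induce_sub[OF assms(14)] V subspace_symmetric_on[of G]
    by (auto simp: h0_def intro!: subspace_add)
  have cols: "(h_N + h_ZN) $ r $ s = 0" if "s \<notin> V_N \<union> V_ZN" for r s using that sN(3) sZN(3) by simp
  note B12 = eigenbasis_coord_Un[OF BN BZN disj(1) sN(3) sZN(3)]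
  note B123 = eigenbasis_coord_Un[OF B12(1) BZZ disj(2) cols sZZ(3), folded h0_def V]
  obtain B where B: "eigenbasis (coord_space V) ((*v) (magnetic h0 0)) B"
    and cB: "\<And>P. card {b \<in> B. P ((magnetic h0 0 *v b) \<bullet> b)} = 2 * card {b \<in> B_N \<union> B_ZN \<union> B_ZZ. P ((h0 *v b) \<bullet> b)}"
    using eigenbasis_complexify[OF B123(1)] by blast
  have B_less: "card {b \<in> B. (magnetic h0 0 *v b) \<bullet> b < \<mu>0} = 2 * (k - 1)"
    using cB[of "\<lambda>x. x < \<mu>0"] B123(2)[of "\<lambda>x. x < \<mu>0"] B12(2)[of "\<lambda>x. x < \<mu>0"] N_less ZN_less ZZ_less assms(7)
    by (simp add: k_def)
  have B_eq: "card {b \<in> B. (magnetic h0 0 *v b) \<bullet> b = \<mu>0} = 2"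
    using cB[of "\<lambda>x. x = \<mu>0"] B123(2)[of "\<lambda>x. x = \<mu>0"] B12(2)[of "\<lambda>x. x = \<mu>0"] N_eq Z_eq
    by simp
  obtain d1 where d1: "d1 > 0" "\<And>b. b \<in> B \<Longrightarrow> (magnetic h0 0 *v b) \<bullet> b \<noteq> \<mu>0 \<Longrightarrow> d1 \<le> \<bar>(magnetic h0 0 *v b) \<bullet> b - \<mu>0\<bar>"
    using finite_gap[OF eigenbasis_finite[OF B], of "\<lambda>b. (magnetic h0 0 *v b) \<bullet> b" \<mu>0] by blast
  obtain d2 where d2: "d2 > 0" "\<And>b. b \<in> B_N \<Longrightarrow> (h_N *v b) \<bullet> b \<noteq> \<mu>0 \<Longrightarrow> d2 \<le> \<bar>(h_N *v b) \<bullet> b - \<mu>0\<bar>"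
    using finite_gap[OF eigenbasis_finite[OF BN], of "\<lambda>b. (h_N *v b) \<bullet> b" \<mu>0] by blast
  \<comment> \<open>\<open>d1\<close> is the gap of the complexified block sum, used to fix the
    index of the eigenvalue; \<open>d2\<close> is the gap of \<open>h_N\<close> alone, used to
    follow its eigenvector.\<close>
  define d where "d = min d1 d2"
  have d: "d > 0" "d \<le> d1" "d \<le> d2" using d1 d2 by (auto simp: d_def)

  define nbr where "nbr r = {s\<in>V_N. r \<rightarrow>\<^bsub>G\<^esub> s}" for r
  define n where "n = real CARD('v)"
  have n: "n \<ge> 1" by (simp add: n_def Suc_leI)
  have nbr: "card (nbr r) \<ge> 3" if "r \<in> V_ZN" for r
    using adm[of r] that ZN[of r] by (auto simp: nbr_def)
  define Q where "Q r m \<longleftrightarrow> (\<forall>t>0. \<forall>w. (\<forall>s\<in>nbr r. 10 * n * \<bar>w s - t * m s\<bar> \<le> t) \<longrightarrow>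
      (\<exists>\<phi>. (\<Sum>s\<in>nbr r. exp (\<i> * complex_of_real (\<phi> s)) * complex_of_real (w s)) = 0))" for r and m :: "'v \<Rightarrow> real"
  define m where "m r = (SOME m. Q r m)" for r
  have "Q r (m r)" if "r \<in> V_ZN" for r
  proof -
    have "\<exists>m. Q r m" unfolding Q_def n_def by (rule cancelling_phases[OF nbr[OF that]])
    then show ?thesis unfolding m_def by (rule someI_ex)
  qed
  then have m: "\<And>r t w. r \<in> V_ZN \<Longrightarrow> t > 0 \<Longrightarrow> (\<And>s. s \<in> nbr r \<Longrightarrow> 10 * n * \<bar>w s - t * m r s\<bar> \<le> t) \<Longrightarrow>
      \<exists>\<phi>. (\<Sum>s\<in>nbr r. exp (\<i> * complex_of_real (\<phi> s)) * complex_of_real (w s)) = 0"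
    unfolding Q_def by blast
  \<comment> \<open>Division by \<open>\<psi>_N $ s\<close> makes the products of entry and
    eigenvector component equal to the target weights \<open>m r s\<close>. Only entries between
    \<open>V_N\<close> and \<open>V_ZN\<close> are touched, where \<open>h0\<close> is 0.\<close>
  define D :: "real^'v^'v" where "D = (\<chi> r s. if r \<in> V_ZN \<and> s \<in> nbr r then m r s / \<psi>_N $ s
      else if s \<in> V_ZN \<and> r \<in> nbr s then m s r / \<psi>_N $ r else 0)"
  have VN_ZN: "r \<notin> V_N" if "r \<in> V_ZN" for r using that disj by blast
  have DS: "D \<in> symmetric_on G"
    unfolding symmetric_on_iff
  proof (intro conjI allI impI)
    fix r s show "D $ r $ s = D $ s $ r" using VN_ZN by (auto simp: D_def nbr_def)
  next
    fix r s assume "D $ r $ s \<noteq> 0"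
    then have "r \<rightarrow>\<^bsub>G\<^esub> s" using adj_sym by (auto simp: D_def nbr_def split: if_splits)
    then show "r \<in> verts G" "s \<in> verts G" "r \<rightarrow>\<^bsub>G\<^esub> s" using adjV by (auto simp: V_def)
  qed
  define K where "K = norm D + 1"
  have K: "K \<ge> 1" "norm D \<le> K" by (auto simp: K_def)
  \<comment> \<open>Tolerance for the eigenvector: the first bound keeps its components on
    \<open>V_N\<close> away from 0, the second keeps the resulting error in the weights, of size
    \<open>t * K * \<kappa>\<close>, within \<open>t / (20 * n)\<close>.\<close>
  define \<kappa> where "\<kappa> = min (Min ((\<lambda>r. \<bar>\<psi>_N $ r\<bar>) ` V_N) / 2) (1 / (20 * n * K))"
  have psi_min: "Min ((\<lambda>r. \<bar>\<psi>_N $ r\<bar>) ` V_N) > 0" using VN(1) assms(12) by (subst Min_gr_iff) auto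
  have \<kappa>: "\<kappa> > 0" "20 * n * K * \<kappa> \<le> 1"
  proof -
    have p: "20 * n * K > 0" using n K by simp
    then show "\<kappa> > 0" using psi_min by (simp add: \<kappa>_def)
    have "\<kappa> \<le> 1 / (20 * n * K)" by (simp add: \<kappa>_def)
    then show "20 * n * K * \<kappa> \<le> 1" using p by (simp add: field_simps)
  qed
  have \<kappa>_less: "\<kappa> < \<bar>\<psi>_N $ r\<bar>" if "r \<in> V_N" for r
  proof -
    have "Min ((\<lambda>r. \<bar>\<psi>_N $ r\<bar>) ` V_N) \<le> \<bar>\<psi>_N $ r\<bar>" using that by simp
    moreover have "\<kappa> \<le> Min ((\<lambda>r. \<bar>\<psi>_N $ r\<bar>) ` V_N) / 2" by (simp add: \<kappa>_def)
    ultimately show ?thesis using psi_min by linarith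
  qed
  define P where "P = norm \<psi>_N + 1"
  have P: "P \<ge> 1" "norm \<psi>_N \<le> P" by (auto simp: P_def)
  \<comment> \<open>Bound for the whole distance of \<open>h\<close> from \<open>h0\<close>:
    \<open>\<epsilon> / 2\<close> for the required closeness, \<open>d / 4\<close> for the
    eigenvalue estimates, and the last term to put the perturbed eigenvector within
    \<open>\<kappa>\<close> of \<open>\<psi>_N\<close>.\<close>
  define \<eta> where "\<eta> = min (\<epsilon> / 2) (min (d / 4) (\<kappa> * d / (4 * P)))"
  have \<eta>: "\<eta> > 0" "\<eta> < \<epsilon>" "4 * \<eta> \<le> d" "4 * \<eta> / d * P \<le> \<kappa>"
  proof -
    show "\<eta> > 0" using assms(19) d \<kappa> P by (simp add: \<eta>_def)
    show "\<eta> < \<epsilon>" using assms(19) by (simp add: \<eta>_def)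
    show "4 * \<eta> \<le> d" by (simp add: \<eta>_def)
    have "\<eta> \<le> \<kappa> * d / (4 * P)" by (simp add: \<eta>_def)
    then show "4 * \<eta> / d * P \<le> \<kappa>" using d P by (simp add: field_simps)
  qed
  \<comment> \<open>Strength of the coupling between \<open>V_N\<close> and \<open>V_ZN\<close>:
    positive, yet using less than half of the budget \<open>\<eta>\<close>.\<close>
  define t where "t = \<eta> / (4 * K)"
  have t: "t > 0" "t * norm D < \<eta> / 2"
  proof -
    show "t > 0" using \<eta> K by (simp add: t_def)
    have "t * norm D \<le> t * K" using K \<open>t > 0\<close> by simp
    also have "\<dots> = \<eta> / 4" using K by (simp add: t_def)
    finally show "t * norm D < \<eta> / 2" using \<eta> by simp
  qed
  \<comment> \<open>Room for the generic perturbation. It has to be small relative to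
    \<open>t\<close>, not just to \<open>\<eta>\<close>, because the cancelling phases tolerate only
    errors up to a fixed fraction of the scale \<open>t\<close> of the weights.\<close>
  define \<rho> where "\<rho> = min (\<eta> / 2) (t / (20 * n * (P + \<kappa>)))"
  have \<rho>: "\<rho> > 0" "\<rho> \<le> \<eta> / 2" "20 * n * (\<rho> * (P + \<kappa>)) \<le> t"
  proof -
    have p: "20 * n * (P + \<kappa>) > 0" using n P \<kappa> by simp
    then show "\<rho> > 0" using \<eta> t by (simp add: \<rho>_def)
    show "\<rho> \<le> \<eta> / 2" by (simp add: \<rho>_def)
    have "\<rho> \<le> t / (20 * n * (P + \<kappa>))" by (simp add: \<rho>_def)
    then show "20 * n * (\<rho> * (P + \<kappa>)) \<le> t" using p by (simp add: field_simps)
  qed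

  have h1S: "h0 + t *\<^sub>R D \<in> symmetric_on G"
    using h0S DS subspace_symmetric_on by (auto intro: subspace_add subspace_scale)
  obtain h where h: "h \<in> symmetric_on G" "dist (h0 + t *\<^sub>R D) h < \<rho>" and gen: "generic G h"
    using dense_interior_onE[OF dense_interior_generic[OF sym] h1S \<rho>(1)] by (metis dist_self)
  have near: "norm (h - h0) < \<eta>"
  proof -
    have "norm (h - h0) \<le> norm (h - (h0 + t *\<^sub>R D)) + norm (t *\<^sub>R D)"
      using norm_triangle_ineq[of "h - (h0 + t *\<^sub>R D)" "t *\<^sub>R D"] by simp
    also have "norm (h - (h0 + t *\<^sub>R D)) < \<rho>" using h(2) by (simp add: dist_norm norm_minus_commute)
    also have "norm (t *\<^sub>R D) < \<eta> / 2" using t by simp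
    finally show ?thesis using \<rho>(2) by simp
  qed
  have h0_cross: "h0 $ r $ s = 0" "h0 $ s $ r = 0" if "r \<in> V_ZN" "s \<in> V_N" for r s
  proof -
    have "s \<notin> V_ZN" "s \<notin> V_ZZ" "r \<notin> V_N" using that disj by blast+
    then show "h0 $ r $ s = 0" "h0 $ s $ r = 0" by (simp_all add: h0_def sN(2,3) sZN(2,3) sZZ(2,3))
  qed
  have cross: "\<bar>h $ r $ s - t * (m r s / \<psi>_N $ s)\<bar> \<le> \<rho>" if "r \<in> V_ZN" "s \<in> nbr r" for r s
  proof -
    have "h0 $ r $ s = 0" using that by (intro h0_cross) (simp_all add: nbr_def)
    then have "h $ r $ s - t * (m r s / \<psi>_N $ s) = (h - (h0 + t *\<^sub>R D)) $ r $ s"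
      using that by (simp add: D_def)
    also have "\<bar>\<dots>\<bar> \<le> norm (h - (h0 + t *\<^sub>R D))" by (rule matrix_entry_le_norm)
    also have "\<dots> \<le> \<rho>" using h(2) by (simp add: dist_norm norm_minus_commute)
    finally show ?thesis .
  qed
  have blocks: "principal_submatrix h0 V_N = h_N" "principal_submatrix h0 V_ZN = h_ZN" "principal_submatrix h0 V_ZZ = h_ZZ"
  proof -
    have zN: "h_ZN $ r $ s = 0" "h_ZZ $ r $ s = 0" if "r \<in> V_N" for r s
      by (rule sZN(2) sZZ(2), use that disj in blast)+
    have zZN: "h_N $ r $ s = 0" "h_ZZ $ r $ s = 0" if "r \<in> V_ZN" for r s
      by (rule sN(2) sZZ(2), use that disj in blast)+
    have zZZ: "h_N $ r $ s = 0" "h_ZN $ r $ s = 0" if "r \<in> V_ZZ" for r s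
      by (rule sN(2) sZN(2), use that disj in blast)+
    have "principal_submatrix h0 V_N $ r $ s = h_N $ r $ s" for r s
      by (cases "r \<in> V_N"; cases "s \<in> V_N") (simp_all add: h0_def zN sN(2,3))
    moreover have "principal_submatrix h0 V_ZN $ r $ s = h_ZN $ r $ s" for r s
      by (cases "r \<in> V_ZN"; cases "s \<in> V_ZN") (simp_all add: h0_def zZN sZN(2,3))
    moreover have "principal_submatrix h0 V_ZZ $ r $ s = h_ZZ $ r $ s" for r s
      by (cases "r \<in> V_ZZ"; cases "s \<in> V_ZZ") (simp_all add: h0_def zZZ sZZ(2,3))
    ultimately show "principal_submatrix h0 V_N = h_N" "principal_submatrix h0 V_ZN = h_ZN"
        "principal_submatrix h0 V_ZZ = h_ZZ"
      unfolding vec_eq_iff by blast+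
  qed
  have block_near: "norm (principal_submatrix h U - principal_submatrix h0 U) < \<eta>" for U
  proof -
    have "principal_submatrix h U - principal_submatrix h0 U = principal_submatrix (h - h0) U"
      by (simp add: vec_eq_iff)
    then show ?thesis using norm_principal_submatrix_le[of "h - h0" U] near by simp
  qed

  let ?A = "principal_submatrix h V_N"
  have hsym: "h $ r $ s = h $ s $ r" for r s by (rule symmetric_on_nth[OF h(1)])
  have "transpose ?A = ?A" unfolding vec_eq_iff transpose_def using hsym by auto
  then have "spectral_matrix 1 V_N ?A" by (rule spectral_symmetric) simp
  then obtain B_A where BA: "eigenbasis (coord_space V_N) ((*v) ?A) B_A" by (rule spectral_eigenbasis)
  have nearA: "norm (?A *v v - h_N *v v) \<le> \<eta> * norm v" for v
  proof -
    have "norm (?A *v v - h_N *v v) \<le> norm (?A - h_N) * norm v"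
      using norm_matrix_vector_le[of "?A - h_N" v] by (simp add: matrix_vector_mult_diff_rdistrib)
    also have "\<dots> \<le> \<eta> * norm v" using block_near[of V_N] unfolding blocks by (intro mult_right_mono) auto
    finally show ?thesis .
  qed
  have \<psi>: "\<psi>_N \<in> coord_space V_N" "h_N *v \<psi>_N = \<mu>0 *\<^sub>R \<psi>_N" "\<psi>_N \<noteq> 0"
    using assms(11,12) VN(1) by (auto simp: eigenspace_scaleR)
  obtain \<mu> \<psi>' where \<psi>': "\<psi>' \<in> coord_space V_N" "?A *v \<psi>' = \<mu> *\<^sub>R \<psi>'" and \<mu>: "\<bar>\<mu> - \<mu>0\<bar> \<le> \<eta>"
    and \<psi>'_near: "norm (\<psi>' - \<psi>_N) \<le> 4 * \<eta> / d2 * norm \<psi>_N"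
    by (rule eigenbasis_perturb_eigenvector[OF BN BA \<psi>(1,3,2) N_eq d2 nearA]) (use \<eta>(3) d(3) in auto)
  have psi_diff: "\<bar>\<psi>' $ s - \<psi>_N $ s\<bar> \<le> \<kappa>" for s
  proof -
    have "\<bar>\<psi>' $ s - \<psi>_N $ s\<bar> \<le> norm (\<psi>' - \<psi>_N)" using component_le_norm_cart[of "\<psi>' - \<psi>_N" s] by simp
    also have "\<dots> \<le> 4 * \<eta> / d2 * norm \<psi>_N" by (rule \<psi>'_near)
    also have "\<dots> \<le> 4 * \<eta> / d * P" using \<eta> d P by (intro mult_mono frac_le) auto
    also have "\<dots> \<le> \<kappa>" by (rule \<eta>(4))
    finally show ?thesis .
  qed
  have psi_supp: "\<psi>' $ s \<noteq> 0 \<longleftrightarrow> s \<in> V_N" for s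
    using psi_diff[of s] \<kappa>_less[of s] \<psi>'(1) by (auto simp: coord_space_iff)

  have "\<exists>\<phi>. (\<Sum>s\<in>nbr r. exp (\<i> * complex_of_real (\<phi> s)) * complex_of_real (h $ r $ s * \<psi>' $ s)) = 0" if r: "r \<in> V_ZN" for r
  proof (rule m[OF r t(1)])
    fix s assume s: "s \<in> nbr r"
    then have s0: "\<psi>_N $ s \<noteq> 0" using assms(12) by (simp add: nbr_def)
    let ?D = "m r s / \<psi>_N $ s"
    have "\<bar>?D\<bar> \<le> K" using matrix_entry_le_norm[of D r s] r s K by (simp add: D_def)
    have "\<bar>\<psi>' $ s\<bar> \<le> P + \<kappa>"
      using psi_diff[of s] component_le_norm_cart[of \<psi>_N s] P by linarith
    \<comment> \<open>Half of the tolerance \<open>t / (10 * n)\<close> goes to the error of the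
      matrix entry, controlled by \<open>\<rho>\<close>, and half to that of the eigenvector,
      controlled by \<open>\<kappa>\<close>.\<close>
    have "h $ r $ s * \<psi>' $ s - t * m r s = (h $ r $ s - t * ?D) * \<psi>' $ s + t * ?D * (\<psi>' $ s - \<psi>_N $ s)"
      using s0 by (simp add: field_simps)
    also have "\<bar>\<dots>\<bar> \<le> \<bar>h $ r $ s - t * ?D\<bar> * \<bar>\<psi>' $ s\<bar> + t * \<bar>?D\<bar> * \<bar>\<psi>' $ s - \<psi>_N $ s\<bar>"
      by (rule order_trans[OF abs_triangle_ineq]) (use t in \<open>simp add: abs_mult\<close>)
    also have "\<dots> \<le> \<rho> * (P + \<kappa>) + t * K * \<kappa>"
      by (intro add_mono mult_mono cross[OF r s] \<open>\<bar>\<psi>' $ s\<bar> \<le> P + \<kappa>\<close> psi_diff \<open>\<bar>?D\<bar> \<le> K\<close> order_refl)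
        (use \<rho> t K in auto)
    finally have "20 * n * \<bar>h $ r $ s * \<psi>' $ s - t * m r s\<bar> \<le> 20 * n * (\<rho> * (P + \<kappa>) + t * K * \<kappa>)"
      using n by (intro mult_left_mono) auto
    also have "\<dots> = 20 * n * (\<rho> * (P + \<kappa>)) + t * (20 * n * K * \<kappa>)" by (simp add: algebra_simps)
    also have "\<dots> \<le> t + t * 1" using \<rho>(3) \<kappa>(2) t(1) by (intro add_mono mult_left_mono) auto
    finally show "10 * n * \<bar>h $ r $ s * \<psi>' $ s - t * m r s\<bar> \<le> t" by simp
  qed
  then obtain \<phi> where \<phi>: "\<forall>r\<in>V_ZN.
      (\<Sum>s\<in>nbr r. exp (\<i> * complex_of_real (\<phi> r s)) * complex_of_real (h $ r $ s * \<psi>' $ s)) = 0"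
    using bchoice[of V_ZN "\<lambda>r \<phi>. (\<Sum>s\<in>nbr r. exp (\<i> * complex_of_real (\<phi> s)) * complex_of_real (h $ r $ s * \<psi>' $ s)) = 0"]
    by blast

  \<comment> \<open>Without flux inside \<open>V_N\<close> the block there stays real and
    \<open>\<psi>'\<close> remains its eigenvector. The opposite sign on the reversed arc makes the
    matrix Hermitian.\<close>
  define \<alpha> :: "real^'v^'v" where "\<alpha> = (\<chi> r s. if r \<in> V_ZN \<and> s \<in> nbr r then \<phi> r s
      else if s \<in> V_ZN \<and> r \<in> nbr s then - \<phi> s r else 0)"
  have \<alpha>S: "\<alpha> \<in> antisymmetric_on G"
  proof -
    have "\<alpha> $ s $ r = - \<alpha> $ r $ s" for r s using VN_ZN by (auto simp: \<alpha>_def nbr_def)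
    then have "transpose \<alpha> = - \<alpha>"
      unfolding vec_eq_iff transpose_def vec_lambda_beta vector_uminus_component by blast
    moreover have "supported_on G \<alpha>" unfolding supported_on_def
    proof (intro allI impI)
      fix r s assume "\<alpha> $ r $ s \<noteq> 0"
      then have "r \<rightarrow>\<^bsub>G\<^esub> s" using adj_sym by (auto simp: \<alpha>_def nbr_def split: if_splits)
      then show "r \<in> verts G \<and> s \<in> verts G \<and> (r \<noteq> s \<longrightarrow> r \<rightarrow>\<^bsub>G\<^esub> s)" using adjV by (auto simp: V_def)
    qed
    ultimately show ?thesis by (simp add: antisymmetric_on_def)
  qed
  define M where "M = magnetic h \<alpha>"
  have M_real: "M $ r $ s = complex_of_real (h $ r $ s)" if "r \<in> V_N" "s \<in> V_N" for r s
    using that VN_ZN by (auto simp: M_def \<alpha>_def)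
  define x where "x = complex_vec 1 \<psi>'"
  have x_supp: "x $ s \<noteq> 0 \<longleftrightarrow> s \<in> V_N" for s using psi_supp by (simp add: x_def)
  have Mx: "M *v x = of_real \<mu> *s x"
  proof -
    have "(M *v x) $ r = complex_of_real \<mu> * x $ r" for r
    proof -
      have sumN: "(M *v x) $ r = (\<Sum>s\<in>V_N. M $ r $ s * x $ s)"
        unfolding matrix_vector_mult_def vec_lambda_beta
        by (rule sum.mono_neutral_right) (use x_supp in auto)
      \<comment> \<open>In the second case the row equation is the cancellation by the phases; in
        the third there is no arc from \<open>r\<close> into \<open>V_N\<close>.\<close>
      consider "r \<in> V_N" | "r \<in> V_ZN" | "r \<notin> V_N" "r \<notin> V_ZN" by blast
      then show ?thesis
      proof cases
        case 1
        have "(M *v x) $ r = complex_of_real (\<Sum>s\<in>V_N. h $ r $ s * \<psi>' $ s)"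
          unfolding sumN of_real_sum by (intro sum.cong refl) (simp add: M_real[OF 1] x_def)
        also have "(\<Sum>s\<in>V_N. h $ r $ s * \<psi>' $ s) = (?A *v \<psi>') $ r"
          unfolding matrix_vector_mult_def vec_lambda_beta using 1
          by (intro sum.mono_neutral_cong_left) auto
        also have "\<dots> = \<mu> * \<psi>' $ r" using \<psi>'(2) by simp
        finally show ?thesis by (simp add: x_def)
      next
        case 2
        have "(M *v x) $ r = (\<Sum>s\<in>nbr r. exp (\<i> * complex_of_real (\<phi> r s)) * complex_of_real (h $ r $ s * \<psi>' $ s))"
          unfolding sumN
        proof (rule sum.mono_neutral_cong_right)
          show "nbr r \<subseteq> V_N" by (auto simp: nbr_def)
          show "\<forall>s\<in>V_N - nbr r. M $ r $ s * x $ s = 0"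
          proof
            fix s assume s: "s \<in> V_N - nbr r"
            then have "\<not> r \<rightarrow>\<^bsub>G\<^esub> s" "r \<noteq> s" using VN_ZN[OF 2] by (auto simp: nbr_def)
            then have "h $ r $ s = 0" using h(1) unfolding symmetric_on_iff by blast
            then show "M $ r $ s * x $ s = 0" by (simp add: M_def)
          qed
          show "M $ r $ s * x $ s = exp (\<i> * complex_of_real (\<phi> r s)) * complex_of_real (h $ r $ s * \<psi>' $ s)"
            if "s \<in> nbr r" for s using that 2 by (simp add: M_def \<alpha>_def x_def)
        qed simp
        then show ?thesis using \<phi>[rule_format, OF 2] x_supp[of r] VN_ZN[OF 2] by simp
      next
        case 3
        have "M $ r $ s = 0" if s: "s \<in> V_N" for s
        proof -
          have "\<not> r \<rightarrow>\<^bsub>G\<^esub> s" "r \<noteq> s" using 3 s ZN[of r] adjV by blast+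
          then have "h $ r $ s = 0" using h(1) unfolding symmetric_on_iff by blast
          then show ?thesis by (simp add: M_def)
        qed
        then show ?thesis unfolding sumN using x_supp[of r] 3 by simp
      qed
    qed
    then show ?thesis by (simp add: vec_eq_iff)
  qed
  have xE: "x \<in> eigenspace V M \<mu>"
    using Mx x_supp VN(2) by (auto simp: eigenspace_coord_space coord_space_iff)
  have x0: "x \<noteq> 0" using x_supp VN(1) by (metis ex_in_conv zero_index)
  \<comment> \<open>Products with an index outside \<open>V_N\<close> vanish with \<open>x\<close>;
    the remaining ones are real because both \<open>x\<close> and the block are.\<close>
  have real: "Im (cnj (x $ r) * M $ r $ s * x $ s) = 0" for r s
  proof (cases "r \<in> V_N \<and> s \<in> V_N")
    case True then show ?thesis by (simp add: M_real x_def)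
  next
    case False then show ?thesis using x_supp[of r] x_supp[of s] by auto
  qed
  \<comment> \<open>The flux \<open>\<alpha>\<close> may be large without spoiling this bound: it is
    nonzero only at entries where \<open>h0\<close> vanishes, and there a phase does not change the
    modulus.\<close>
  have nearM: "norm (M - magnetic h0 0) \<le> \<eta>"
  proof -
    have "norm (M - magnetic h0 0) \<le> norm (h - h0)"
    proof (rule norm_matrix_mono)
      fix r s
      show "norm ((M - magnetic h0 0) $ r $ s) \<le> norm ((h - h0) $ r $ s)"
      proof (cases "\<alpha> $ r $ s = 0")
        case True
        then show ?thesis by (simp add: M_def flip: of_real_diff)
      next
        case False
        then have "r \<in> V_N \<and> s \<in> V_ZN \<or> r \<in> V_ZN \<and> s \<in> V_N" by (auto simp: \<alpha>_def nbr_def split: if_splits)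
        then have "h0 $ r $ s = 0" using h0_cross by blast
        then show ?thesis by (simp add: M_def norm_mult)
      qed
    qed
    with near show ?thesis by simp
  qed
  have k1: "1 \<le> k" using assms(7) by (simp add: k_def)
  have spM: "spectral_matrix 2 V M"
    unfolding V_def M_def by (intro spectral_hermitian_on magnetic_hermitian h(1) \<alpha>S)
  have gap1: "d \<le> \<bar>(magnetic h0 0 *v b) \<bullet> b - \<mu>0\<bar>" if "b \<in> B" "(magnetic h0 0 *v b) \<bullet> b \<noteq> \<mu>0" for b
    using d1(2)[OF that] d(2) by linarith
  have "2 * \<eta> < d" using \<eta> by linarith
  note count = hermitian_eigenvalue_count[OF spM B B_less B_eq gap1 nearM \<mu> this xE x0 k1]
  have crit: "torus_critical_point G h (torus_eigenvalue k G) (gauge_class G M)"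
    unfolding M_def
    by (rule torus_critical_point_magnetic[OF h(1) \<alpha>S k1])
      (use count xE x0 real in \<open>simp_all add: M_def V_def del: magnetic_nth\<close>)
  have supp: "vec_support y = V_N" if y: "y \<in> eigenspace V M \<mu>" "y \<noteq> 0" for y
  proof -
    obtain a where a: "y = a *s x" by (rule eigenspace_singleton[OF count(2) xE x0 y(1)])
    then have "a \<noteq> 0" using y(2) by auto
    then show ?thesis using x_supp by (auto simp: a vec_support_def)
  qed
  show ?thesis unfolding Let_def k_def[symmetric]
  proof (rule exI[of _ h], rule exI[of _ \<alpha>], intro conjI h(1) gen \<alpha>S)
    show "norm (principal_submatrix h V_N - h_N) < \<epsilon>" "norm (principal_submatrix h V_ZN - h_ZN) < \<epsilon>"
      "norm (principal_submatrix h V_ZZ - h_ZZ) < \<epsilon>"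
      using block_near[of V_N] block_near[of V_ZN] block_near[of V_ZZ] \<eta>(2) unfolding blocks by linarith+
    note count3 = count(3)[unfolded M_def V_def]
    show "torus_critical_point G h (torus_eigenvalue k G) (gauge_class G (magnetic h \<alpha>))"
      using crit by (simp add: M_def)
    show "simple_eigenvalue (verts G) (magnetic h \<alpha>) (eigenvalue_nth k (verts G) (magnetic h \<alpha>))"
      using count(2) count3 by (simp add: M_def V_def simple_eigenvalue_def)
    show "\<forall>x\<in>eigenspace (verts G) (magnetic h \<alpha>) (eigenvalue_nth k (verts G) (magnetic h \<alpha>)). x \<noteq> 0 \<longrightarrow> vec_support x = V_N"
      using supp count3 by (simp add: M_def V_def)
  qed
qed

end
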